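(* Let $\mathfrak{N}$ be a subset of the space of affine transformations of $\mathbb{R}^d$ such that $\mathcal{G}=\{e^{t\nu}:t\in\mathbb{R},\nu\in\mathfrak{N}\}$ is a commutative group of volume-preserving transformations. Suppose that $W$, this $\mathcal{G}$, $K$, $L=\{L_t\}$, $u_0$ and $f$ satisfy conditions (W1)-(W4) and (i)-(iv) listed in the context. Then, for any $n\ge1$ and any $\mu^{(1)},\dots,\mu^{(n)}\in B((0,T),\mathfrak{N})$, and for any $h\in B((0,T),\mathcal{G})$, the equation $$u_t(x)=u_0(x)+\int_0^t\Big[L_r^*u_r(x)+\sum_{i=1}^nM_{\mu^{(i)}_r}u_r(x)+(h_rf_r)(x)\Big]dr,\quad t\in[0,T],\ x\in\mathbb{R}^d,$$ has a solution $u\in W$, in the weak sense: for all $\zeta\in C_0^\infty(\mathbb{R}^d)$ and $t\in[0,T]$, $$(u_t,\zeta)=(u_0,\zeta)+\int_0^t\Big(u_s,L_s\zeta+\sum_{i=1}^nM_{\mu^{(i)}_s}\zeta\Big)ds+\int_0^t(h_sf_s,\zeta)\,ds.$$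
   Context: Fix $T\in(0,\infty)$, $K\in[0,\infty)$, $d\ge1$. $B(\mathbb{R}^d)$ is the space of bounded real Borel functions on $\mathbb{R}^d$, $B((0,T)\times\mathbb{R}^d)$ that of bounded real Borel functions on $(0,T)\times\mathbb{R}^d$; $(\phi,\psi)=\int_{\mathbb{R}^d}\phi\psi\,dx$. $W$ is a set of real-valued Borel functions $u=u_t(x)$ on $[0,T]\times\mathbb{R}^d$. For a function $\phi$ on $\mathbb{R}^d$ and a transformation $g$ of $\mathbb{R}^d$, $(g\phi)(x)=\phi(gx)$. An affine map $x\mapsto a x+b$ is identified with $(a,b)$; measurability and boundedness of functions with values in affine maps refer to this identification (norm $|a|+|b|$). $B((0,T),\mathcal{G})$ and $B((0,T),\mathfrak{N})$ are the sets of bounded measurable functions on $(0,T)$ with values in $\mathcal{G}$, respectively $\mathfrak{N}$. $f\in B((0,T)\times\mathbb{R}^d)$ and $u_0\in B(\mathbb{R}^d)$ are fixed. $L=\{L_t,t\in(0,T)\}$ is a family of linear operators $L_t:C_0^\infty(\mathbb{R}^d)\to B(\mathbb{R}^d)$; $L_t^*$ denotes the formal adjoint. For an affine map $\nu$, $e^{t\nu}$ is the transformation $g(t)$ that is the unique solution of $g(t)=1+\int_0^t\nu g(s)\,ds$, i.e. $g(t)x=x+\int_0^t\nu(g(s)x)\,ds$. For $\nu\in\mathfrak{N}$, $$M_\nu\phi(x)=\lim_{\varepsilon\downarrow0}\varepsilon^{-2}[\phi(e^{\varepsilon\nu}x)-2\phi(x)+\phi(e^{-\varepsilon\nu}x)]$$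 whenever the limit exists for all $x$; it exists for twice continuously differentiable $\phi$. Since the elements of $\mathcal{G}$ are volume-preserving, $M_\nu$ is formally self-adjoint. Conditions on $W$: (W1) $\sup_{[0,T]\times\mathbb{R}^d}|u_t(x)|\le K$ for every $u\in W$. (W2) If $(\Omega,\mathcal{F},P)$ is a probability space and $u(\omega)=u_t(\omega,x)$ is an $\mathcal{F}\times\mathcal{B}([0,T]\times\mathbb{R}^d)$-measurable function with $u(\omega)\in W$ for every $\omega$, then $E[u_t(x)]$ belongs to $W$. (W3) For $u\in W$ and any bounded measurable $\mathcal{G}$-valued function $g_t$ on $[0,T]$, the function $u_t(g_tx)$ is in $W$. (W4) For any sequence $u^k\in W$ and bounded function $u=u_t(x)$ on $[0,T]\times\mathbb{R}^d$ such that $\int_{\mathbb{R}^d}u^k_t\zeta\,dx\to\int_{\mathbb{R}^d}u_t\zeta\,dx$ for any $t\in[0,T]$ and $\zeta\in C_0^\infty(\mathbb{R}^d)$, there exists $w\in W$ such that $w_t=u_t$ a.e. on $\mathbb{R}^d$ for any $t\in[0,T]$. Conditions on $(L,f)$: (i) $gL_t=L_tg$ for any $t\in(0,T)$, $g\in\mathcal{G}$; (ii) for any $\zeta\in C_0^\infty(\mathbb{R}^d)$, $L_t\zeta(x)$ is measurable in $(t,x)$ and $\int_{[0,T]\times\mathbb{R}^d}|L_t\zeta(x)|\,dt\,dx<\infty$; (iii) there is a mapping $B((0,T),\mathcal{G})\to W$, $h\mapsto u[h]$, such that for $u=u[h]$, all $\zeta\in C_0^\infty(\mathbb{R}^d)$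 and $t\in[0,T]$, $(u_t,\zeta)=(u_0,\zeta)+\int_0^t(u_s,L_s\zeta)\,ds+\int_0^t(h_sf_s,\zeta)\,ds$; (iv) for any $h',h''\in B((0,T),\mathcal{G})$ and $(t,x)\in[0,T]\times\mathbb{R}^d$, $|u_t[h'](x)-u_t[h''](x)|\le K\int_0^t\sup_{y\in\mathbb{R}^d}|f_r(h'_ry)-f_r(h''_ry)|\,dr$. *)

theory Defs
  imports "HOL-Analysis.Analysis" "HOL-Probability.Probability" "HOL-Algebra.Group"
begin

section \<open>Function spaces\<close>

text \<open>A function on \<open>[0,T] \<times> \<real>\<^sup>d\<close> whose identity as an element of a set matters
  is an \<^const>\<open>extensional\<close> function on \<open>strip T\<close>, so that HOL equality of such functions is
  equality on the strip.\<close>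

definition strip :: "real \<Rightarrow> (real \<times> (real ^ 'n)) set" where
  "strip T = {0..T} \<times> UNIV"

definition bdd_borel_on :: "'a::topological_space set \<Rightarrow> ('a \<Rightarrow> real) set" where
  "bdd_borel_on A = {f. f \<in> borel_measurable (restrict_space borel A) \<and> bounded (f ` A)}"

text \<open>\<open>Ck k\<close>: \<open>k\<close> times continuously differentiable.\<close>

primrec Ck :: "nat \<Rightarrow> (real ^ 'n \<Rightarrow> real) \<Rightarrow> bool" where
  "Ck 0 \<phi> \<longleftrightarrow> continuous_on UNIV \<phi>"
| "Ck (Suc k) \<phi> \<longleftrightarrow> (\<forall>x. \<phi> differentiable (at x)) \<and>
     (\<forall>v. Ck k (\<lambda>x. frechet_derivative \<phi> (at x) v))"

definition C0_inf :: "(real ^ 'n \<Rightarrow> real) set" where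
  "C0_inf = {\<phi>. (\<forall>k. Ck k \<phi>) \<and> compact (closure {x. \<phi> x \<noteq> 0})}"

definition pairing :: "(real ^ 'n \<Rightarrow> real) \<Rightarrow> (real ^ 'n \<Rightarrow> real) \<Rightarrow> real" where
  "pairing \<phi> \<psi> = (LINT x|lborel. \<phi> x * \<psi> x)"


section \<open>Affine transformations and their exponentials\<close>

definition affine_maps :: "(real ^ 'n \<Rightarrow> real ^ 'n) set" where
  "affine_maps = {g. \<exists>a b. g = (\<lambda>x. a *v x + b)}"

text \<open>For \<open>g x = a *v x + b\<close> this is the pair \<open>(a, b)\<close>.\<close>

definition affine_coords :: "(real ^ 'n \<Rightarrow> real ^ 'n) \<Rightarrow> (real ^ 'n ^ 'n) \<times> (real ^ 'n)" where
  "affine_coords g = (matrix (\<lambda>x. g x - g 0), g 0)"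

text \<open>The set \<open>B(I, X)\<close> of bounded measurable functions on \<open>I\<close> with values in a set \<open>X\<close> of
  affine maps.\<close>

definition bdd_meas_maps ::
    "real set \<Rightarrow> (real ^ 'n \<Rightarrow> real ^ 'n) set \<Rightarrow> (real \<Rightarrow> real ^ 'n \<Rightarrow> real ^ 'n) set" where
  "bdd_meas_maps I X = {g. g \<in> I \<rightarrow>\<^sub>E X \<and>
     (\<lambda>t. affine_coords (g t)) \<in> borel_measurable (restrict_space borel I) \<and>
     (\<exists>C. \<forall>t\<in>I. norm (fst (affine_coords (g t))) + norm (snd (affine_coords (g t))) \<le> C)}"

text \<open>\<open>aff_exp \<nu> t\<close> is \<open>e\<^sup>t\<^sup>\<nu>\<close>. The integrability clause says that the integral
  makes sense; for \<open>t < 0\<close> the integral from \<open>0\<close> to \<open>t\<close> is oriented.\<close>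

definition aff_exp :: "(real ^ 'n \<Rightarrow> real ^ 'n) \<Rightarrow> real \<Rightarrow> real ^ 'n \<Rightarrow> real ^ 'n" where
  "aff_exp \<nu> = (THE g. \<forall>t x.
     interval_lebesgue_integrable lborel (ereal 0) (ereal t) (\<lambda>s. \<nu> (g s x)) \<and>
     g t x = x + (LBINT s=ereal 0..ereal t. \<nu> (g s x)))"

definition volume_preserving :: "(real ^ 'n \<Rightarrow> real ^ 'n) \<Rightarrow> bool" where
  "volume_preserving g \<longleftrightarrow> g \<in> borel_measurable borel \<and> distr lborel borel g = lborel"

definition exp_set :: "(real ^ 'n \<Rightarrow> real ^ 'n) set \<Rightarrow> (real ^ 'n \<Rightarrow> real ^ 'n) set" where
  "exp_set N = {aff_exp \<nu> t | t \<nu>. \<nu> \<in> N}"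

text \<open>The operator \<open>M\<^sub>\<nu>\<close>. The value is unspecified where the limit does not exist.\<close>

definition second_diff ::
    "(real ^ 'n \<Rightarrow> real ^ 'n) \<Rightarrow> (real ^ 'n \<Rightarrow> real) \<Rightarrow> real ^ 'n \<Rightarrow> real" where
  "second_diff \<nu> \<phi> x = Lim (at_right 0)
     (\<lambda>\<epsilon>. (\<phi> (aff_exp \<nu> \<epsilon> x) - 2 * \<phi> x + \<phi> (aff_exp \<nu> (- \<epsilon>) x)) / \<epsilon>\<^sup>2)"


section \<open>Conditions on the function class\<close>

definition uniformly_bounded_class :: "real \<Rightarrow> real \<Rightarrow> (real \<times> (real ^ 'n) \<Rightarrow> real) set \<Rightarrow> bool" where
  "uniformly_bounded_class T K W \<longleftrightarrow> (\<forall>u\<in>W. \<forall>p\<in>strip T. \<bar>u p\<bar> \<le> K)"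

text \<open>In the next definition the sample space is an arbitrary subset of \<open>nat \<Rightarrow> real\<close> carrying
  an arbitrary \<open>\<sigma>\<close>-algebra and probability measure. This covers probability spaces over all
  types: a jointly measurable \<open>u\<close> is measurable with respect to a countably generated
  sub-\<open>\<sigma>\<close>-algebra \<open>\<sigma>(A\<^sub>0, A\<^sub>1, \<dots>)\<close> of events, hence factors through the map sending
  \<open>\<omega>\<close> to the sequence of the indicators of the \<open>A\<^sub>i\<close>, and one may replace the sample space
  by the image of that map with the image \<open>\<sigma>\<close>-algebra and measure; neither the functions
  \<open>u(\<omega>)\<close> nor the expectation change.\<close>

definition closed_under_expectation :: "real \<Rightarrow> (real \<times> (real ^ 'n) \<Rightarrow> real) set \<Rightarrow> bool" where
  "closed_under_expectation T W \<longleftrightarrow> (\<forall>(P :: (nat \<Rightarrow> real) measure) u. prob_space P \<longrightarrow>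
     (\<lambda>(\<omega>, p). u \<omega> p) \<in> borel_measurable (P \<Otimes>\<^sub>M restrict_space borel (strip T)) \<longrightarrow>
     (\<forall>\<omega>\<in>space P. u \<omega> \<in> W) \<longrightarrow>
     restrict (\<lambda>p. LINT \<omega>|P. u \<omega> p) (strip T) \<in> W)"

definition closed_under_transformations ::
    "real \<Rightarrow> (real ^ 'n \<Rightarrow> real ^ 'n) set \<Rightarrow> (real \<times> (real ^ 'n) \<Rightarrow> real) set \<Rightarrow> bool" where
  "closed_under_transformations T G W \<longleftrightarrow> (\<forall>u\<in>W. \<forall>g\<in>bdd_meas_maps {0..T} G.
     restrict (\<lambda>(t, x). u (t, g t x)) (strip T) \<in> W)"

text \<open>Each \<open>u\<^sub>t\<close> is Borel here, so that the integrals of \<open>u\<^sub>t \<zeta>\<close> make sense; since the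
  conclusion only concerns \<open>u\<^sub>t\<close> up to null sets, Lebesgue measurable \<open>u\<^sub>t\<close> would give the
  same condition.\<close>

definition closed_under_weak_limits :: "real \<Rightarrow> (real \<times> (real ^ 'n) \<Rightarrow> real) set \<Rightarrow> bool" where
  "closed_under_weak_limits T W \<longleftrightarrow> (\<forall>(U :: nat \<Rightarrow> real \<times> (real ^ 'n) \<Rightarrow> real) u.
     (\<forall>k. U k \<in> W) \<longrightarrow> bounded (u ` strip T) \<longrightarrow>
     (\<forall>t\<in>{0..T}. (\<lambda>x. u (t, x)) \<in> borel_measurable borel) \<longrightarrow>
     (\<forall>t\<in>{0..T}. \<forall>\<zeta>\<in>C0_inf.
        (\<lambda>k. pairing (\<lambda>x. U k (t, x)) \<zeta>) \<longlonglongrightarrow> pairing (\<lambda>x. u (t, x)) \<zeta>) \<longrightarrow>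
     (\<exists>w\<in>W. \<forall>t\<in>{0..T}. AE x in lborel. w (t, x) = u (t, x)))"


section \<open>Conditions on the operators and the free term\<close>

text \<open>The weak form of \<open>u\<^sub>t = u\<^sub>0 + \<integral>\<^sub>0\<^sup>t (A\<^sub>s\<^sup>* u\<^sub>s + F\<^sub>s) ds\<close>, \<open>t \<in> [0,T]\<close>, where
  \<open>A s\<close> acts on test functions.\<close>

definition weak_solution ::
    "real \<Rightarrow> (real \<Rightarrow> (real ^ 'n \<Rightarrow> real) \<Rightarrow> real ^ 'n \<Rightarrow> real) \<Rightarrow> (real ^ 'n \<Rightarrow> real) \<Rightarrow>
     (real \<Rightarrow> real ^ 'n \<Rightarrow> real) \<Rightarrow> (real \<times> (real ^ 'n) \<Rightarrow> real) \<Rightarrow> bool" where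
  "weak_solution T A u0 F u \<longleftrightarrow> (\<forall>\<zeta>\<in>C0_inf. \<forall>t\<in>{0..T}.
     pairing (\<lambda>x. u (t, x)) \<zeta> = pairing u0 \<zeta>
       + (LBINT s:{0<..<t}. pairing (\<lambda>x. u (s, x)) (A s \<zeta>))
       + (LBINT s:{0<..<t}. pairing (F s) \<zeta>))"

definition operator_family ::
    "real \<Rightarrow> (real \<Rightarrow> (real ^ 'n \<Rightarrow> real) \<Rightarrow> real ^ 'n \<Rightarrow> real) \<Rightarrow> bool" where
  "operator_family T L \<longleftrightarrow> (\<forall>t\<in>{0<..<T}.
     (\<forall>\<phi>\<in>C0_inf. L t \<phi> \<in> bdd_borel_on UNIV) \<and>
     (\<forall>\<phi>\<in>C0_inf. \<forall>\<psi>\<in>C0_inf. \<forall>a b.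
        L t (\<lambda>x. a * \<phi> x + b * \<psi> x) = (\<lambda>x. a * L t \<phi> x + b * L t \<psi> x)))"

definition commutes_with :: "real \<Rightarrow> (real ^ 'n \<Rightarrow> real ^ 'n) set \<Rightarrow>
     (real \<Rightarrow> (real ^ 'n \<Rightarrow> real) \<Rightarrow> real ^ 'n \<Rightarrow> real) \<Rightarrow> bool" where
  "commutes_with T G L \<longleftrightarrow>
     (\<forall>t\<in>{0<..<T}. \<forall>g\<in>G. \<forall>\<zeta>\<in>C0_inf. L t \<zeta> \<circ> g = L t (\<zeta> \<circ> g))"

definition integrable_on_test_functions ::
    "real \<Rightarrow> (real \<Rightarrow> (real ^ 'n \<Rightarrow> real) \<Rightarrow> real ^ 'n \<Rightarrow> real) \<Rightarrow> bool" where
  "integrable_on_test_functions T L \<longleftrightarrow> (\<forall>\<zeta>\<in>C0_inf.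
     (\<lambda>(t, x). L t \<zeta> x) \<in> borel_measurable (restrict_space borel ({0<..<T} \<times> UNIV)) \<and>
     set_integrable lborel ({0<..<T} \<times> UNIV) (\<lambda>(t, x). L t \<zeta> x))"

text \<open>The supremum below is measurable in \<open>r\<close> with respect to the Lebesgue, but in general not
  the Borel, \<open>\<sigma>\<close>-algebra; hence the integral with respect to \<^const>\<open>lebesgue\<close>.\<close>

definition solution_map ::
    "real \<Rightarrow> real \<Rightarrow> (real ^ 'n \<Rightarrow> real ^ 'n) set \<Rightarrow> (real \<times> (real ^ 'n) \<Rightarrow> real) set \<Rightarrow>
     (real \<Rightarrow> (real ^ 'n \<Rightarrow> real) \<Rightarrow> real ^ 'n \<Rightarrow> real) \<Rightarrow> (real ^ 'n \<Rightarrow> real) \<Rightarrow>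
     (real \<times> (real ^ 'n) \<Rightarrow> real) \<Rightarrow>
     ((real \<Rightarrow> real ^ 'n \<Rightarrow> real ^ 'n) \<Rightarrow> real \<times> (real ^ 'n) \<Rightarrow> real) \<Rightarrow> bool" where
  "solution_map T K G W L u0 f U \<longleftrightarrow>
     (\<forall>h\<in>bdd_meas_maps {0<..<T} G.
        U h \<in> W \<and> weak_solution T L u0 (\<lambda>s x. f (s, h s x)) (U h)) \<and>
     (\<forall>h'\<in>bdd_meas_maps {0<..<T} G. \<forall>h''\<in>bdd_meas_maps {0<..<T} G. \<forall>t\<in>{0..T}. \<forall>x.
        \<bar>U h' (t, x) - U h'' (t, x)\<bar>
          \<le> K * (LINT r:{0<..<t}|lebesgue. (SUP y. \<bar>f (r, h' r y) - f (r, h'' r y)\<bar>)))"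

end

theory Submission
  imports Defs "HOL-Library.Diagonal_Subsequence"
begin

text \<open>
  The idea is to produce the second order terms by a random motion inside the group. Let \<open>g\<close> be a
  path in \<open>G\<close> that only changes by finitely many jumps, and let \<open>u\<close> solve the given equation, without
  the operators \<open>M\<close>, for the free term \<open>f (s, h\<^sub>s (g\<^sub>s x))\<close>. Since \<open>L\<close> commutes with \<open>G\<close> and \<open>G\<close>
  preserves Lebesgue measure, \<open>v\<^sub>t x = u\<^sub>t (g\<^sub>t\<^sup>-\<^sup>1 x)\<close> solves the equation with free term
  \<open>f (s, h\<^sub>s x)\<close> between the jumps, while a jump of \<open>g\<close> by \<open>\<gamma>\<close> replaces \<open>(v, \<zeta>)\<close> by
  \<open>(v, \<zeta> \<circ> \<gamma>)\<close> (\<open>walk_equation\<close>). Now let the jumps be \<open>e\<^sup>\<epsilon>\<^sup>\<nu>\<close> or \<open>e\<^sup>-\<^sup>\<epsilon>\<^sup>\<nu>\<close> with equal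
  probability, at the points of a deterministic time grid. By condition (iv) the solution just before
  a jump does not depend on that jump or on later ones (\<open>U_nonanticipating\<close>). Hence in the mean the
  jump tests \<open>v\<close> against \<open>(\<zeta> \<circ> e\<^sup>\<epsilon>\<^sup>\<nu> + \<zeta> \<circ> e\<^sup>-\<^sup>\<epsilon>\<^sup>\<nu>) / 2 - \<zeta>\<close>, which is nearly
  \<open>\<epsilon>\<^sup>2 / 2\<close> times \<open>M\<^sub>\<nu> \<zeta>\<close>, with an error that is uniform in space and
  supported in one ball (\<open>second_difference_uniform\<close>). The mean \<open>w\<close> of \<open>v\<close> over all walks belongs
  to \<open>W\<close> by (W2) and (W3) (\<open>averaged_walk_exists\<close>). When \<open>\<epsilon>\<^sup>2\<close> is proportional to the
  time step, the sum over the jumps approximates \<open>\<integral> (w\<^sub>s, M\<^sub>\<nu> \<zeta>) ds\<close>, and \<open>w\<close> is an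
  approximate weak solution of the equation with \<open>M\<^sub>\<nu>\<close>.

  Condition (iv) gives no continuity of the solution map in the jumps themselves: for a merely Borel
  \<open>f\<close> two different transformations may be far apart in the supremum that occurs there. The probability
  space is therefore kept finite, so that no measurability in the random parameter has to be
  checked. This is possible when the directions come from a finite set and only their weights depend
  on time: the weights enter through the size of the jumps
  (\<open>finitely_many_directions\<close>). Arbitrary measurable directions are uniform limits of
  finite-valued ones, because a bounded set of affine maps is totally bounded
  (\<open>finite_valued_approximation\<close>).

  Both passages to the limit use the same compactness result,
  \<open>weak_solution_of_approximate_solutions\<close>. Bounded functions on \<open>\<real>\<^sup>d\<close> are weakly sequentially compact
  against integrable functions (\<open>convergent_pairing_subsequence\<close>, \<open>weak_limit_lborel\<close>); the equation
  makes \<open>t \<mapsto> (u\<^sub>t, \<zeta>)\<close> equicontinuous, so that one subsequence converges at all times; (W4) puts the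
  limit into \<open>W\<close>. To pass to the limit in \<open>(u\<^sub>s, L\<^sub>s \<zeta>)\<close>, where \<open>L\<^sub>s \<zeta>\<close> is only integrable,
  convergence against test functions is upgraded to convergence against integrable functions
  (\<open>weak_convergence_from_test_functions\<close>), which rests on explicit smooth functions that increase
  to the indicator of a box (\<open>box_bump_tendsto\<close>).
\<close>

section \<open>Smooth functions of compact support\<close>

lemma Ck_SucI:
  assumes "\<And>x. (\<phi> has_derivative \<phi>' x) (at x)" "\<And>v. Ck k (\<lambda>x. \<phi>' x v)"
  shows "Ck (Suc k) \<phi>"
proof -
  have "frechet_derivative \<phi> (at x) = \<phi>' x" for x
    using frechet_derivative_at[OF assms(1)] by metis
  then show ?thesis
    using assms by (auto simp: differentiable_def)
qed

lemma Ck_SucD_has_derivative: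
  "Ck (Suc k) \<phi> \<Longrightarrow> (\<phi> has_derivative frechet_derivative \<phi> (at x)) (at x)"
  by (simp add: frechet_derivative_works[symmetric])

lemma Ck_continuous: "Ck k \<phi> \<Longrightarrow> continuous_on UNIV \<phi>"
  by (cases k) (auto intro!: differentiable_imp_continuous_on simp: differentiable_on_def
      intro: differentiable_at_withinI)

lemma Ck_SucD: "Ck (Suc k) \<phi> \<Longrightarrow> Ck k \<phi>"
proof (induction k arbitrary: \<phi>)
  case 0
  then show ?case using Ck_continuous[OF 0] by simp
next
  case (Suc k)
  have "Ck k (\<lambda>x. frechet_derivative \<phi> (at x) v)" for v
    using Suc.prems by (intro Suc.IH) auto
  then show ?case using Suc.prems by auto
qed

lemma Ck_const: "Ck k (\<lambda>x. c)"
proof (induction k arbitrary: c)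
  case (Suc k)
  show ?case by (rule Ck_SucI[where \<phi>'="\<lambda>_ _. 0"]) (use Suc in auto)
qed simp

lemma Ck_linear:
  assumes "linear l" shows "Ck k (\<lambda>x. l x + c)"
proof (cases k)
  case 0
  have "continuous_on UNIV l"
    using assms by (simp add: linear_conv_bounded_linear linear_continuous_on)
  then show ?thesis
    using 0 by (auto intro!: continuous_on_add continuous_on_const)
next
  case (Suc k')
  show ?thesis unfolding Suc
    by (rule Ck_SucI[where \<phi>'="\<lambda>_. l"])
       (use assms in \<open>auto intro!: Ck_const derivative_eq_intros simp: linear_conv_bounded_linear bounded_linear_imp_has_derivative\<close>)
qed

lemma Ck_add:
  "Ck k \<phi> \<Longrightarrow> Ck k \<psi> \<Longrightarrow> Ck k (\<lambda>x. \<phi> x + \<psi> x)"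
proof (induction k arbitrary: \<phi> \<psi>)
  case 0
  then show ?case by (auto intro: continuous_intros)
next
  case (Suc k)
  show ?case
    by (rule Ck_SucI[OF has_derivative_add[OF Suc.prems[THEN Ck_SucD_has_derivative]]])
       (use Suc in auto)
qed

lemma Ck_mult:
  "Ck k \<phi> \<Longrightarrow> Ck k \<psi> \<Longrightarrow> Ck k (\<lambda>x. \<phi> x * \<psi> x)"
proof (induction k arbitrary: \<phi> \<psi>)
  case 0
  then show ?case by (auto intro: continuous_intros)
next
  case (Suc k)
  show ?case
    by (rule Ck_SucI[OF has_derivative_mult[OF Suc.prems[THEN Ck_SucD_has_derivative]]])
       (intro Ck_add Suc.IH, use Suc.prems Ck_SucD in auto)
qed

lemma Ck_prod: "(\<And>i. i \<in> I \<Longrightarrow> Ck k (\<phi> i)) \<Longrightarrow> Ck k (\<lambda>x. \<Prod>i\<in>I. \<phi> i x)"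
  by (induction I rule: infinite_finite_induct) (auto intro: Ck_const Ck_mult)

lemma Ck_compose_affine:
  fixes a :: "real^'n^'n" and b :: "real^'n"
  shows "Ck k \<phi> \<Longrightarrow> Ck k (\<lambda>x. \<phi> (a *v x + b))"
proof (induction k arbitrary: \<phi>)
  case 0
  then have "continuous_on UNIV \<phi>" by simp
  moreover have "continuous_on UNIV (\<lambda>x. a *v x + b)"
    by (intro continuous_intros)
  ultimately show ?case
    by (simp, intro continuous_on_compose2[of UNIV \<phi> UNIV "\<lambda>x. a *v x + b"]) auto
next
  case (Suc k)
  have d: "((\<lambda>x. a *v x + b) has_derivative (\<lambda>v. a *v v)) (at x)" for x
    by (auto intro!: derivative_eq_intros bounded_linear_imp_has_derivative
        simp: linear_conv_bounded_linear[symmetric])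
  show ?case
  proof (rule Ck_SucI[where \<phi>'="\<lambda>x v. frechet_derivative \<phi> (at (a *v x + b)) (a *v v)"])
    show "((\<lambda>x. \<phi> (a *v x + b)) has_derivative (\<lambda>v. frechet_derivative \<phi> (at (a *v x + b)) (a *v v))) (at x)" for x
      using has_derivative_compose[OF d Ck_SucD_has_derivative[OF Suc.prems]] .
    show "Ck k (\<lambda>x. frechet_derivative \<phi> (at (a *v x + b)) (a *v v))" for v
      by (rule Suc.IH[of "\<lambda>y. frechet_derivative \<phi> (at y) (a *v v)"]) (use Suc.prems in auto)
  qed
qed

text \<open>The functions \<open>q (1/x) e\<^sup>-\<^sup>1\<^sup>/\<^sup>x\<close> for \<open>x > 0\<close>, continued by \<open>0\<close>. The family over all
polynomials \<open>q\<close> is closed under differentiation, which makes each member smooth.\<close>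

definition flat :: "real poly \<Rightarrow> real \<Rightarrow> real" where
  "flat q x = (if x > 0 then poly q (1/x) * exp (- (1/x)) else 0)"

lemma poly_times_exp_minus_tendsto_0:
  fixes q :: "real poly" shows "((\<lambda>y. poly q y * exp (- y)) \<longlongrightarrow> 0) at_top"
proof -
  have "((\<lambda>y. \<Sum>i\<le>degree q. coeff q i * (y ^ i / exp y)) \<longlongrightarrow> (\<Sum>i\<le>degree q. coeff q i * 0)) at_top"
    by (intro tendsto_sum tendsto_mult tendsto_const tendsto_power_div_exp_0)
  then show ?thesis
    by (simp add: poly_altdef exp_minus sum_distrib_right sum_divide_distrib field_simps)
qed

lemma flat_DERIV:
  "(flat q has_real_derivative flat (monom 1 2 * (q - pderiv q)) x) (at x)"
proof -
  consider "x > 0" | "x < 0" | "x = 0" by linarith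
  then show ?thesis
  proof cases
    case 1
    have "((\<lambda>x. poly q (1/x) * exp (- (1/x))) has_real_derivative
        flat (monom 1 2 * (q - pderiv q)) x) (at x)"
      using 1 by (auto intro!: derivative_eq_intros simp: flat_def poly_monom field_simps power2_eq_square)
    moreover have "eventually (\<lambda>y. y \<in> {0<..}) (nhds x)"
      using 1 by (intro eventually_nhds_in_open) auto
    then have "eventually (\<lambda>y. flat q y = poly q (1/y) * exp (- (1/y))) (nhds x)"
      by eventually_elim (simp add: flat_def)
    ultimately show ?thesis
      by (subst DERIV_cong_ev[OF refl _ refl]) auto
  next
    case 2
    have "eventually (\<lambda>y. y \<in> {..<0}) (nhds x)"
      using 2 by (intro eventually_nhds_in_open) auto
    then have "eventually (\<lambda>y. flat q y = 0) (nhds x)"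
      by eventually_elim (simp add: flat_def)
    then show ?thesis
      using 2 by (subst DERIV_cong_ev[OF refl _ refl]) (auto simp: flat_def)
  next
    case 3
    (* substituting y = 1/h turns the right limit into decay of y q(y) exp(-y) *)
    have "((\<lambda>h. flat q h / h) \<longlongrightarrow> 0) (at 0)"
    proof (rule filterlim_split_at)
      have "((\<lambda>y. poly (monom 1 1 * q) y * exp (- y)) \<longlongrightarrow> 0) at_top"
        by (rule poly_times_exp_minus_tendsto_0)
      then have "((\<lambda>h. poly (monom 1 1 * q) (inverse h) * exp (- inverse h)) \<longlongrightarrow> 0) (at_right 0)"
        by (rule filterlim_compose[OF _ filterlim_inverse_at_top_right])
      moreover have "eventually (\<lambda>h. poly (monom 1 1 * q) (inverse h) * exp (- inverse h) = flat q h / h) (at_right (0::real))"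
        by (auto simp: eventually_at_filter flat_def poly_monom field_simps)
      ultimately show "((\<lambda>h. flat q h / h) \<longlongrightarrow> 0) (at_right 0)"
        by (rule Lim_transform_eventually)
      have "eventually (\<lambda>h. 0 = flat q h / h) (at_left (0::real))"
        by (auto simp: eventually_at_filter flat_def)
      then show "((\<lambda>h. flat q h / h) \<longlongrightarrow> 0) (at_left 0)"
        by (rule Lim_transform_eventually[OF tendsto_const])
    qed
    then show ?thesis using 3 by (simp add: DERIV_def flat_def)
  qed
qed

lemma Ck_flat:
  fixes i :: "'n::finite"
  shows "Ck k (\<lambda>x::real^'n. flat q (c * x $ i + d))"
proof (induction k arbitrary: q)
  case 0
  have "continuous_on UNIV (flat q)"
    by (rule DERIV_continuous_on) (use flat_DERIV in \<open>auto intro: has_field_derivative_at_within\<close>)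
  then have "continuous_on UNIV (\<lambda>x::real^'n. flat q (c * x $ i + d))"
    by (rule continuous_on_compose2[of UNIV "flat q"]) (auto intro!: continuous_intros)
  then show ?case by simp
next
  case (Suc k)
  let ?q = "monom 1 2 * (q - pderiv q)"
  show ?case
  proof (rule Ck_SucI)
    fix x :: "real^'n"
    have "((\<lambda>x::real^'n. c * x $ i + d) has_derivative (\<lambda>v. c * v $ i)) (at x)"
      by (auto intro!: derivative_eq_intros bounded_linear_imp_has_derivative bounded_linear_vec_nth)
    from has_derivative_compose[OF this flat_DERIV[unfolded has_field_derivative_def]]
    show "((\<lambda>x. flat q (c * x $ i + d)) has_derivative
        (\<lambda>v. flat ?q (c * x $ i + d) * (c * v $ i))) (at x)" .
    show "Ck k (\<lambda>x. flat ?q (c * x $ i + d) * (c * v $ i))" for v :: "real^'n"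
      by (intro Ck_mult Suc.IH Ck_const)
  qed
qed

lemma C0_infI:
  "(\<And>k. Ck k \<phi>) \<Longrightarrow> bounded {x. \<phi> x \<noteq> 0} \<Longrightarrow> \<phi> \<in> C0_inf"
  by (simp add: C0_inf_def)

lemma C0_inf_Ck: "\<phi> \<in> C0_inf \<Longrightarrow> Ck k \<phi>"
  by (simp add: C0_inf_def)

lemma C0_inf_bounded_support: "\<phi> \<in> C0_inf \<Longrightarrow> bounded {x. \<phi> x \<noteq> 0}"
  by (auto simp: C0_inf_def dest!: compact_imp_bounded intro: bounded_subset closure_subset)

lemma C0_inf_support:
  assumes "\<phi> \<in> C0_inf" obtains R where "R > 0" "\<And>x. norm x > R \<Longrightarrow> \<phi> x = 0"
proof -
  from C0_inf_bounded_support[OF assms] obtain R where "R > 0" "\<forall>x\<in>{x. \<phi> x \<noteq> 0}. norm x \<le> R"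
    unfolding bounded_pos by blast
  then show ?thesis using that[of R] by force
qed

lemma C0_inf_continuous: "\<phi> \<in> C0_inf \<Longrightarrow> continuous_on A \<phi>"
  using Ck_continuous[OF C0_inf_Ck] continuous_on_subset by blast

lemma C0_inf_borel: "\<phi> \<in> C0_inf \<Longrightarrow> \<phi> \<in> borel_measurable borel"
  using C0_inf_continuous borel_measurable_continuous_onI by blast

lemma C0_inf_integrable:
  assumes "\<phi> \<in> C0_inf" shows "integrable lborel \<phi>"
proof -
  obtain R where R: "\<And>x. norm x > R \<Longrightarrow> \<phi> x = 0" using C0_inf_support[OF assms] by metis
  have "integrable lborel (\<lambda>x. indicator (cball 0 R) x *\<^sub>R \<phi> x)"
    by (rule borel_integrable_compact) (use C0_inf_continuous[OF assms] in auto)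
  also have "(\<lambda>x. indicator (cball 0 R) x *\<^sub>R \<phi> x) = \<phi>"
    using R by (auto simp: indicator_def fun_eq_iff)
  finally show ?thesis .
qed

lemma C0_inf_add: "\<phi> \<in> C0_inf \<Longrightarrow> \<psi> \<in> C0_inf \<Longrightarrow> (\<lambda>x. \<phi> x + \<psi> x) \<in> C0_inf"
proof (rule C0_infI)
  assume *: "\<phi> \<in> C0_inf" "\<psi> \<in> C0_inf"
  then show "Ck k (\<lambda>x. \<phi> x + \<psi> x)" for k by (intro Ck_add C0_inf_Ck)
  have "bounded ({x. \<phi> x \<noteq> 0} \<union> {x. \<psi> x \<noteq> 0})"
    using *[THEN C0_inf_bounded_support] by simp
  then show "bounded {x. \<phi> x + \<psi> x \<noteq> 0}" by (rule bounded_subset) auto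
qed

lemma C0_inf_sum: "(\<And>i. i \<in> I \<Longrightarrow> \<phi> i \<in> C0_inf) \<Longrightarrow> (\<lambda>x. \<Sum>i\<in>I. \<phi> i x) \<in> C0_inf"
  by (induction I rule: infinite_finite_induct)
     (auto intro: C0_inf_add C0_infI[of "\<lambda>_. 0", OF Ck_const])

text \<open>For \<open>q = 1\<close> and \<open>k \<rightarrow> \<infinity>\<close> the functions \<open>flat q (k y)\<close> increase to the indicator of \<open>y > 0\<close> and stay
below \<open>1\<close>; a product of such factors over the faces of a box approximates its indicator.\<close>

definition box_bump :: "real^'n \<Rightarrow> real^'n \<Rightarrow> nat \<Rightarrow> real^'n \<Rightarrow> real" where
  "box_bump a b k x = (\<Prod>i\<in>UNIV. flat 1 (real (Suc k) * (x $ i - a $ i)) * flat 1 (real (Suc k) * (b $ i - x $ i)))"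

lemma flat_1_le: "0 \<le> flat 1 x" "flat 1 x \<le> 1"
  by (auto simp: flat_def)

lemma flat_1_tendsto: "(\<lambda>k. flat 1 (real (Suc k) * y)) \<longlonglongrightarrow> indicator {0<..} y"
proof (cases "y > 0")
  case True
  have "(\<lambda>k. exp (- (inverse (real (Suc k)) * inverse y))) \<longlonglongrightarrow> exp (- (0 * inverse y))"
    by (intro tendsto_intros LIMSEQ_inverse_real_of_nat)
  moreover have "flat 1 (real (Suc k) * y) = exp (- (inverse (real (Suc k)) * inverse y))" for k
    using True mult_pos_pos[of "real (Suc k)" y] by (simp add: flat_def field_simps del: of_nat_Suc)
  ultimately show ?thesis using True by simp
next
  case False
  then have "flat 1 (real (Suc k) * y) = 0" for k
    using mult_nonneg_nonpos[of "real (Suc k)" y] by (auto simp: flat_def not_less)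
  then show ?thesis using False by simp
qed

lemma box_bump_outside:
  assumes "x \<notin> cbox a b" shows "box_bump a b k x = 0"
proof -
  obtain i where i: "x $ i < a $ i \<or> b $ i < x $ i"
    using assms by (auto simp: mem_box_cart not_le)
  have "flat 1 (real (Suc k) * (x $ i - a $ i)) * flat 1 (real (Suc k) * (b $ i - x $ i)) = 0"
    using i mult_pos_neg[of "real (Suc k)" "x $ i - a $ i"] mult_pos_neg[of "real (Suc k)" "b $ i - x $ i"]
    by (auto simp: flat_def simp del: of_nat_Suc)
  then show ?thesis unfolding box_bump_def by (intro prod_zero) (simp, blast)
qed

lemma box_bump_C0_inf: "box_bump a b k \<in> C0_inf"
proof (rule C0_infI)
  have *: "real (Suc k) * (x $ i - a $ i) = real (Suc k) * x $ i + - (real (Suc k) * a $ i)"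
    "real (Suc k) * (b $ i - x $ i) = - real (Suc k) * x $ i + real (Suc k) * b $ i" for x i
    by (simp_all add: algebra_simps)
  show "Ck j (box_bump a b k)" for j
    unfolding box_bump_def * by (intro Ck_prod Ck_mult Ck_flat)
  have "{x. box_bump a b k x \<noteq> 0} \<subseteq> cbox a b"
    using box_bump_outside by blast
  then show "bounded {x. box_bump a b k x \<noteq> 0}"
    using bounded_cbox bounded_subset by blast
qed

lemma box_bump_bounds: "0 \<le> box_bump a b k x" "box_bump a b k x \<le> indicator (cbox a b) x"
proof -
  show "0 \<le> box_bump a b k x"
    unfolding box_bump_def by (intro prod_nonneg) (auto simp: flat_1_le)
  have "box_bump a b k x \<le> 1"
    unfolding box_bump_def by (intro prod_le_1) (auto simp: flat_1_le intro: mult_le_one)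
  moreover have "box_bump a b k x = 0" if "x \<notin> cbox a b"
    using box_bump_outside[OF that] .
  ultimately show "box_bump a b k x \<le> indicator (cbox a b) x"
    by (auto simp: indicator_def)
qed

lemma box_bump_tendsto: "(\<lambda>k. box_bump a b k x) \<longlonglongrightarrow> indicator (box a b) x"
proof -
  have "(\<lambda>k. box_bump a b k x) \<longlonglongrightarrow>
    (\<Prod>i\<in>UNIV. indicator {0<..} (x $ i - a $ i) * indicator {0<..} (b $ i - x $ i))"
    unfolding box_bump_def by (intro tendsto_prod tendsto_mult flat_1_tendsto)
  also have "(\<Prod>i\<in>UNIV. indicator {0<..} (x $ i - a $ i) * indicator {0<..} (b $ i - x $ i)) =
      (indicator (box a b) x :: real)"
    by (auto simp: indicator_def mem_box_cart intro!: prod.neutral)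
  finally show ?thesis .
qed

section \<open>The flow of an affine vector field\<close>

text \<open>For \<open>\<nu> x = a x + b\<close> the flow is \<open>e\<^sup>t\<^sup>\<nu> x = x + \<Sum>\<^sub>k t\<^sup>k\<^sup>+\<^sup>1 / (k+1)! a\<^sup>k (\<nu> x)\<close>. Starting the
series from \<open>\<nu> x\<close> treats the linear and the constant part of \<open>\<nu>\<close> together.\<close>

definition flow_series :: "real^'n^'n \<Rightarrow> real^'n \<Rightarrow> nat \<Rightarrow> real \<Rightarrow> real^'n" where
  "flow_series a y k t = (t ^ Suc k / fact (Suc k)) *\<^sub>R (((*v) a) ^^ k) y"

definition flow :: "real^'n^'n \<Rightarrow> real^'n \<Rightarrow> real \<Rightarrow> real^'n \<Rightarrow> real^'n" where
  "flow a b t x = x + (\<Sum>k. flow_series a (a *v x + b) k t)"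

lemma linear_funpow:
  fixes f :: "'a::real_vector \<Rightarrow> 'a"
  assumes f: "linear f" shows "linear (f ^^ k)"
proof (induction k)
  case (Suc k)
  show ?case
    by (rule linearI) (simp_all add: linear_add[OF Suc] linear_scale[OF Suc] linear_add[OF f] linear_scale[OF f])
qed (simp add: id_def linear_ident)

lemma norm_funpow_le:
  fixes a :: "real^'n^'n"
  shows "norm ((((*v) a) ^^ k) y) \<le> onorm ((*v) a) ^ k * norm y"
proof (induction k)
  case (Suc k)
  have "norm ((((*v) a) ^^ Suc k) y) \<le> onorm ((*v) a) * norm ((((*v) a) ^^ k) y)"
    by (simp add: onorm)
  also have "\<dots> \<le> onorm ((*v) a) * (onorm ((*v) a) ^ k * norm y)"
    by (intro mult_left_mono Suc onorm_pos_le) simp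
  finally show ?case by (simp add: mult_ac)
qed simp

lemma norm_flow_series_le:
  "norm (flow_series a y k t) \<le> \<bar>t\<bar> * norm y * ((\<bar>t\<bar> * onorm ((*v) a)) ^ k /\<^sub>R fact k)"
proof -
  have "norm (flow_series a y k t) \<le> \<bar>t\<bar> ^ Suc k / fact (Suc k) * (onorm ((*v) a) ^ k * norm y)"
    unfolding flow_series_def norm_scaleR
    by (intro mult_mono norm_funpow_le) (auto simp: power_abs abs_mult simp del: fact_Suc)
  also have "\<dots> \<le> \<bar>t\<bar> ^ Suc k / fact k * (onorm ((*v) a) ^ k * norm y)"
    by (intro mult_right_mono divide_left_mono mult_nonneg_nonneg fact_mono zero_le_power onorm_pos_le)
       (auto simp del: fact_Suc)
  also have "\<dots> = \<bar>t\<bar> * norm y * ((\<bar>t\<bar> * onorm ((*v) a)) ^ k /\<^sub>R fact k)"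
    by (simp add: field_simps power_mult_distrib)
  finally show ?thesis .
qed

lemma summable_norm_flow_series: "summable (\<lambda>k. norm (flow_series a y k t))"
  by (rule summable_comparison_test'[OF summable_mult[OF summable_exp_generic], of 0])
     (use norm_flow_series_le in auto)

lemma summable_flow_series: "summable (\<lambda>k. flow_series a y k t)"
  by (rule summable_norm_cancel[OF summable_norm_flow_series])

text \<open>Compared termwise with \<open>\<bar>t\<bar>\<close> times an exponential series; the factor \<open>\<bar>t\<bar>\<close> is what later keeps supports
of transported test functions in a fixed ball.\<close>

lemma norm_flow_minus_id_le:
  "norm (flow a b t x - x) \<le> \<bar>t\<bar> * exp (\<bar>t\<bar> * onorm ((*v) a)) * norm (a *v x + b)"
proof -
  have "norm (flow a b t x - x) \<le> (\<Sum>k. norm (flow_series a (a *v x + b) k t))"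
    unfolding flow_def using summable_norm[OF summable_norm_flow_series] by simp
  also have "\<dots> \<le> (\<Sum>k. \<bar>t\<bar> * norm (a *v x + b) * ((\<bar>t\<bar> * onorm ((*v) a)) ^ k /\<^sub>R fact k))"
    by (intro suminf_le norm_flow_series_le summable_norm_flow_series summable_mult summable_exp_generic)
  also have "\<dots> = \<bar>t\<bar> * norm (a *v x + b) * exp (\<bar>t\<bar> * onorm ((*v) a))"
    unfolding exp_def by (rule suminf_mult[OF summable_exp_generic])
  finally show ?thesis by (simp add: mult_ac)
qed

lemma flow_0: "flow a b 0 x = x"
  by (simp add: flow_def flow_series_def)

lemma linear_flow_series: "linear (\<lambda>y. flow_series a y k t)"
proof -
  have "linear (((*v) a) ^^ k)" by (intro linear_funpow) simp
  then show ?thesis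
    unfolding flow_series_def by (intro linear_compose_scale_right)
qed

lemma flow_affine: "flow a b t \<in> affine_maps"
proof -
  let ?l = "\<lambda>x. \<Sum>k. flow_series a (a *v x) k t"
  have "linear ?l"
  proof (rule linearI)
    show "?l (x + y) = ?l x + ?l y" for x y
      by (simp add: matrix_vector_right_distrib linear_add[OF linear_flow_series]
          suminf_add[OF summable_flow_series summable_flow_series])
    show "?l (c *\<^sub>R x) = c *\<^sub>R ?l x" for c x
      by (simp add: matrix_vector_mult_scaleR linear_scale[OF linear_flow_series]
          suminf_scaleR_right[OF summable_flow_series])
  qed
  then have "linear (\<lambda>x. x + ?l x)" by (intro linear_compose_add linear_ident)
  then have "flow a b t x = matrix (\<lambda>x. x + ?l x) *v x + (\<Sum>k. flow_series a b k t)" for x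
    unfolding flow_def
    by (subst matrix_works, simp add: linear_matrix_vector_mul_eq, simp add: linear_add[OF linear_flow_series] suminf_add[OF summable_flow_series summable_flow_series])
  then show ?thesis unfolding affine_maps_def by blast
qed

lemma vec_eq_sum_axis: "(\<Sum>i\<in>UNIV. (v $ i) *\<^sub>R (axis i 1 :: real^'n)) = v"
  using basis_expansion[of v] by (simp add: scalar_mult_eq_scaleR)

lemma has_vector_derivative_cartI:
  fixes g :: "real \<Rightarrow> real^'n"
  assumes "\<And>i. ((\<lambda>t. g t $ i) has_real_derivative d $ i) (at t)"
  shows "(g has_vector_derivative d) (at t)"
proof -
  have "((\<lambda>t. \<Sum>i\<in>UNIV. (g t $ i) *\<^sub>R (axis i 1 :: real^'n)) has_vector_derivative
      (\<Sum>i\<in>UNIV. d $ i *\<^sub>R (axis i 1 :: real^'n))) (at t)"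
    by (intro has_vector_derivative_sum)
       (use has_vector_derivative_scaleR[OF assms has_vector_derivative_const] in simp)
  then show ?thesis by (simp add: vec_eq_sum_axis)
qed

text \<open>Each coordinate is a real power series in \<open>t\<close> and is differentiated termwise. The derived series
begins with \<open>\<nu> x\<close> and continues with \<open>a\<close> applied to the original one.\<close>

lemma flow_has_vector_derivative:
  fixes a :: "real^'n^'n"
  shows "((\<lambda>t. flow a b t x) has_vector_derivative (a *v flow a b t x + b)) (at t)"
proof (rule has_vector_derivative_cartI)
  fix i
  define y where "y = a *v x + b"
  define P where "P k = (((*v) a) ^^ k) y" for k
  define c where "c n = (case n of 0 \<Rightarrow> 0 | Suc k \<Rightarrow> P k $ i / fact (Suc k))" for n
  have tm: "c (Suc k) * s ^ Suc k = flow_series a y k s $ i" for k s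
    by (simp add: c_def flow_series_def P_def)
  have sm: "summable (\<lambda>k. flow_series a y k s $ i)" for s
    by (rule bounded_linear.summable[OF bounded_linear_vec_nth summable_flow_series])
  have smc: "summable (\<lambda>n. c n * s ^ n)" for s
    using sm[of s] by (subst summable_Suc_iff[symmetric]) (simp only: tm)
  have sum_eq: "(\<Sum>n. c n * s ^ n) = flow a b s x $ i - x $ i" for s
  proof -
    have "(\<Sum>n. c n * s ^ n) = (\<Sum>n. c (Suc n) * s ^ Suc n)"
      using suminf_split_head[OF smc[of s]] by (simp add: c_def)
    also have "\<dots> = (\<Sum>k. flow_series a y k s) $ i"
      unfolding tm by (rule bounded_linear.suminf[OF bounded_linear_vec_nth summable_flow_series, symmetric])
    finally show ?thesis by (simp add: flow_def y_def)
  qed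
  have d: "diffs c n = P n $ i / fact n" for n
    by (simp add: diffs_def c_def field_simps del: of_nat_Suc)
  have "((\<lambda>s. \<Sum>n. c n * s ^ n) has_real_derivative (\<Sum>n. diffs c n * t ^ n)) (at t)"
    by (rule termdiffs_strong_converges_everywhere[OF smc])
  moreover have "(\<Sum>n. diffs c n * t ^ n) = (a *v flow a b t x + b) $ i"
  proof -
    have "(\<lambda>n. c n * s ^ n) sums (\<Sum>n. c n * s ^ n)" for s using smc by (rule summable_sums)
    have smd: "summable (\<lambda>n. diffs c n * t ^ n)"
      using termdiff_converges_all[OF smc] .
    have st: "diffs c (Suc k) * t ^ Suc k = (a *v flow_series a y k t) $ i" for k
      by (simp add: d flow_series_def P_def matrix_vector_mult_scaleR del: fact_Suc)
    have bl: "bounded_linear (\<lambda>v. (a *v v) $ i)"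
      using bounded_linear_compose[OF bounded_linear_vec_nth[of i] matrix_vector_mul_bounded_linear[of a]]
      by (simp add: o_def)
    have "(\<Sum>n. diffs c n * t ^ n) = diffs c 0 * t ^ 0 + (\<Sum>k. diffs c (Suc k) * t ^ Suc k)"
      using suminf_split_head[OF smd] by simp
    also have "\<dots> = y $ i + (a *v (\<Sum>k. flow_series a y k t)) $ i"
      unfolding st by (subst bounded_linear.suminf[OF bl summable_flow_series]) (simp add: d P_def)
    also have "\<dots> = (a *v flow a b t x + b) $ i"
      by (simp add: flow_def y_def matrix_vector_right_distrib)
    finally show ?thesis .
  qed
  ultimately have "((\<lambda>s. flow a b s x $ i - x $ i) has_real_derivative (a *v flow a b t x + b) $ i) (at t)"
    by (simp add: sum_eq)
  from DERIV_add[OF this DERIV_const[of "x $ i"]]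
  show "((\<lambda>s. flow a b s x $ i) has_real_derivative (a *v flow a b t x + b) $ i) (at t)" by simp
qed

text \<open>Gronwall: \<open>\<bar>d s\<bar>\<^sup>2 e\<^sup>-\<^sup>2\<^sup>B\<^sup>s\<close> is nonincreasing, \<open>B\<close> being the operator norm of \<open>f\<close>.\<close>

lemma linear_ode_zero_nonneg:
  fixes d :: "real \<Rightarrow> 'a::euclidean_space"
  assumes d: "\<And>s. 0 \<le> s \<Longrightarrow> s \<le> t \<Longrightarrow> (d has_vector_derivative f (d s)) (at s)"
    and f: "bounded_linear f" and "d 0 = 0" "0 \<le> t"
  shows "d t = 0"
proof -
  define B where "B = onorm f"
  define e where "e s = (d s \<bullet> d s) * exp (- 2 * B * s)" for s
  have "e t \<le> e 0"
  proof (rule DERIV_nonpos_imp_nonincreasing[OF \<open>0 \<le> t\<close>])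
    fix s assume s: "0 \<le> s" "s \<le> t"
    have "((\<lambda>s. d s \<bullet> d s) has_real_derivative 2 * (d s \<bullet> f (d s))) (at s)"
      using has_derivative_inner[OF d[OF s, unfolded has_vector_derivative_def] d[OF s, unfolded has_vector_derivative_def]]
      unfolding has_field_derivative_def
      by (rule has_derivative_eq_rhs) (auto simp: fun_eq_iff inner_commute)
    then have "(e has_real_derivative (2 * (d s \<bullet> f (d s)) - 2 * B * (d s \<bullet> d s)) * exp (- 2 * B * s)) (at s)"
      unfolding e_def by (auto intro!: derivative_eq_intros simp: algebra_simps)
    moreover have "d s \<bullet> f (d s) \<le> B * (d s \<bullet> d s)"
    proof -
      have "d s \<bullet> f (d s) \<le> norm (d s) * norm (f (d s))" by (rule norm_cauchy_schwarz)
      also have "\<dots> \<le> norm (d s) * (B * norm (d s))"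
        unfolding B_def by (intro mult_left_mono onorm f) auto
      finally show ?thesis by (simp add: power2_norm_eq_inner[symmetric] power2_eq_square mult_ac)
    qed
    then have "(2 * (d s \<bullet> f (d s)) - 2 * B * (d s \<bullet> d s)) * exp (- 2 * B * s) \<le> 0"
      by (intro mult_nonpos_nonneg) auto
    ultimately show "\<exists>y. (e has_real_derivative y) (at s) \<and> y \<le> 0" by blast
  qed
  then have "d t \<bullet> d t \<le> 0" using \<open>d 0 = 0\<close> by (simp add: e_def mult_le_0_iff)
  then show ?thesis using inner_ge_zero[of "d t"] by (simp del: inner_ge_zero)
qed

lemma linear_ode_zero:
  fixes d :: "real \<Rightarrow> 'a::euclidean_space"
  assumes d: "\<And>s. (d has_vector_derivative f (d s)) (at s)"
    and f: "bounded_linear f" and "d 0 = 0"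
  shows "d t = 0"
proof (cases "0 \<le> t")
  case True
  show ?thesis by (rule linear_ode_zero_nonneg[OF d f \<open>d 0 = 0\<close> True])
next
  case False
  have "((\<lambda>s. d (- s)) has_vector_derivative - f (d (- s))) (at s)" for s
  proof -
    have "(uminus has_vector_derivative - 1) (at s)"
      by (auto intro!: derivative_eq_intros simp: has_vector_derivative_def)
    from vector_diff_chain_at[OF this d] show ?thesis by (simp add: o_def)
  qed
  from linear_ode_zero_nonneg[of "- t" "\<lambda>s. d (- s)" "\<lambda>v. - f v", OF this bounded_linear_minus[OF f]]
  show ?thesis using False \<open>d 0 = 0\<close> by simp
qed

text \<open>The right-hand side of the integral equation is continuous in \<open>t\<close>, being an indefinite integral. Hence
so is the integrand, and the fundamental theorem of calculus applies.\<close>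

lemma integral_equation_has_vector_derivative:
  fixes G :: "real \<Rightarrow> real^'n"
  assumes I: "\<And>t. interval_lebesgue_integrable lborel (ereal 0) (ereal t) (\<lambda>s. \<nu> (G s))"
    and E: "\<And>t. G t = x + (LBINT s=ereal 0..ereal t. \<nu> (G s))"
    and \<nu>: "continuous_on UNIV \<nu>"
  shows "(G has_vector_derivative \<nu> (G t)) (at t)"
proof -
  define R where "R = \<bar>t\<bar> + 1"
  define w where "w = (\<lambda>s. \<nu> (G s))"
  have R: "0 < R" "- R < t" "t < R" by (auto simp: R_def)
  have "set_integrable lborel {-R<..<0} w" "set_integrable lborel {0<..<R} w"
    using I[of "-R"] I[of R] R by (auto simp: interval_lebesgue_integrable_def w_def)
  moreover have "set_integrable lborel {c} w" for c
  proof -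
    have "(\<lambda>s. indicat_real {c} s *\<^sub>R w s) = (\<lambda>s. indicat_real {c} s *\<^sub>R w c)"
      by (auto simp: indicator_def)
    then show ?thesis by (simp add: set_integrable_def)
  qed
  ultimately have "set_integrable lborel ({-R<..<0} \<union> {0<..<R} \<union> {-R} \<union> {0} \<union> {R}) w"
    by (intro set_integrable_Un) auto
  moreover have "{-R<..<0} \<union> {0<..<R} \<union> {-R} \<union> {0} \<union> {R} = {-R..R}"
    using R by auto
  ultimately have int: "set_integrable lborel {-R..R} w" by simp
  have I2: "interval_lebesgue_integrable lborel (ereal s) (ereal u) w"
    if "s \<in> {-R..R}" "u \<in> {-R..R}" for s u
    using that by (auto simp: interval_lebesgue_integrable_def intro!: set_integrable_subset[OF int])
  have G: "G s = x - integral {-R..0} w + integral {-R..s} w" if "s \<in> {-R..R}" for s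
  proof -
    have "(LBINT r=ereal (-R)..ereal 0. w r) + (LBINT r=ereal 0..ereal s. w r) = (LBINT r=ereal (-R)..ereal s. w r)"
      by (rule interval_integral_sum) (use that R I2[of "-R" "max 0 s"] in \<open>auto simp: min_def max_def zero_ereal_def split: if_splits\<close>)
    moreover have *: "(LBINT r=ereal (-R)..ereal u. w r) = integral {-R..u} w" if "u \<in> {-R..R}" for u
      by (rule interval_integral_eq_integral) (use that in \<open>auto intro!: set_integrable_subset[OF int]\<close>)
    ultimately have "integral {-R..0} w + (LBINT r=ereal 0..ereal s. w r) = integral {-R..s} w"
      using *[of 0] *[of s] that R by simp
    then show ?thesis using E[of s] by (simp add: w_def algebra_simps)
  qed
  have "continuous_on {-R..R} (\<lambda>s. integral {-R..s} w)"
    by (rule indefinite_integral_continuous_1) (use set_borel_integral_eq_integral[OF int] in simp)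
  then have "continuous_on {-R..R} (\<lambda>s. x - integral {-R..0} w + integral {-R..s} w)"
    by (intro continuous_intros)
  then have "continuous_on {-R..R} G"
    by (rule continuous_on_eq) (simp add: G)
  then have cw: "continuous_on {-R..R} w"
    unfolding w_def by (intro continuous_on_compose2[OF \<nu>]) auto
  have "((\<lambda>s. x - integral {-R..0} w + integral {-R..s} w) has_vector_derivative 0 + w t) (at t within {-R..R})"
    by (intro has_vector_derivative_add has_vector_derivative_const integral_has_vector_derivative cw) (use R in auto)
  then have "((\<lambda>s. x - integral {-R..0} w + integral {-R..s} w) has_vector_derivative w t) (at t within {-R..R})"
    by simp
  then have "(G has_vector_derivative w t) (at t within {-R..R})"
    by (rule has_vector_derivative_transform[rotated 2]) (use R G in auto)
  then show ?thesis
    using R by (simp add: w_def at_within_Icc_at)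
qed

text \<open>Existence in the defining description of \<^const>\<open>aff_exp\<close> comes from the series; uniqueness because two
solutions differ by a solution of a linear equation that vanishes at \<open>0\<close>.\<close>

lemma aff_exp_eq_flow:
  fixes a :: "real^'n^'n"
  shows "aff_exp (\<lambda>x. a *v x + b) = flow a b"
  unfolding aff_exp_def
proof (rule the_equality)
  let ?\<nu> = "\<lambda>x. a *v x + b"
  have cont: "continuous_on UNIV ?\<nu>" by (intro continuous_intros)
  have c: "continuous_on A (\<lambda>s. ?\<nu> (flow a b s x))" for x A
    by (intro continuous_on_compose2[OF cont] continuous_at_imp_continuous_on ballI
        has_vector_derivative_continuous[OF flow_has_vector_derivative]) auto
  show "\<forall>t x. interval_lebesgue_integrable lborel (ereal 0) (ereal t) (\<lambda>s. ?\<nu> (flow a b s x)) \<and>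
      flow a b t x = x + (LBINT s=ereal 0..ereal t. ?\<nu> (flow a b s x))"
  proof (intro allI conjI)
    fix t x
    show "interval_lebesgue_integrable lborel (ereal 0) (ereal t) (\<lambda>s. ?\<nu> (flow a b s x))"
      by (rule interval_integrable_isCont) (use c[of UNIV x] in \<open>auto simp: continuous_on_eq_continuous_at\<close>)
    show "flow a b t x = x + (LBINT s=ereal 0..ereal t. ?\<nu> (flow a b s x))"
      by (subst interval_integral_FTC_finite[where F="\<lambda>t. flow a b t x", OF c])
         (auto intro: has_vector_derivative_at_within flow_has_vector_derivative simp: flow_0)
  qed
  fix g assume g: "\<forall>t x. interval_lebesgue_integrable lborel (ereal 0) (ereal t) (\<lambda>s. ?\<nu> (g s x)) \<and>
      g t x = x + (LBINT s=ereal 0..ereal t. ?\<nu> (g s x))"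
  show "g = flow a b"
  proof (intro ext)
    fix t x
    have "((\<lambda>s. g s x) has_vector_derivative ?\<nu> (g s x)) (at s)" for s
      by (rule integral_equation_has_vector_derivative[where \<nu>="?\<nu>" and x=x and G="\<lambda>s. g s x",
            OF g[rule_format, THEN conjunct1] g[rule_format, THEN conjunct2] cont])
    from has_vector_derivative_diff[OF this flow_has_vector_derivative[of a b x]]
    have "((\<lambda>s. g s x - flow a b s x) has_vector_derivative a *v (g s x - flow a b s x)) (at s)" for s
      by (simp add: matrix_vector_mult_diff_distrib)
    moreover have "g 0 x = x"
      using g[rule_format, THEN conjunct2, of 0 x] by (simp add: zero_ereal_def)
    ultimately show "g t x = flow a b t x"
      using linear_ode_zero[of "\<lambda>s. g s x - flow a b s x" "(*v) a" t] by (simp add: flow_0)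
  qed
qed

section \<open>Second differences along affine flows\<close>

definition partial :: "(real^'n \<Rightarrow> real) \<Rightarrow> 'n \<Rightarrow> real^'n \<Rightarrow> real" where
  "partial \<phi> i x = frechet_derivative \<phi> (at x) (axis i 1)"

text \<open>The Lie derivative along the vector field \<open>\<nu>\<close>. For affine \<open>\<nu>\<close>, applying it twice gives \<open>M\<^sub>\<nu>\<close>.\<close>

definition lie :: "(real^'n \<Rightarrow> real^'n) \<Rightarrow> (real^'n \<Rightarrow> real) \<Rightarrow> real^'n \<Rightarrow> real" where
  "lie \<nu> \<phi> x = frechet_derivative \<phi> (at x) (\<nu> x)"

lemma C0_inf_has_derivative:
  "\<phi> \<in> C0_inf \<Longrightarrow> (\<phi> has_derivative frechet_derivative \<phi> (at x)) (at x)"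
  by (rule Ck_SucD_has_derivative[OF C0_inf_Ck[of \<phi> "Suc 0"]])

lemma frechet_derivative_eq_sum_partial:
  assumes "\<phi> \<in> C0_inf"
  shows "frechet_derivative \<phi> (at x) v = (\<Sum>i\<in>UNIV. v $ i * partial \<phi> i x)"
proof -
  have l: "linear (frechet_derivative \<phi> (at x))"
    using C0_inf_has_derivative[OF assms] has_derivative_linear by blast
  have "frechet_derivative \<phi> (at x) v = frechet_derivative \<phi> (at x) (\<Sum>i\<in>UNIV. (v $ i) *\<^sub>R axis i 1)"
    by (simp add: vec_eq_sum_axis)
  also have "\<dots> = (\<Sum>i\<in>UNIV. v $ i * partial \<phi> i x)"
    by (simp add: linear_sum[OF l] linear_scale[OF l] partial_def)
  finally show ?thesis .
qed

lemma lie_eq_sum_partial: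
  "\<phi> \<in> C0_inf \<Longrightarrow> lie \<nu> \<phi> x = (\<Sum>i\<in>UNIV. \<nu> x $ i * partial \<phi> i x)"
  by (simp add: lie_def frechet_derivative_eq_sum_partial)

lemma C0_inf_partial:
  assumes "\<phi> \<in> C0_inf" shows "partial \<phi> i \<in> C0_inf"
proof (rule C0_infI)
  show "Ck k (partial \<phi> i)" for k
    using C0_inf_Ck[OF assms, of "Suc k"] unfolding partial_def[abs_def] by auto
  have "partial \<phi> i x = 0" if "x \<notin> closure {x. \<phi> x \<noteq> 0}" for x
  proof -
    have "(\<phi> has_derivative (\<lambda>_. 0)) (at x)"
      by (rule has_derivative_transform_within_open[OF has_derivative_const[of 0], of "- closure {x. \<phi> x \<noteq> 0}"])
         (use that closure_subset[of "{x. \<phi> x \<noteq> 0}"] in auto)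
    then show ?thesis
      unfolding partial_def using frechet_derivative_at by metis
  qed
  then have "{x. partial \<phi> i x \<noteq> 0} \<subseteq> closure {x. \<phi> x \<noteq> 0}" by auto
  then show "bounded {x. partial \<phi> i x \<noteq> 0}"
    using C0_inf_bounded_support[OF assms] bounded_closure bounded_subset by blast
qed

lemma C0_inf_mult_smooth:
  assumes "\<phi> \<in> C0_inf" "\<And>k. Ck k g" shows "(\<lambda>x. g x * \<phi> x) \<in> C0_inf"
  by (rule C0_infI, intro Ck_mult assms C0_inf_Ck)
     (auto intro: bounded_subset[OF C0_inf_bounded_support[OF assms(1)]])

lemma Ck_affine_component:
  fixes a :: "real^'n^'n"
  shows "Ck k (\<lambda>x. (a *v x + b) $ i)"
proof -
  have "linear (\<lambda>x. (a *v x) $ i)"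
    by (rule linearI) (simp_all add: matrix_vector_right_distrib matrix_vector_mult_scaleR)
  from Ck_linear[OF this, of k "b $ i"] show ?thesis by simp
qed

lemma C0_inf_lie:
  fixes a :: "real^'n^'n"
  assumes "\<phi> \<in> C0_inf" shows "lie (\<lambda>x. a *v x + b) \<phi> \<in> C0_inf"
proof -
  have "lie (\<lambda>x. a *v x + b) \<phi> = (\<lambda>x. \<Sum>i\<in>UNIV. (a *v x + b) $ i * partial \<phi> i x)"
    by (simp add: lie_eq_sum_partial[OF assms] fun_eq_iff)
  then show ?thesis
    by (simp only: C0_inf_sum C0_inf_mult_smooth C0_inf_partial[OF assms] Ck_affine_component)
qed

lemma C0_inf_along_flow:
  fixes a :: "real^'n^'n"
  assumes "\<phi> \<in> C0_inf"
  shows "((\<lambda>t. \<phi> (flow a b t x)) has_real_derivative lie (\<lambda>x. a *v x + b) \<phi> (flow a b t x)) (at t)"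
proof -
  have l: "linear (frechet_derivative \<phi> (at (flow a b t x)))"
    using C0_inf_has_derivative[OF assms] has_derivative_linear by blast
  from has_derivative_compose[OF flow_has_vector_derivative[unfolded has_vector_derivative_def] C0_inf_has_derivative[OF assms]]
  show ?thesis
    unfolding has_field_derivative_def lie_def
    by (rule has_derivative_eq_rhs) (simp add: fun_eq_iff linear_scale[OF l])
qed

lemma norm_flow_minus_id_le_linear:
  fixes a :: "real^'n^'n"
  obtains C where "C > 0" "\<And>t x. \<bar>t\<bar> \<le> 1 \<Longrightarrow> norm (flow a b t x - x) \<le> \<bar>t\<bar> * C * (1 + norm x)"
proof
  let ?B = "onorm ((*v) a)"
  have B: "0 \<le> ?B" by (intro onorm_pos_le) simp
  show "exp ?B * (?B + norm b + 1) > 0" using B by (simp add: add_nonneg_pos)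
  fix t :: real and x :: "real^'n" assume t: "\<bar>t\<bar> \<le> 1"
  have "norm (flow a b t x - x) \<le> \<bar>t\<bar> * exp (\<bar>t\<bar> * ?B) * norm (a *v x + b)"
    by (rule norm_flow_minus_id_le)
  also have "\<dots> \<le> \<bar>t\<bar> * exp ?B * ((?B + norm b + 1) * (1 + norm x))"
  proof (intro mult_mono)
    show "exp (\<bar>t\<bar> * ?B) \<le> exp ?B" using t B by (simp add: mult_left_le_one_le)
    have "norm (a *v x + b) \<le> ?B * norm x + norm b"
      using norm_triangle_ineq[of "a *v x" b] onorm[OF matrix_vector_mul_bounded_linear, of a x] by linarith
    also have "\<dots> \<le> (?B + norm b + 1) * (1 + norm x)"
      using B by (simp add: algebra_simps)
    finally show "norm (a *v x + b) \<le> (?B + norm b + 1) * (1 + norm x)" .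
  qed auto
  finally show "norm (flow a b t x - x) \<le> \<bar>t\<bar> * (exp ?B * (?B + norm b + 1)) * (1 + norm x)"
    by (simp add: mult_ac)
qed

text \<open>Taylor's formula with Lagrange remainder for \<open>t \<mapsto> \<zeta> (e\<^sup>t\<^sup>\<nu> x)\<close> at \<open>\<epsilon>\<close> and \<open>-\<epsilon>\<close>; the first order
terms cancel.\<close>

lemma second_difference_eq_mean:
  fixes a :: "real^'n^'n" and b :: "real^'n"
  assumes "\<zeta> \<in> C0_inf" and "0 < \<epsilon>"
  defines "\<eta> \<equiv> lie (\<lambda>x. a *v x + b) (lie (\<lambda>x. a *v x + b) \<zeta>)"
  obtains s t where "\<bar>s\<bar> \<le> \<epsilon>" "\<bar>t\<bar> \<le> \<epsilon>"
    "(\<zeta> (flow a b \<epsilon> x) - 2 * \<zeta> x + \<zeta> (flow a b (- \<epsilon>) x)) / \<epsilon>\<^sup>2 =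
      (\<eta> (flow a b s x) + \<eta> (flow a b t x)) / 2"
proof -
  let ?V = "lie (\<lambda>x. a *v x + b)"
  define diff where "diff m t = ((?V ^^ m) \<zeta>) (flow a b t x)" for m t
  have C: "(?V ^^ m) \<zeta> \<in> C0_inf" for m
    by (induction m) (use assms(1) C0_inf_lie in auto)
  have D: "DERIV (diff m) t :> diff (Suc m) t" for m t
    unfolding diff_def using C0_inf_along_flow[OF C] by simp
  have "\<exists>t. \<bar>t\<bar> \<le> \<bar>h\<bar> \<and> diff 0 h = (\<Sum>m<2. diff m 0 / fact m * h ^ m) + diff 2 t / fact 2 * h ^ 2" for h
    by (rule Maclaurin_bi_le) (use D in auto)
  then have T: "\<exists>t. \<bar>t\<bar> \<le> \<bar>h\<bar> \<and> diff 0 h = diff 0 0 + diff 1 0 * h + diff 2 t / 2 * h\<^sup>2" for h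
  proof -
    have "(\<Sum>m<2. diff m 0 / fact m * h ^ m) = diff 0 0 + diff 1 0 * h"
      by (simp add: numeral_2_eq_2)
    then show ?thesis
      using \<open>\<And>h. \<exists>t. \<bar>t\<bar> \<le> \<bar>h\<bar> \<and> diff 0 h = (\<Sum>m<2. diff m 0 / fact m * h ^ m) + diff 2 t / fact 2 * h ^ 2\<close>[of h]
      by simp
  qed
  from T[of \<epsilon>] T[of "- \<epsilon>"] obtain s t where
    s: "\<bar>s\<bar> \<le> \<epsilon>" "diff 0 \<epsilon> = diff 0 0 + diff 1 0 * \<epsilon> + diff 2 s / 2 * \<epsilon>\<^sup>2" and
    t: "\<bar>t\<bar> \<le> \<epsilon>" "diff 0 (- \<epsilon>) = diff 0 0 - diff 1 0 * \<epsilon> + diff 2 t / 2 * \<epsilon>\<^sup>2"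
    using \<open>0 < \<epsilon>\<close> by auto
  have "diff 0 \<epsilon> - 2 * diff 0 0 + diff 0 (- \<epsilon>) = (diff 2 s + diff 2 t) / 2 * \<epsilon>\<^sup>2"
    using s t by (simp add: algebra_simps add_divide_distrib)
  then have "(diff 0 \<epsilon> - 2 * diff 0 0 + diff 0 (- \<epsilon>)) / \<epsilon>\<^sup>2 = (diff 2 s + diff 2 t) / 2"
    using \<open>0 < \<epsilon>\<close> by simp
  then show ?thesis
    using that[OF s(1) t(1)] by (simp add: diff_def flow_0 \<eta>_def numeral_2_eq_2)
qed

text \<open>By the mean value form it suffices that \<open>\<eta> \<circ> e\<^sup>t\<^sup>\<nu>\<close> is uniformly close to \<open>\<eta>\<close> for small \<open>t\<close>. On a
ball this is uniform continuity. Far away both functions vanish, because \<open>e\<^sup>t\<^sup>\<nu>\<close> moves \<open>x\<close> by at most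
half of \<open>1 + \<bar>x\<bar>\<close> when \<open>t\<close> is small, and so cannot bring a distant point into the support of \<open>\<eta>\<close>.\<close>

lemma second_difference_uniform:
  fixes a :: "real^'n^'n" and b :: "real^'n"
  assumes \<zeta>: "\<zeta> \<in> C0_inf"
  defines "\<eta> \<equiv> lie (\<lambda>x. a *v x + b) (lie (\<lambda>x. a *v x + b) \<zeta>)"
  shows "\<exists>R. \<forall>e>0. \<exists>d>0. \<forall>\<epsilon>. 0 < \<epsilon> \<and> \<epsilon> < d \<longrightarrow>
    (\<forall>x. \<bar>(\<zeta> (flow a b \<epsilon> x) - 2 * \<zeta> x + \<zeta> (flow a b (- \<epsilon>) x)) / \<epsilon>\<^sup>2 - \<eta> x\<bar> \<le> e * indicator (cball 0 R) x)"
proof -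
  have \<eta>: "\<eta> \<in> C0_inf" unfolding \<eta>_def by (intro C0_inf_lie \<zeta>)
  obtain R0 where R0: "R0 > 0" "\<And>x. norm x > R0 \<Longrightarrow> \<eta> x = 0"
    using C0_inf_support[OF \<eta>] by blast
  obtain C where C: "C > 0" "\<And>t x. \<bar>t\<bar> \<le> 1 \<Longrightarrow> norm (flow a b t x - x) \<le> \<bar>t\<bar> * C * (1 + norm x)"
    using norm_flow_minus_id_le_linear by blast
  (* up to time t0 a point x moves by at most (1 + norm x) / 2 *)
  define t0 where "t0 = min 1 (1 / (2 * C))"
  have t0: "0 < t0" "t0 \<le> 1" "t0 * C \<le> 1/2" using C(1) by (auto simp: t0_def min_def field_simps)
  have half: "norm (flow a b t x - x) \<le> (1 + norm x) / 2" if "\<bar>t\<bar> \<le> t0" for t x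
  proof -
    have "norm (flow a b t x - x) \<le> \<bar>t\<bar> * C * (1 + norm x)" using C that t0 by simp
    also have "\<dots> \<le> 1/2 * (1 + norm x)"
      using that t0 C mult_right_mono[of "\<bar>t\<bar>" t0 C] by (intro mult_right_mono add_nonneg_nonneg norm_ge_zero) linarith+
    finally show ?thesis by simp
  qed
  define R where "R = 2 * R0 + 1"
  define R' where "R' = R + (1 + R) / 2"
  have R: "R > 0" using R0 by (simp add: R_def)
  have outside: "\<eta> (flow a b t x) = 0" if "\<bar>t\<bar> \<le> t0" "norm x > R" for t x
  proof (rule R0)
    have "norm x \<le> norm (flow a b t x) + norm (flow a b t x - x)"
      using norm_triangle_ineq4[of "flow a b t x" "flow a b t x - x"] by simp
    then show "R0 < norm (flow a b t x)" using half[OF that(1), of x] that(2) unfolding R_def by (simp add: field_simps)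
  qed
  show ?thesis
  proof (rule exI[of _ R], intro allI impI)
    fix e :: real assume e: "e > 0"
    have "uniformly_continuous_on (cball 0 R') \<eta>"
      by (intro compact_uniformly_continuous C0_inf_continuous \<eta> compact_cball)
    then obtain d0 where d0: "d0 > 0" "\<And>x y. x \<in> cball 0 R' \<Longrightarrow> y \<in> cball 0 R' \<Longrightarrow> dist y x < d0 \<Longrightarrow> dist (\<eta> y) (\<eta> x) < e"
      using e unfolding uniformly_continuous_on_def by metis
    define d where "d = min t0 (d0 / (C * (1 + R)))"
    have d: "d > 0" using t0 d0 C R by (simp add: d_def)
    have close: "\<bar>\<eta> (flow a b t x) - \<eta> x\<bar> \<le> e * indicator (cball 0 R) x" if t: "\<bar>t\<bar> < d" for t x
    proof (cases "norm x \<le> R")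
      case False
      then have "\<eta> (flow a b t x) = 0" "\<eta> (flow a b 0 x) = 0"
        using outside[of t x] outside[of 0 x] t t0 by (auto simp: d_def)
      then show ?thesis using False by (simp add: flow_0)
    next
      case True
      have n: "norm (flow a b t x - x) \<le> \<bar>t\<bar> * C * (1 + norm x)" using C t t0 by (simp add: d_def)
      also have "\<dots> \<le> \<bar>t\<bar> * (C * (1 + R))" using True C by (simp add: mult.assoc mult_left_mono)
      also have "\<dots> < d0"
        using t C R by (simp add: d_def pos_less_divide_eq)
      finally have "dist (flow a b t x) x < d0" by (simp add: dist_norm)
      moreover have "norm (flow a b t x) \<le> R'"
        using half[of t x] t True norm_triangle_ineq[of "flow a b t x - x" x] by (simp add: d_def R'_def field_simps)
      moreover have "norm x \<le> R'" using True R by (simp add: R'_def field_simps)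
      ultimately have "dist (\<eta> (flow a b t x)) (\<eta> x) < e" by (intro d0) auto
      then show ?thesis using True by (simp add: dist_real_def)
    qed
    have "\<bar>(\<zeta> (flow a b \<epsilon> x) - 2 * \<zeta> x + \<zeta> (flow a b (- \<epsilon>) x)) / \<epsilon>\<^sup>2 - \<eta> x\<bar> \<le> e * indicator (cball 0 R) x"
      if \<epsilon>: "0 < \<epsilon>" "\<epsilon> < d" for \<epsilon> x
    proof -
      obtain s t where st: "\<bar>s\<bar> \<le> \<epsilon>" "\<bar>t\<bar> \<le> \<epsilon>"
        "(\<zeta> (flow a b \<epsilon> x) - 2 * \<zeta> x + \<zeta> (flow a b (- \<epsilon>) x)) / \<epsilon>\<^sup>2 = (\<eta> (flow a b s x) + \<eta> (flow a b t x)) / 2"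
        using second_difference_eq_mean[OF \<zeta> \<epsilon>(1), of a b x] unfolding \<eta>_def by metis
      have "\<bar>\<eta> (flow a b s x) - \<eta> x\<bar> \<le> e * indicator (cball 0 R) x"
        "\<bar>\<eta> (flow a b t x) - \<eta> x\<bar> \<le> e * indicator (cball 0 R) x"
        using close st(1,2) \<epsilon>(2) by (meson le_less_trans)+
      moreover have "\<bar>(p + q) / 2 - r\<bar> \<le> E" if "\<bar>p - r\<bar> \<le> E" "\<bar>q - r\<bar> \<le> E" for p q r E :: real
        using that by (simp add: abs_le_iff field_simps)
      ultimately show ?thesis
        unfolding st(3) by blast
    qed
    then show "\<exists>d>0. \<forall>\<epsilon>. 0 < \<epsilon> \<and> \<epsilon> < d \<longrightarrow>
      (\<forall>x. \<bar>(\<zeta> (flow a b \<epsilon> x) - 2 * \<zeta> x + \<zeta> (flow a b (- \<epsilon>) x)) / \<epsilon>\<^sup>2 - \<eta> x\<bar> \<le> e * indicator (cball 0 R) x)"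
      using d by blast
  qed
qed

lemma affine_coords_affine:
  fixes a :: "real^'n^'n"
  shows "affine_coords (\<lambda>x. a *v x + b) = (a, b)"
  by (simp add: affine_coords_def)

lemma affine_eq_coords:
  assumes "g \<in> affine_maps"
  shows "g = (\<lambda>x. fst (affine_coords g) *v x + snd (affine_coords g))"
  using assms by (auto simp: affine_maps_def affine_coords_affine)

text \<open>The value of \<open>M\<^sub>\<nu> \<zeta>\<close> written out in the coordinates \<open>c = (a, b)\<close> of \<open>\<nu>\<close>. In this form its dependence
on \<open>\<nu>\<close> is visibly continuous, which gives measurability in time and stability when \<open>\<nu>\<close> is replaced by
a nearby map.\<close>

definition second_order :: "(real^'n \<Rightarrow> real) \<Rightarrow> (real^'n^'n) \<times> (real^'n) \<Rightarrow> real^'n \<Rightarrow> real" where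
  "second_order \<zeta> c x = (\<Sum>j\<in>UNIV. (fst c *v (fst c *v x + snd c)) $ j * partial \<zeta> j x
     + (fst c *v x + snd c) $ j * (\<Sum>i\<in>UNIV. (fst c *v x + snd c) $ i * partial (partial \<zeta> j) i x))"

lemma lie_lie_eq_second_order:
  fixes a :: "real^'n^'n"
  assumes "\<zeta> \<in> C0_inf"
  shows "lie (\<lambda>x. a *v x + b) (lie (\<lambda>x. a *v x + b) \<zeta>) x = second_order \<zeta> (a, b) x"
proof -
  let ?\<nu> = "\<lambda>x. a *v x + b"
  have e: "lie ?\<nu> \<zeta> = (\<lambda>x. \<Sum>j\<in>UNIV. ?\<nu> x $ j * partial \<zeta> j x)"
    by (simp add: lie_eq_sum_partial[OF assms] fun_eq_iff)
  have d: "((\<lambda>x. \<Sum>j\<in>UNIV. ?\<nu> x $ j * partial \<zeta> j x) has_derivative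
     (\<lambda>h. \<Sum>j\<in>UNIV. ?\<nu> x $ j * frechet_derivative (partial \<zeta> j) (at x) h + (a *v h) $ j * partial \<zeta> j x)) (at x)"
  proof (intro has_derivative_sum has_derivative_mult C0_inf_has_derivative C0_inf_partial assms)
    fix j
    have "bounded_linear (\<lambda>v. (a *v v) $ j)"
      using bounded_linear_compose[OF bounded_linear_vec_nth[of j] matrix_vector_mul_bounded_linear[of a]]
      by (simp add: o_def)
    then show "((\<lambda>x. ?\<nu> x $ j) has_derivative (\<lambda>h. (a *v h) $ j)) (at x)"
      by (auto intro!: derivative_eq_intros bounded_linear_imp_has_derivative)
  qed
  have "frechet_derivative (lie ?\<nu> \<zeta>) (at x) =
     (\<lambda>h. \<Sum>j\<in>UNIV. ?\<nu> x $ j * frechet_derivative (partial \<zeta> j) (at x) h + (a *v h) $ j * partial \<zeta> j x)"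
    unfolding e by (rule frechet_derivative_at[OF d, symmetric])
  then have "lie ?\<nu> (lie ?\<nu> \<zeta>) x =
     (\<Sum>j\<in>UNIV. ?\<nu> x $ j * frechet_derivative (partial \<zeta> j) (at x) (?\<nu> x) + (a *v ?\<nu> x) $ j * partial \<zeta> j x)"
    by (subst lie_def) simp
  then show ?thesis
    by (simp add: second_order_def add.commute frechet_derivative_eq_sum_partial[OF C0_inf_partial[OF assms]])
qed

lemma second_diff_eq_second_order:
  assumes "\<nu> \<in> affine_maps" "\<zeta> \<in> C0_inf"
  shows "second_diff \<nu> \<zeta> = second_order \<zeta> (affine_coords \<nu>)"
proof
  fix x
  obtain a b where ab: "affine_coords \<nu> = (a, b)" by (cases "affine_coords \<nu>")
  then have \<nu>: "\<nu> = (\<lambda>x. a *v x + b)" using affine_eq_coords[OF assms(1)] by simp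
  have "((\<lambda>\<epsilon>. (\<zeta> (flow a b \<epsilon> x) - 2 * \<zeta> x + \<zeta> (flow a b (- \<epsilon>) x)) / \<epsilon>\<^sup>2) \<longlongrightarrow> second_order \<zeta> (a, b) x) (at_right 0)"
  proof (rule tendstoI)
    fix e :: real assume "e > 0"
    obtain R where "\<exists>d>0. \<forall>\<epsilon>. 0 < \<epsilon> \<and> \<epsilon> < d \<longrightarrow>
        (\<forall>x. \<bar>(\<zeta> (flow a b \<epsilon> x) - 2 * \<zeta> x + \<zeta> (flow a b (- \<epsilon>) x)) / \<epsilon>\<^sup>2 - second_order \<zeta> (a, b) x\<bar>
          \<le> e / 2 * indicator (cball 0 R) x)"
      using second_difference_uniform[OF assms(2), of a b, unfolded lie_lie_eq_second_order[OF assms(2)]]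
        half_gt_zero[OF \<open>e > 0\<close>] by blast
    then obtain d where d: "d > 0" and le: "\<And>\<epsilon>. 0 < \<epsilon> \<Longrightarrow> \<epsilon> < d \<Longrightarrow>
      \<bar>(\<zeta> (flow a b \<epsilon> x) - 2 * \<zeta> x + \<zeta> (flow a b (- \<epsilon>) x)) / \<epsilon>\<^sup>2 - second_order \<zeta> (a, b) x\<bar>
        \<le> e / 2 * indicator (cball 0 R) x"
      by auto
    have "e / 2 * indicator (cball 0 R) x < e"
      using \<open>e > 0\<close> by (auto simp: indicator_def)
    then have lt: "dist ((\<zeta> (flow a b \<epsilon> x) - 2 * \<zeta> x + \<zeta> (flow a b (- \<epsilon>) x)) / \<epsilon>\<^sup>2) (second_order \<zeta> (a, b) x) < e"
      if "\<epsilon> \<in> {0<..<d}" for \<epsilon>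
      using le[of \<epsilon>] that unfolding dist_real_def by auto
    show "\<forall>\<^sub>F \<epsilon> in at_right 0. dist ((\<zeta> (flow a b \<epsilon> x) - 2 * \<zeta> x + \<zeta> (flow a b (- \<epsilon>) x)) / \<epsilon>\<^sup>2) (second_order \<zeta> (a, b) x) < e"
      by (rule eventually_mono[OF eventually_at_right_real[OF d] lt])
  qed
  then show "second_diff \<nu> \<zeta> x = second_order \<zeta> (affine_coords \<nu>) x"
    unfolding second_diff_def \<nu> aff_exp_eq_flow affine_coords_affine by (intro tendsto_Lim) auto
qed

text \<open>This allows the equation itself to be tested against \<open>M\<^sub>\<nu> \<zeta>\<close>.\<close>

lemma second_diff_C0_inf:
  assumes "\<nu> \<in> affine_maps" "\<zeta> \<in> C0_inf"
  shows "second_diff \<nu> \<zeta> \<in> C0_inf"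
proof -
  obtain a b where ab: "affine_coords \<nu> = (a, b)" by (cases "affine_coords \<nu>")
  have "second_diff \<nu> \<zeta> = lie (\<lambda>x. a *v x + b) (lie (\<lambda>x. a *v x + b) \<zeta>)"
    by (simp add: second_diff_eq_second_order[OF assms] ab lie_lie_eq_second_order[OF assms(2)] fun_eq_iff)
  then show ?thesis by (simp add: C0_inf_lie assms)
qed

lemma second_difference_tendsto_second_diff:
  assumes "\<nu> \<in> affine_maps" "\<zeta> \<in> C0_inf"
  shows "\<exists>R. \<forall>e>0. \<exists>d>0. \<forall>\<epsilon>. 0 < \<epsilon> \<and> \<epsilon> < d \<longrightarrow>
    (\<forall>x. \<bar>(\<zeta> (aff_exp \<nu> \<epsilon> x) - 2 * \<zeta> x + \<zeta> (aff_exp \<nu> (- \<epsilon>) x)) / \<epsilon>\<^sup>2 - second_diff \<nu> \<zeta> x\<bar>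
       \<le> e * indicator (cball 0 R) x)"
proof -
  obtain a b where ab: "affine_coords \<nu> = (a, b)" by (cases "affine_coords \<nu>")
  have \<nu>: "\<nu> = (\<lambda>x. a *v x + b)" using affine_eq_coords[OF assms(1)] ab by simp
  have s: "second_diff \<nu> \<zeta> = second_order \<zeta> (a, b)"
    by (simp add: second_diff_eq_second_order[OF assms] ab)
  have "aff_exp \<nu> = flow a b" unfolding \<nu> by (rule aff_exp_eq_flow)
  then show ?thesis
    unfolding s
    using second_difference_uniform[OF assms(2), of a b, unfolded lie_lie_eq_second_order[OF assms(2)]]
    by (simp only:)
qed

lemma second_order_continuous:
  assumes "\<zeta> \<in> C0_inf"
  shows "continuous_on UNIV (\<lambda>(c, x). second_order \<zeta> c x)"
proof -
  have p: "continuous_on UNIV (\<lambda>p::((real^'n^'n) \<times> (real^'n)) \<times> (real^'n). \<phi> (snd p))" if "\<phi> \<in> C0_inf" for \<phi>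
    by (rule continuous_on_compose2[OF C0_inf_continuous[OF that, of UNIV]]) (auto intro: continuous_intros)
  note [continuous_intros] = p[OF C0_inf_partial[OF assms]] p[OF C0_inf_partial[OF C0_inf_partial[OF assms]]]
  show ?thesis
    unfolding second_order_def split_beta matrix_vector_mult_def
    by (simp, intro continuous_intros)
qed

lemma second_order_support:
  assumes "\<zeta> \<in> C0_inf"
  obtains R where "R > 0" "\<And>c x. norm x > R \<Longrightarrow> second_order \<zeta> c x = 0"
proof -
  have "\<forall>j. \<exists>R. \<forall>x. norm x > R \<longrightarrow> partial \<zeta> j x = 0"
    using C0_inf_support[OF C0_inf_partial[OF assms]] by metis
  then obtain R1 where R1: "\<And>j x. norm x > R1 j \<Longrightarrow> partial \<zeta> j x = 0" by metis
  have "\<forall>j i. \<exists>R. \<forall>x. norm x > R \<longrightarrow> partial (partial \<zeta> j) i x = 0"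
    using C0_inf_support[OF C0_inf_partial[OF C0_inf_partial[OF assms]]] by metis
  then obtain R2 where R2: "\<And>j i x. norm x > R2 j i \<Longrightarrow> partial (partial \<zeta> j) i x = 0" by metis
  define R where "R = Max (insert 1 (range R1 \<union> range (case_prod R2)))"
  have R: "R1 j \<le> R" "R2 j i \<le> R" "1 \<le> R" for j i
    unfolding R_def by (rule Max_ge; auto intro: range_eqI[of _ _ "(j, i)"])+
  have "second_order \<zeta> c x = 0" if x: "norm x > R" for c x
  proof -
    have "partial \<zeta> j x = 0" "partial (partial \<zeta> j) i x = 0" for i j
      using R1[OF le_less_trans[OF R(1) x]] R2[OF le_less_trans[OF R(2) x]] by auto
    then show ?thesis by (simp add: second_order_def)
  qed
  moreover have "R > 0" using R(3) by linarith
  ultimately show ?thesis using that by blast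
qed

text \<open>Uniform continuity of \<^const>\<open>second_order\<close> on the compact product of a ball of coordinates and a ball
containing the support of \<open>\<zeta>\<close>.\<close>

lemma second_order_uniform:
  fixes \<zeta> :: "real^'n \<Rightarrow> real"
  assumes "\<zeta> \<in> C0_inf"
  obtains R B where "\<And>c x. norm c \<le> C \<Longrightarrow> \<bar>second_order \<zeta> c x\<bar> \<le> B * indicator (cball 0 R) x"
    "\<And>e. e > 0 \<Longrightarrow> \<exists>d>0. \<forall>c c'. norm c \<le> C \<longrightarrow> norm c' \<le> C \<longrightarrow> dist c c' < d \<longrightarrow>
      (\<forall>x. \<bar>second_order \<zeta> c x - second_order \<zeta> c' x\<bar> \<le> e * indicator (cball 0 R) x)"
proof -
  obtain R where R: "R > 0" "\<And>c x. norm x > R \<Longrightarrow> second_order \<zeta> c x = 0"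
    using second_order_support[OF assms] by blast
  let ?S = "cball 0 C \<times> cball 0 R :: (((real^'n^'n) \<times> (real^'n)) \<times> (real^'n)) set"
  let ?q = "\<lambda>(c, x). second_order \<zeta> c x"
  have S: "compact ?S" by (intro compact_Times compact_cball)
  have q: "continuous_on ?S ?q" using second_order_continuous[OF assms] continuous_on_subset by blast
  have "bounded (?q ` ?S)" by (intro compact_imp_bounded compact_continuous_image q S)
  then obtain B where B: "\<And>p. p \<in> ?S \<Longrightarrow> \<bar>?q p\<bar> \<le> B"
    unfolding bounded_iff by auto
  show ?thesis
  proof (rule that[of B R])
    show "\<bar>second_order \<zeta> c x\<bar> \<le> B * indicator (cball 0 R) x" if "norm c \<le> C" for c x
      using B[of "(c, x)"] R(2)[of x c] that by (cases "norm x \<le> R") auto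
    fix e :: real assume "e > 0"
    then obtain d where d: "d > 0" "\<And>p p'. p \<in> ?S \<Longrightarrow> p' \<in> ?S \<Longrightarrow> dist p' p < d \<Longrightarrow> dist (?q p') (?q p) < e"
      using compact_uniformly_continuous[OF q S] unfolding uniformly_continuous_on_def by metis
    show "\<exists>d>0. \<forall>c c'. norm c \<le> C \<longrightarrow> norm c' \<le> C \<longrightarrow> dist c c' < d \<longrightarrow>
      (\<forall>x. \<bar>second_order \<zeta> c x - second_order \<zeta> c' x\<bar> \<le> e * indicator (cball 0 R) x)"
    proof (intro exI[of _ d] conjI d(1) allI impI)
      fix c c' :: "(real^'n^'n) \<times> (real^'n)" and x :: "real^'n" assume *: "norm c \<le> C" "norm c' \<le> C" "dist c c' < d"
      show "\<bar>second_order \<zeta> c x - second_order \<zeta> c' x\<bar> \<le> e * indicator (cball 0 R) x"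
      proof (cases "norm x \<le> R")
        case True
        have "dist (c, x) (c', x) < d" using * by (simp add: dist_Pair_Pair)
        with True * d(2)[of "(c', x)" "(c, x)"] show ?thesis
          unfolding mem_Times_iff fst_conv snd_conv mem_cball_0 split dist_real_def by simp
      qed (use R(2)[of x c] R(2)[of x c'] in simp)
    qed
  qed
qed

section \<open>Weak sequential compactness of bounded functions\<close>

lemma integrable_bounded_mult:
  fixes u f :: "'a \<Rightarrow> real"
  assumes "integrable M f" "u \<in> borel_measurable M" "\<And>x. x \<in> space M \<Longrightarrow> \<bar>u x\<bar> \<le> K"
  shows "integrable M (\<lambda>x. u x * f x)"
proof (rule Bochner_Integration.integrable_bound)
  show "integrable M (\<lambda>x. K * f x)" using assms by simp
  show "(\<lambda>x. u x * f x) \<in> borel_measurable M" using assms by measurable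
  show "AE x in M. norm (u x * f x) \<le> norm (K * f x)"
    using assms(3) by (intro AE_I2) (force simp: abs_mult intro!: mult_right_mono)
qed

lemma integral_bounded_mult_le:
  fixes u f :: "'a \<Rightarrow> real"
  assumes "integrable M f" "u \<in> borel_measurable M" "\<And>x. x \<in> space M \<Longrightarrow> \<bar>u x\<bar> \<le> K"
  shows "\<bar>\<integral>x. u x * f x \<partial>M\<bar> \<le> K * (\<integral>x. \<bar>f x\<bar> \<partial>M)"
proof -
  have "\<bar>\<integral>x. u x * f x \<partial>M\<bar> \<le> (\<integral>x. \<bar>u x * f x\<bar> \<partial>M)"
    using integral_abs_bound by blast
  also have "\<dots> \<le> (\<integral>x. K * \<bar>f x\<bar> \<partial>M)"
    using assms by (intro integral_mono integrable_abs integrable_bounded_mult[OF assms])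
      (auto simp: abs_mult intro!: mult_right_mono)
  finally show ?thesis by simp
qed

lemma dominated_L1_limit:
  fixes s :: "nat \<Rightarrow> 'a \<Rightarrow> real"
  assumes "\<And>i. integrable M (s i)" "integrable M f" "integrable M w"
    and "\<And>i x. x \<in> space M \<Longrightarrow> \<bar>s i x\<bar> \<le> w x"
    and "\<And>x. x \<in> space M \<Longrightarrow> (\<lambda>i. s i x) \<longlonglongrightarrow> f x"
  shows "(\<lambda>i. \<integral>x. \<bar>s i x - f x\<bar> \<partial>M) \<longlonglongrightarrow> 0"
proof -
  have "(\<lambda>i. \<integral>x. \<bar>s i x - f x\<bar> \<partial>M) \<longlonglongrightarrow> (\<integral>x. 0 \<partial>M)"
  proof (rule integral_dominated_convergence[where w="\<lambda>x. w x + \<bar>f x\<bar>"])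
    show "AE x in M. (\<lambda>i. \<bar>s i x - f x\<bar>) \<longlonglongrightarrow> 0"
    proof (intro AE_I2)
      fix x assume "x \<in> space M"
      from tendsto_rabs[OF tendsto_diff[OF assms(5)[OF this] tendsto_const[of "f x"]]]
      show "(\<lambda>i. \<bar>s i x - f x\<bar>) \<longlonglongrightarrow> 0" by simp
    qed
    show "AE x in M. norm \<bar>s i x - f x\<bar> \<le> w x + \<bar>f x\<bar>" for i
      by (intro AE_I2) (use assms(4) in \<open>force intro: order_trans[OF abs_triangle_ineq4]\<close>)
    show "(\<lambda>x. \<bar>s i x - f x\<bar>) \<in> borel_measurable M" for i
      using assms(1,2) by (simp add: borel_measurable_integrable)
    show "integrable M (\<lambda>x. w x + \<bar>f x\<bar>)" using assms by auto
  qed auto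
  then show ?thesis by simp
qed

lemma LIMSEQ_zero_approx:
  fixes y :: "nat \<Rightarrow> real"
  assumes "\<And>i. x i \<longlonglongrightarrow> 0" "\<And>i k. \<bar>x i k - y k\<bar> \<le> d i" "d \<longlonglongrightarrow> 0"
  shows "y \<longlonglongrightarrow> 0"
proof (rule LIMSEQ_I)
  fix r :: real assume "r > 0"
  then obtain i where i: "\<bar>d i\<bar> < r / 2"
    using LIMSEQ_D[OF assms(3), of "r / 2"] by (auto simp: real_norm_def)
  obtain N where N: "\<And>k. k \<ge> N \<Longrightarrow> \<bar>x i k\<bar> < r / 2"
    using LIMSEQ_D[OF assms(1)[of i], of "r / 2"] \<open>r > 0\<close> by (auto simp: real_norm_def)
  have "norm (y k - 0) < r" if "k \<ge> N" for k
    using N[OF that] assms(2)[of i k] i by (simp add: abs_if split: if_splits)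
  then show "\<exists>no. \<forall>n\<ge>no. norm (y n - 0) < r" by blast
qed

lemma convergent_approx:
  fixes y :: "nat \<Rightarrow> real"
  assumes "\<And>i. convergent (x i)" "\<And>i k. \<bar>x i k - y k\<bar> \<le> d i" "d \<longlonglongrightarrow> 0"
  shows "convergent y"
proof (rule Cauchy_convergent, rule CauchyI)
  fix e :: real assume "e > 0"
  then obtain i where i: "\<bar>d i\<bar> < e / 3"
    using LIMSEQ_D[OF assms(3), of "e / 3"] by (auto simp: real_norm_def)
  have "Cauchy (x i)" using assms(1) convergent_Cauchy by blast
  then obtain N where N: "\<And>m n. m \<ge> N \<Longrightarrow> n \<ge> N \<Longrightarrow> \<bar>x i m - x i n\<bar> < e / 3"
    using CauchyD[of "x i" "e / 3"] \<open>e > 0\<close> by (auto simp: real_norm_def)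
  have "norm (y m - y n) < e" if "m \<ge> N" "n \<ge> N" for m n
    using N[OF that] assms(2)[of i m] assms(2)[of i n] i by (simp add: abs_if split: if_splits)
  then show "\<exists>M. \<forall>m\<ge>M. \<forall>n\<ge>M. norm (y m - y n) < e" by blast
qed

text \<open>Boxes with rational corners form a countable intersection-stable generator of the Borel sets.
Countability is needed for the diagonal argument, stability for the Dynkin argument in \<open>L1_induct\<close>.\<close>

definition rat_boxes :: "(real^'n) set set" where
  "rat_boxes = {box a b |a b. (\<forall>i. a $ i \<in> \<rat>) \<and> (\<forall>i. b $ i \<in> \<rat>)}"

lemma countable_rat_vectors: "countable {x::real^'n. \<forall>i. x $ i \<in> \<rat>}"
proof -
  have "{x::real^'n. \<forall>i. x $ i \<in> \<rat>} \<subseteq> vec_lambda ` (PiE UNIV (\<lambda>_. \<rat>))"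
  proof
    fix x :: "real^'n" assume "x \<in> {x. \<forall>i. x $ i \<in> \<rat>}"
    then have "vec_nth x \<in> PiE UNIV (\<lambda>_. \<rat>)" by auto
    moreover have "x = vec_lambda (vec_nth x)" by (simp add: vec_eq_iff)
    ultimately show "x \<in> vec_lambda ` (PiE UNIV (\<lambda>_. \<rat>))" by blast
  qed
  moreover have "countable (PiE (UNIV::'n set) (\<lambda>_. \<rat>::real set))"
    by (intro countable_PiE countable_rat) auto
  ultimately show ?thesis by (meson countable_image countable_subset)
qed

lemma countable_rat_boxes: "countable (rat_boxes :: (real^'n) set set)"
proof -
  have eq: "rat_boxes = (\<lambda>(a, b). box a b) ` ({x::real^'n. \<forall>i. x $ i \<in> \<rat>} \<times> {x. \<forall>i. x $ i \<in> \<rat>})"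
    by (auto simp: rat_boxes_def)
  show ?thesis
    unfolding eq by (intro countable_image countable_SIGMA countable_rat_vectors)
qed

lemma Int_stable_rat_boxes: "Int_stable (rat_boxes :: (real^'n) set set)"
proof (rule Int_stableI)
  fix A B :: "(real^'n) set" assume "A \<in> rat_boxes" "B \<in> rat_boxes"
  then obtain a b c d where *: "A = box a b" "B = box c d"
    "\<forall>i. a $ i \<in> \<rat>" "\<forall>i. b $ i \<in> \<rat>" "\<forall>i. c $ i \<in> \<rat>" "\<forall>i. d $ i \<in> \<rat>"
    by (auto simp: rat_boxes_def)
  have "A \<inter> B = box (\<chi> i. max (a $ i) (c $ i)) (\<chi> i. min (b $ i) (d $ i))"
    unfolding * by (auto simp: mem_box_cart)
  moreover have "max (a $ i) (c $ i) \<in> \<rat>" "min (b $ i) (d $ i) \<in> \<rat>" for i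
    using * by (auto simp: max_def min_def)
  ultimately show "A \<inter> B \<in> rat_boxes"
    unfolding rat_boxes_def by (auto intro!: exI)
qed

lemma sigma_sets_rat_boxes: "sigma_sets UNIV rat_boxes = sets (borel :: (real^'n) measure)"
proof -
  have "topological_basis (rat_boxes :: (real^'n) set set)"
  proof (rule topological_basisI)
    fix O' :: "(real^'n) set" and x assume "open O'" "x \<in> O'"
    then obtain e where e: "e > 0" "ball x e \<subseteq> O'" using open_contains_ball by blast
    obtain a b where ab: "\<forall>i\<in>Basis. a \<bullet> i \<in> \<rat> \<and> b \<bullet> i \<in> \<rat>" "x \<in> box a b" "box a b \<subseteq> ball x e"
      using rational_boxes[OF e(1), of x] by blast
    have "a $ i \<in> \<rat> \<and> b $ i \<in> \<rat>" for i
      using ab(1) by (force simp: Basis_vec_def inner_axis)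
    then show "\<exists>B'\<in>rat_boxes. x \<in> B' \<and> B' \<subseteq> O'"
      using ab e unfolding rat_boxes_def by blast
  qed (auto simp: rat_boxes_def open_box)
  then have "(borel :: (real^'n) measure) = sigma UNIV rat_boxes"
    by (intro borel_eq_countable_basis countable_rat_boxes)
  then have "sets (borel :: (real^'n) measure) = sets (sigma UNIV rat_boxes)"
    by (rule arg_cong)
  then show ?thesis by simp
qed

lemma integrable_indicator_box: "B \<in> rat_boxes \<Longrightarrow> integrable lborel (indicator B :: real^'n \<Rightarrow> real)"
  by (auto simp: rat_boxes_def intro!: integrable_real_indicator emeasure_lborel_box_finite)

text \<open>An induction principle for integrable functions: a linear class that is closed under dominated limits
and contains the indicators of boxes contains everything. Within a fixed large box the Borel sets are
reached by a Dynkin argument; exhausting the space by boxes then gives all sets of finite measure.\<close>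

lemma L1_induct [consumes 1, case_names box add scale lim]:
  fixes f :: "real^'n \<Rightarrow> real"
  assumes f: "integrable lborel f"
    and box: "\<And>B. B \<in> rat_boxes \<Longrightarrow> P (indicator B)"
    and add: "\<And>f g. integrable lborel f \<Longrightarrow> integrable lborel g \<Longrightarrow> P f \<Longrightarrow> P g \<Longrightarrow> P (\<lambda>x. f x + g x)"
    and scale: "\<And>f c. integrable lborel f \<Longrightarrow> P f \<Longrightarrow> P (\<lambda>x. c * f x)"
    and lim: "\<And>s f w. (\<And>i. integrable lborel (s i)) \<Longrightarrow> (\<And>i::nat. P (s i)) \<Longrightarrow> integrable lborel f \<Longrightarrow>
       integrable lborel w \<Longrightarrow> (\<And>i x. \<bar>s i x\<bar> \<le> w x) \<Longrightarrow> (\<And>x. (\<lambda>i. s i x) \<longlonglongrightarrow> f x) \<Longrightarrow> P f"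
  shows "P f"
proof -
  (* boxes exhausting the space, each of finite measure *)
  define E :: "nat \<Rightarrow> (real^'n) set" where "E k = box (\<chi> i. - real k) (\<chi> i. real k)" for k
  have E: "E k \<in> rat_boxes" for k unfolding E_def rat_boxes_def by (auto intro!: exI)
  have Eint: "integrable lborel (indicator (E k) :: _ \<Rightarrow> real)" for k
    by (rule integrable_indicator_box[OF E])
  have Eb[measurable]: "E k \<in> sets borel" for k by (simp add: E_def)
  have AE_int: "integrable lborel (indicator (A \<inter> E k) :: _ \<Rightarrow> real)" if "A \<in> sets borel" for A k
    using that by (intro Bochner_Integration.integrable_bound[OF Eint[of k]]) (auto simp: indicator_def)
  have zero: "P (\<lambda>x. 0)" using scale[OF Eint box[OF E], of 0] by simp
  have sum: "P (\<lambda>x. \<Sum>i<m. g i x)" if "\<And>i. integrable lborel (g i)" "\<And>i. P (g i)"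
    for g :: "nat \<Rightarrow> real^'n \<Rightarrow> real" and m
    by (induction m) (auto simp: zero intro!: add that Bochner_Integration.integrable_sum)
  have inE: "P (indicator (A \<inter> E k))" if "A \<in> sets borel" for A k
  proof -
    have A: "A \<in> sigma_sets UNIV rat_boxes" using that by (simp add: sigma_sets_rat_boxes)
    have "rat_boxes \<subseteq> Pow (UNIV :: (real^'n) set)" by simp
    from Int_stable_rat_boxes this A show ?thesis
    proof (induction A rule: sigma_sets_induct_disjoint)
      case (basic A)
      then show ?case using Int_stable_rat_boxes E box unfolding Int_stable_def by blast
    next
      case empty
      then show ?case using zero by simp
    next
      case (compl A)
      then have A: "A \<in> sets borel" by (simp add: sigma_sets_rat_boxes)
      have "P (\<lambda>x. indicator (E k) x + (-1) * indicator (A \<inter> E k) x)"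
        by (intro add scale AE_int A compl box E Eint integrable_mult_right)
      also have "(\<lambda>x. indicator (E k) x + (-1) * indicator (A \<inter> E k) x) = (indicator ((UNIV - A) \<inter> E k) :: _ \<Rightarrow> real)"
        by (auto simp: indicator_def fun_eq_iff)
      finally show ?case .
    next
      case (union A)
      then have A: "A i \<in> sets borel" for i by (auto simp: sigma_sets_rat_boxes)
      let ?s = "\<lambda>m x. \<Sum>i<m. indicator (A i \<inter> E k) x :: real"
      have s_eq: "?s m x = indicator ((\<Union>i<m. A i) \<inter> E k) x" for m x
      proof -
        have "indicator (\<Union>i\<in>{..<m}. A i \<inter> E k) x = ?s m x"
          using \<open>disjoint_family A\<close> by (intro indicator_UN_disjoint) (auto simp: disjoint_family_on_def)
        moreover have "(\<Union>i\<in>{..<m}. A i \<inter> E k) = (\<Union>i<m. A i) \<inter> E k" by auto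
        ultimately show ?thesis by simp
      qed
      have lims: "(\<lambda>m. ?s m x) \<longlonglongrightarrow> indicator ((\<Union>i. A i) \<inter> E k) x" for x
      proof (cases "x \<in> (\<Union>i. A i) \<inter> E k")
        case True
        then obtain i where "x \<in> A i" by blast
        then have "eventually (\<lambda>m. ?s m x = indicator ((\<Union>i. A i) \<inter> E k) x) sequentially"
          using True unfolding s_eq eventually_sequentially by (intro exI[of _ "Suc i"]) (auto simp: indicator_def)
        then show ?thesis by (rule tendsto_eventually)
      next
        case False
        then show ?thesis unfolding s_eq by (intro tendsto_eventually always_eventually) (auto simp: indicator_def)
      qed
      show ?case
      proof (rule lim[where s="?s" and w="indicator (E k)"])
        show "P (?s m)" for m by (intro sum AE_int A union)
        show "integrable lborel (?s m)" for m by (intro Bochner_Integration.integrable_sum AE_int A)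
        show "integrable lborel (indicator ((\<Union>i. A i) \<inter> E k) :: _ \<Rightarrow> real)" by (intro AE_int sets.countable_UN) (auto simp: A)
        show "\<bar>?s m x\<bar> \<le> indicator (E k) x" for m x unfolding s_eq by (simp add: indicator_def)
      qed (use Eint lims in auto)
    qed
  qed
  have indic: "P (indicator A)" if A: "A \<in> sets borel" "emeasure lborel A < \<infinity>" for A
  proof (rule lim[where s="\<lambda>k. indicator (A \<inter> E k)" and w="indicator A"])
    show "(\<lambda>k. indicator (A \<inter> E k) x :: real) \<longlonglongrightarrow> indicator A x" for x
    proof -
      obtain k where k: "norm x < real k" using reals_Archimedean2 by blast
      have "x \<in> E m" if "m \<ge> k" for m
      proof -
        have "\<bar>x $ i\<bar> < real m" for i
          using component_le_norm_cart[of x i] k that of_nat_mono[OF that, where 'a=real] by linarith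
        then show ?thesis unfolding E_def mem_box_cart by (auto simp: abs_less_iff minus_less_iff)
      qed
      then have "eventually (\<lambda>m. indicator (A \<inter> E m) x = (indicator A x :: real)) sequentially"
        unfolding eventually_sequentially by (intro exI[of _ k]) (auto simp: indicator_def)
      then show ?thesis by (rule tendsto_eventually)
    qed
  qed (use A in \<open>auto intro: inE AE_int simp: indicator_def\<close>)
  from f show ?thesis
  proof (induction rule: integrable_induct)
    case (base A c)
    have "P (\<lambda>x. c * indicator A x)" by (intro scale indic) (use base in auto)
    then show ?case by (simp add: mult.commute)
  next
    case (add f g)
    then show ?case by (intro assms(3))
  next
    case (lim f s)
    show ?case
      by (rule assms(5)[where s=s and w="\<lambda>x. 2 * \<bar>f x\<bar>"]) (use lim in \<open>auto\<close>)
  qed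
qed

text \<open>The integrable functions for which convergence holds form a class as in \<open>L1_induct\<close>, since the \<open>u\<^sub>k\<close>
are bounded. Indicators of boxes belong to it as dominated limits of test functions.\<close>

lemma weak_convergence_from_test_functions:
  fixes u :: "nat \<Rightarrow> real^'n \<Rightarrow> real"
  assumes u: "\<And>k. u k \<in> borel_measurable borel" "\<And>k x. \<bar>u k x\<bar> \<le> K"
    and v: "v \<in> borel_measurable borel" "\<And>x. \<bar>v x\<bar> \<le> K"
    and test: "\<And>\<zeta>. \<zeta> \<in> C0_inf \<Longrightarrow> (\<lambda>k. pairing (u k) \<zeta>) \<longlonglongrightarrow> pairing v \<zeta>"
    and f: "integrable lborel f"
  shows "(\<lambda>k. pairing (u k) f) \<longlonglongrightarrow> pairing v f"
proof -
  let ?I = "\<lambda>k f. \<integral>x. (u k x - v x) * f x \<partial>lborel"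
  have uv: "(\<lambda>x. u k x - v x) \<in> borel_measurable lborel" "\<bar>u k x - v x\<bar> \<le> 2 * K" for k x
    using u(1) v(1) abs_triangle_ineq4[of "u k x" "v x"] u(2)[of k x] v(2)[of x] by (simp, linarith)
  note int = integrable_bounded_mult[OF _ uv]
  have I_eq: "?I k f = pairing (u k) f - pairing v f" if "integrable lborel f" for k f
    using integrable_bounded_mult[OF that, of "u k" K] integrable_bounded_mult[OF that, of v K] u v
    by (simp add: pairing_def left_diff_distrib)
  have lim_closed: "(\<lambda>k. ?I k f) \<longlonglongrightarrow> 0"
    if "\<And>i. integrable lborel (s i)" "\<And>i::nat. (\<lambda>k. ?I k (s i)) \<longlonglongrightarrow> 0" "integrable lborel f"
      "integrable lborel w" "\<And>i x. \<bar>s i x\<bar> \<le> w x" "\<And>x. (\<lambda>i. s i x) \<longlonglongrightarrow> f x" for s f w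
  proof (rule LIMSEQ_zero_approx[where x="\<lambda>i k. ?I k (s i)"])
    show "\<bar>?I k (s i) - ?I k f\<bar> \<le> 2 * K * (\<integral>x. \<bar>s i x - f x\<bar> \<partial>lborel)" for i k
    proof -
      have "?I k (s i) - ?I k f = ?I k (\<lambda>x. s i x - f x)"
        using int[OF that(1)] int[OF that(3)] by (simp add: right_diff_distrib)
      then show ?thesis using integral_bounded_mult_le[OF _ uv, of "\<lambda>x. s i x - f x"] that(1,3) by simp
    qed
    have "(\<lambda>i. 2 * K * (\<integral>x. \<bar>s i x - f x\<bar> \<partial>lborel)) \<longlonglongrightarrow> 2 * K * 0"
      by (intro tendsto_mult tendsto_const dominated_L1_limit[OF that(1) that(3,4)]) (use that in auto)
    then show "(\<lambda>i. 2 * K * (\<integral>x. \<bar>s i x - f x\<bar> \<partial>lborel)) \<longlonglongrightarrow> 0" by simp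
  qed (use that in auto)
  from f have "(\<lambda>k. ?I k f) \<longlonglongrightarrow> 0"
  proof (induction f rule: L1_induct)
    case (box B)
    then obtain a b where B: "B = box a b" by (auto simp: rat_boxes_def)
    show ?case
    proof (rule lim_closed[where s="box_bump a b" and w="indicator (cbox a b)"])
      show "(\<lambda>k. ?I k (box_bump a b i)) \<longlonglongrightarrow> 0" for i
        using tendsto_diff[OF test[OF box_bump_C0_inf[of a b i]] tendsto_const[of "pairing v (box_bump a b i)"]]
        by (simp add: I_eq[OF C0_inf_integrable[OF box_bump_C0_inf]])
      show "integrable lborel (indicator (cbox a b) :: _ \<Rightarrow> real)"
        by (intro integrable_real_indicator emeasure_lborel_cbox_finite) simp
      show "\<bar>box_bump a b i x\<bar> \<le> indicator (cbox a b) x" for i x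
        using box_bump_bounds[of a b i x] by simp
    qed (use box C0_inf_integrable[OF box_bump_C0_inf] box_bump_tendsto integrable_indicator_box in \<open>auto simp: B\<close>)
  next
    case (add f g)
    have "?I k (\<lambda>x. f x + g x) = ?I k f + ?I k g" for k
      using int[OF add(1)] int[OF add(2)] by (simp add: distrib_left)
    then show ?case using tendsto_add[OF add(3,4)] by simp
  next
    case (scale f c)
    have "?I k (\<lambda>x. c * f x) = c * ?I k f" for k
      by (simp add: mult.left_commute)
    then show ?case using tendsto_mult[OF tendsto_const[of c] scale(2)] by simp
  next
    case (lim s f w)
    show ?case by (rule lim_closed[OF lim.hyps(1) lim.IH lim.hyps(2-5)])
  qed
  then have "(\<lambda>k. pairing (u k) f - pairing v f) \<longlonglongrightarrow> 0" by (simp add: I_eq[OF f])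
  from tendsto_add[OF this tendsto_const[of "pairing v f"]] show ?thesis by simp
qed


text \<open>A diagonal argument over the countably many pairs of an index \<open>j\<close> (later, a rational time) and a
rational box, followed by \<open>L1_induct\<close>.\<close>

lemma convergent_pairing_subsequence:
  fixes u :: "nat \<Rightarrow> nat \<Rightarrow> real^'n \<Rightarrow> real"
  assumes u: "\<And>j k. u j k \<in> borel_measurable borel" "\<And>j k x. \<bar>u j k x\<bar> \<le> K"
  obtains r where "strict_mono r"
    "\<And>j f. integrable lborel f \<Longrightarrow> convergent (\<lambda>k. pairing (u j (r k)) f)"
proof -
  have K: "0 \<le> K" using u(2)[of 0 0 0] by linarith
  have ne: "rat_boxes \<noteq> ({} :: (real^'n) set set)" unfolding rat_boxes_def by (auto intro!: exI[of _ 0])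
  define B where "B = from_nat_into (rat_boxes :: (real^'n) set set)"
  have B: "B i \<in> rat_boxes" for i unfolding B_def by (rule from_nat_into[OF ne])
  have B_surj: "\<exists>i. B i = X" if "X \<in> rat_boxes" for X
    unfolding B_def using from_nat_into_surj[OF countable_rat_boxes that] by blast
  have intB: "integrable lborel (indicator (B i) :: _ \<Rightarrow> real)" for i by (rule integrable_indicator_box[OF B])
  note um = u(1)[folded measurable_lborel2]
  define Q where "Q n s = convergent (\<lambda>k. pairing (u (fst (prod_decode n)) (s k)) (indicator (B (snd (prod_decode n)))))" for n s
  interpret subseqs Q
  proof
    fix n and s :: "nat \<Rightarrow> nat"
    let ?x = "\<lambda>k. pairing (u (fst (prod_decode n)) (s k)) (indicator (B (snd (prod_decode n))))"
    have "\<bar>?x k\<bar> \<le> K * (\<integral>x. \<bar>indicator (B (snd (prod_decode n))) x\<bar> \<partial>lborel)" for k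
      unfolding pairing_def by (intro integral_bounded_mult_le intB um u(2))
    then have "bounded (range ?x)" unfolding bounded_iff by auto
    from bounded_imp_convergent_subsequence[OF this] obtain l r where "strict_mono r" "(?x \<circ> r) \<longlonglongrightarrow> l" by blast
    then show "\<exists>r'. strict_mono r' \<and> Q n (s \<circ> r')"
      unfolding Q_def convergent_def by (auto simp: o_def)
  qed
  have "Q n (diagseq \<circ> (+) (Suc n))" for n
  proof (rule diagseq_holds)
    fix r s :: "nat \<Rightarrow> nat" and n assume "strict_mono r" "Q n s"
    then show "Q n (s \<circ> r)"
      unfolding Q_def using convergent_subseq_convergent[of _ r] by (auto simp: o_def)
  qed
  then have conv: "convergent (\<lambda>k. pairing (u j (diagseq k)) (indicator (B i)))" for i j
  proof -
    have "convergent (\<lambda>k. pairing (u j (diagseq (k + Suc (prod_encode (j, i))))) (indicator (B i)))"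
      using \<open>\<And>n. Q n (diagseq \<circ> (+) (Suc n))\<close>[of "prod_encode (j, i)"]
      by (simp add: Q_def o_def add.commute)
    then show ?thesis
      using convergent_ignore_initial_segment[of "\<lambda>k. pairing (u j (diagseq k)) (indicator (B i))"] by blast
  qed
  show ?thesis
  proof (rule that[OF subseq_diagseq])
    fix j and f :: "real^'n \<Rightarrow> real" assume f: "integrable lborel f"
    let ?I = "\<lambda>k f. pairing (u j (diagseq k)) f"
    note int = integrable_bounded_mult[OF _ um u(2)]
    from f show "convergent (\<lambda>k. ?I k f)"
    proof (induction f rule: L1_induct)
      case (box X)
      then show ?case using B_surj conv by metis
    next
      case (add f g)
      have "?I k (\<lambda>x. f x + g x) = ?I k f + ?I k g" for k
        using int[OF add(1)] int[OF add(2)] by (simp add: pairing_def distrib_left)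
      then show ?case using convergent_add[OF add(3,4)] by simp
    next
      case (scale f c)
      have "?I k (\<lambda>x. c * f x) = c * ?I k f" for k
        by (simp add: pairing_def mult.left_commute)
      then show ?case using convergent_mult[OF convergent_const[of c] scale(2)] by simp
    next
      case (lim s f w)
      show ?case
      proof (rule convergent_approx[where x="\<lambda>i k. ?I k (s i)"])
        show "\<bar>?I k (s i) - ?I k f\<bar> \<le> K * (\<integral>x. \<bar>s i x - f x\<bar> \<partial>lborel)" for i k
        proof -
          have "?I k (s i) - ?I k f = ?I k (\<lambda>x. s i x - f x)"
            using int[OF lim.hyps(1)] int[OF lim.hyps(2)] by (simp add: pairing_def right_diff_distrib)
          then show ?thesis unfolding pairing_def
            using integral_bounded_mult_le[OF _ um u(2), of "\<lambda>x. s i x - f x"] lim.hyps(1,2) by simp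
        qed
        have "(\<lambda>i. K * (\<integral>x. \<bar>s i x - f x\<bar> \<partial>lborel)) \<longlonglongrightarrow> K * 0"
          by (intro tendsto_mult tendsto_const dominated_L1_limit[OF lim.hyps(1-3)]) (use lim.hyps in auto)
        then show "(\<lambda>i. K * (\<integral>x. \<bar>s i x - f x\<bar> \<partial>lborel)) \<longlonglongrightarrow> 0" by simp
      qed (use lim in auto)
    qed
  qed
qed

text \<open>The limits \<open>l f = lim \<integral> u\<^sub>k f\<close> define a functional that is continuous for the \<open>L\<^sup>1\<close> norm. Hence
\<open>A \<mapsto> l (1\<^sub>A) + K M(A)\<close> is a measure; it lies between \<open>0\<close> and \<open>2 K M\<close>, and its Radon-Nikodym
density, shifted back by \<open>K\<close>, represents \<open>l\<close>.\<close>

lemma (in finite_measure) weak_limit_density: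
  fixes u :: "nat \<Rightarrow> 'a \<Rightarrow> real"
  assumes u: "\<And>k. u k \<in> borel_measurable M" "\<And>k x. x \<in> space M \<Longrightarrow> \<bar>u k x\<bar> \<le> K"
    and conv: "\<And>f. integrable M f \<Longrightarrow> convergent (\<lambda>k. \<integral>x. u k x * f x \<partial>M)"
    and K: "0 \<le> K"
  obtains v where "v \<in> borel_measurable M" "\<And>x. \<bar>v x\<bar> \<le> K"
    "\<And>f. integrable M f \<Longrightarrow> (\<lambda>k. \<integral>x. u k x * f x \<partial>M) \<longlonglongrightarrow> (\<integral>x. v x * f x \<partial>M)"
proof -
  note int = integrable_bounded_mult[OF _ u]
  define l where "l f = lim (\<lambda>k. \<integral>x. u k x * f x \<partial>M)" for f
  have l: "(\<lambda>k. \<integral>x. u k x * f x \<partial>M) \<longlonglongrightarrow> l f" if "integrable M f" for f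
    unfolding l_def using conv[OF that] convergent_LIMSEQ_iff by blast
  have l_add: "l (\<lambda>x. f x + g x) = l f + l g" if "integrable M f" "integrable M g" for f g
  proof -
    have "(\<lambda>k. \<integral>x. u k x * (f x + g x) \<partial>M) \<longlonglongrightarrow> l f + l g"
      using tendsto_add[OF l[OF that(1)] l[OF that(2)]] int[OF that(1)] int[OF that(2)]
      by (simp add: distrib_left)
    then show ?thesis using l[of "\<lambda>x. f x + g x"] that LIMSEQ_unique by auto
  qed
  have l_scale: "l (\<lambda>x. c * f x) = c * l f" if "integrable M f" for c f
  proof -
    have "(\<lambda>k. \<integral>x. u k x * (c * f x) \<partial>M) \<longlonglongrightarrow> c * l f"
      using tendsto_mult[OF tendsto_const[of c] l[OF that]] by (simp add: mult.left_commute)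
    then show ?thesis using l[of "\<lambda>x. c * f x"] that LIMSEQ_unique by auto
  qed
  have l_le: "\<bar>l f\<bar> \<le> K * (\<integral>x. \<bar>f x\<bar> \<partial>M)" if "integrable M f" for f
    by (rule tendsto_upperbound[OF tendsto_rabs[OF l[OF that]]])
       (use integral_bounded_mult_le[OF that u] in auto)
  (* adding K makes the set function nonnegative *)
  define g where "g A = l (indicator A) + K * measure M A" for A
  have ind: "integrable M (indicator A :: _ \<Rightarrow> real)" if "A \<in> sets M" for A
    using that by (simp add: emeasure_eq_measure)
  have g_bounds: "0 \<le> g A" "g A \<le> 2 * K * measure M A" if "A \<in> sets M" for A
    using l_le[OF ind[OF that]] that by (auto simp: g_def abs_le_iff)
  have g_add: "g (A \<union> B) = g A + g B" if "A \<in> sets M" "B \<in> sets M" "A \<inter> B = {}" for A B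
  proof -
    have "(indicator (A \<union> B) :: _ \<Rightarrow> real) = (\<lambda>x. indicator A x + indicator B x)"
      using that(3) by (auto simp: indicator_def fun_eq_iff)
    then show ?thesis
      using l_add[OF ind[OF that(1)] ind[OF that(2)]] finite_measure_Union[OF that]
      by (simp add: g_def distrib_left)
  qed
  have l0: "l (indicator {}) = 0"
  proof -
    have "(indicator {} :: 'a \<Rightarrow> real) = (\<lambda>x. 0)" by (auto simp: fun_eq_iff)
    then show ?thesis using l_scale[of "\<lambda>_. 0" 0] by simp
  qed
  have g_sum: "g (\<Union>i<n. A i) = (\<Sum>i<n. g (A i))" if "range A \<subseteq> sets M" "disjoint_family A" for A :: "nat \<Rightarrow> 'a set" and n
  proof (induction n)
    case 0
    show ?case using l0 by (simp add: g_def)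
  next
    case (Suc n)
    have "(\<Union>i<Suc n. A i) = (\<Union>i<n. A i) \<union> A n" by (auto simp: less_Suc_eq)
    moreover have "A i \<inter> A n = {}" if "i < n" for i
      using disjoint_family_onD[OF \<open>disjoint_family A\<close>, of i n] that by auto
    then have "(\<Union>i<n. A i) \<inter> A n = {}" by blast
    ultimately show ?case using g_add[of "\<Union>i<n. A i" "A n"] Suc that(1) by auto
  qed
  define N where "N = measure_of (space M) (sets M) (\<lambda>A. ennreal (g A))"
  have setsN[simp]: "sets N = sets M" by (simp add: N_def)
  have spaceN[simp]: "space N = space M" by (simp add: N_def)
  have emN: "emeasure N A = ennreal (g A)" if "A \<in> sets M" for A
  proof (rule emeasure_measure_of[OF N_def])
    show "positive (sets N) (\<lambda>A. ennreal (g A))" using l0 by (simp add: positive_def g_def)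
    show "countably_additive (sets N) (\<lambda>A. ennreal (g A))"
    proof (rule countably_additiveI)
      fix A :: "nat \<Rightarrow> 'a set" assume A: "range A \<subseteq> sets N" "disjoint_family A" "(\<Union>i. A i) \<in> sets N"
      then have A': "A i \<in> sets M" for i by auto
      have "(\<lambda>n. g (\<Union>i. A i) - (\<Sum>i<n. g (A i))) \<longlonglongrightarrow> 0"
      proof (rule tendsto_sandwich[OF _ _ tendsto_const])
        have tail: "g (\<Union>i. A i) - (\<Sum>i<n. g (A i)) = g ((\<Union>i. A i) - (\<Union>i<n. A i))" for n
        proof -
          have "(\<Union>i. A i) = (\<Union>i<n. A i) \<union> ((\<Union>i. A i) - (\<Union>i<n. A i))" by auto
          then have "g (\<Union>i. A i) = g ((\<Union>i<n. A i) \<union> ((\<Union>i. A i) - (\<Union>i<n. A i)))" by (rule arg_cong)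
          also have "\<dots> = g (\<Union>i<n. A i) + g ((\<Union>i. A i) - (\<Union>i<n. A i))"
            by (rule g_add) (use A' in auto)
          also have "g (\<Union>i<n. A i) = (\<Sum>i<n. g (A i))"
            by (rule g_sum) (use A A' in auto)
          finally show ?thesis by simp
        qed
        have m: "(\<Union>i. A i) - (\<Union>i<n. A i) \<in> sets M" for n using A' by auto
        show "\<forall>\<^sub>F n in sequentially. 0 \<le> g (\<Union>i. A i) - (\<Sum>i<n. g (A i))"
          unfolding tail using g_bounds(1)[OF m] by simp
        show "\<forall>\<^sub>F n in sequentially. g (\<Union>i. A i) - (\<Sum>i<n. g (A i)) \<le> 2 * K * measure M ((\<Union>i. A i) - (\<Union>i<n. A i))"
          unfolding tail using g_bounds(2)[OF m] by simp
        have "(\<lambda>n. measure M ((\<Union>i. A i) - (\<Union>i<n. A i))) \<longlonglongrightarrow> measure M (\<Inter>n. (\<Union>i. A i) - (\<Union>i<n. A i))"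
          by (intro finite_Lim_measure_decseq) (use m in \<open>auto simp: decseq_def\<close>)
        also have "(\<Inter>n. (\<Union>i. A i) - (\<Union>i<n. A i)) = {}" by auto
        finally show "(\<lambda>n. 2 * K * measure M ((\<Union>i. A i) - (\<Union>i<n. A i))) \<longlonglongrightarrow> 0"
          using tendsto_mult[OF tendsto_const[of "2 * K"]] by fastforce
      qed
      from tendsto_diff[OF tendsto_const[of "g (\<Union>i. A i)"] this]
      have "(\<lambda>i. g (A i)) sums g (\<Union>i. A i)" by (simp add: sums_def)
      then have "(\<lambda>i. ennreal (g (A i))) sums ennreal (g (\<Union>i. A i))"
        using A A' g_bounds(1) by (subst sums_ennreal) auto
      then show "(\<Sum>i. ennreal (g (A i))) = ennreal (g (\<Union>i. A i))" by (rule sums_unique[symmetric])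
    qed
  qed (use that sets.sets_into_space in auto)
  have "absolutely_continuous M N"
    unfolding absolutely_continuous_def
  proof
    fix A assume A: "A \<in> null_sets M"
    then have "g A \<le> 0" using g_bounds(2)[of A] by (auto simp: measure_eq_0_null_sets)
    then show "A \<in> null_sets N" using A emN[of A] by (auto simp: null_sets_def ennreal_neg)
  qed
  then obtain F where F[measurable]: "F \<in> borel_measurable M" and dens: "density M F = N"
    using Radon_Nikodym[of N] by auto
  have FA: "(\<integral>\<^sup>+x\<in>A. F x \<partial>M) = ennreal (g A)" if "A \<in> sets M" for A
    using emeasure_density[OF F that] emN[OF that] by (simp add: dens)
  have F_fin: "AE x in M. F x \<noteq> \<infinity>"
  proof (rule nn_integral_noteq_infinite)
    have "(\<integral>\<^sup>+x. F x \<partial>M) = (\<integral>\<^sup>+x\<in>space M. F x \<partial>M)"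
      by (intro nn_integral_cong) auto
    then show "(\<integral>\<^sup>+x. F x \<partial>M) \<noteq> \<infinity>" using FA[of "space M"] by simp
  qed auto
  define p where "p x = enn2real (F x)" for x
  have p[measurable]: "p \<in> borel_measurable M" unfolding p_def by measurable
  have p_nn: "(\<integral>\<^sup>+x. ennreal (p x * indicator A x) \<partial>M) = ennreal (g A)" if "A \<in> sets M" for A
  proof -
    have "(\<integral>\<^sup>+x. ennreal (p x * indicator A x) \<partial>M) = (\<integral>\<^sup>+x\<in>A. F x \<partial>M)"
      by (rule nn_integral_cong_AE)
         (use F_fin in \<open>eventually_elim, auto simp: p_def indicator_def less_top\<close>)
    then show ?thesis using FA[OF that] by simp
  qed
  have pA: "integrable M (\<lambda>x. p x * indicator A x)" "(\<integral>x. p x * indicator A x \<partial>M) = g A" if "A \<in> sets M" for A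
  proof -
    have "integrable M (\<lambda>x. p x * indicator A x) \<and> (\<integral>x. p x * indicator A x \<partial>M) = g A"
      by (rule nn_integral_eq_integrable[THEN iffD1]) (use that p_nn[OF that] g_bounds in \<open>auto simp: p_def\<close>)
    then show "integrable M (\<lambda>x. p x * indicator A x)" "(\<integral>x. p x * indicator A x \<partial>M) = g A" by auto
  qed
  have p_le: "AE x in M. p x \<le> 2 * K"
  proof -
    define A where "A = {x \<in> space M. 2 * K < p x}"
    have A[measurable]: "A \<in> sets M" unfolding A_def by measurable
    let ?q = "\<lambda>x. (p x - 2 * K) * indicator A x"
    have q: "integrable M ?q" "(\<integral>x. ?q x \<partial>M) = g A - 2 * K * measure M A"
      using pA[OF A] ind[OF A] A by (simp_all add: left_diff_distrib)
    have nn: "0 \<le> ?q x" for x by (auto simp: A_def indicator_def)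
    have "0 \<le> (\<integral>x. ?q x \<partial>M)" by (intro integral_nonneg_AE AE_I2 nn)
    then have "(\<integral>x. ?q x \<partial>M) = 0"
      using q(2) g_bounds(2)[OF A] by linarith
    then have "AE x in M. ?q x = 0"
      using integral_nonneg_eq_0_iff_AE[OF q(1)] nn by simp
    then show ?thesis
      by (rule AE_mp) (auto simp: A_def indicator_def intro!: AE_I2)
  qed
  (* clipping changes the density on a null set only and makes the bound hold everywhere *)
  define v where "v x = max (- K) (min K (p x - K))" for x
  have v[measurable]: "v \<in> borel_measurable M" unfolding v_def by measurable
  have v_le: "\<bar>v x\<bar> \<le> K" for x using K by (auto simp: v_def)
  note vint = integrable_bounded_mult[OF _ v, of _ K, OF _ v_le]
  have v_AE: "AE x in M. v x = p x - K"
    using p_le by eventually_elim (use K in \<open>auto simp: v_def p_def max_def min_def\<close>)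
  have "l f = (\<integral>x. v x * f x \<partial>M)" if "integrable M f" for f
    using that
  proof (induction rule: integrable_induct)
    case (base A c)
    have "(\<integral>x. v x * indicator A x \<partial>M) = (\<integral>x. p x * indicator A x - K * indicator A x \<partial>M)"
    proof (rule integral_cong_AE)
      show "AE x in M. v x * indicator A x = p x * indicator A x - K * indicator A x"
        using v_AE by eventually_elim (simp add: left_diff_distrib)
    qed (use base(1) in measurable)
    also have "\<dots> = l (indicator A)"
      using pA[OF base(1)] ind[OF base(1)] base(1) by (simp add: g_def)
    finally have "l (\<lambda>x. c * indicator A x) = (\<integral>x. v x * (c * indicator A x) \<partial>M)"
      using l_scale[OF ind[OF base(1)], of c] by (simp add: mult.left_commute)
    then show ?case by (simp add: mult.commute)
  next
    case (add f h)
    then show ?case using l_add[OF add.hyps] vint[OF add.hyps(1)] vint[OF add.hyps(2)] by (simp add: distrib_left)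
  next
    case (lim f s)
    have "(\<lambda>i. l (s i)) \<longlonglongrightarrow> l f" "(\<lambda>i. \<integral>x. v x * s i x \<partial>M) \<longlonglongrightarrow> (\<integral>x. v x * f x \<partial>M)"
    proof -
      have L1: "(\<lambda>i. \<integral>x. \<bar>s i x - f x\<bar> \<partial>M) \<longlonglongrightarrow> 0"
        by (rule dominated_L1_limit[where w="\<lambda>x. 2 * \<bar>f x\<bar>"]) (use lim in auto)
      have KL1: "(\<lambda>i. K * (\<integral>x. \<bar>s i x - f x\<bar> \<partial>M)) \<longlonglongrightarrow> 0"
        using tendsto_mult[OF tendsto_const[of K] L1] by simp
      have d: "integrable M (\<lambda>x. s i x - f x)" for i using lim by auto
      have e1: "l (s i) - l f = l (\<lambda>x. s i x - f x)" for i
        using l_add[OF d lim.hyps(4), of i] by simp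
      have "(\<lambda>i. l (s i) - l f) \<longlonglongrightarrow> 0"
        by (rule tendsto_rabs_zero_cancel, rule tendsto_sandwich[OF _ _ tendsto_const KL1])
           (use l_le[OF d] in \<open>auto simp: e1\<close>)
      then show "(\<lambda>i. l (s i)) \<longlonglongrightarrow> l f" by (simp add: LIM_zero_iff)
      have e2: "(\<integral>x. v x * s i x \<partial>M) - (\<integral>x. v x * f x \<partial>M) = (\<integral>x. v x * (s i x - f x) \<partial>M)" for i
        using vint[OF lim.hyps(1)] vint[OF lim.hyps(4)] by (simp add: right_diff_distrib)
      have "(\<lambda>i. (\<integral>x. v x * s i x \<partial>M) - (\<integral>x. v x * f x \<partial>M)) \<longlonglongrightarrow> 0"
        by (rule tendsto_rabs_zero_cancel, rule tendsto_sandwich[OF _ _ tendsto_const KL1])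
           (use integral_bounded_mult_le[OF d v v_le] in \<open>auto simp: e2\<close>)
      then show "(\<lambda>i. \<integral>x. v x * s i x \<partial>M) \<longlonglongrightarrow> (\<integral>x. v x * f x \<partial>M)" by (simp add: LIM_zero_iff)
    qed
    then show ?case using lim.IH LIMSEQ_unique by simp
  qed
  then show ?thesis using that[OF v v_le] l by metis
qed

text \<open>Reduction to a finite measure: Lebesgue measure is replaced by \<open>h dx\<close> with an integrable \<open>h > 0\<close>, and
the test function \<open>f\<close> by \<open>f / h\<close>.\<close>

lemma weak_limit_lborel:
  fixes u :: "nat \<Rightarrow> real^'n \<Rightarrow> real"
  assumes u: "\<And>k. u k \<in> borel_measurable borel" "\<And>k x. \<bar>u k x\<bar> \<le> K"
    and conv: "\<And>f. integrable lborel f \<Longrightarrow> convergent (\<lambda>k. pairing (u k) f)"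
  obtains v where "v \<in> borel_measurable borel" "\<And>x. \<bar>v x\<bar> \<le> K"
    "\<And>f. integrable lborel f \<Longrightarrow> (\<lambda>k. pairing (u k) f) \<longlonglongrightarrow> pairing v f"
proof -
  obtain h :: "real^'n \<Rightarrow> ennreal" where h[measurable]: "h \<in> borel_measurable borel"
    and h_int: "(\<integral>\<^sup>+x. h x \<partial>lborel) \<noteq> \<infinity>" and h_pos: "\<And>x. 0 < h x" "\<And>x. h x < \<infinity>"
    using sigma_finite_measure.Ex_finite_integrable_function[OF sigma_finite_lborel] by auto
  define q where "q x = enn2real (h x)" for x
  have q[measurable]: "q \<in> borel_measurable borel" unfolding q_def by measurable
  have q_pos: "0 < q x" for x using h_pos[of x] by (simp add: q_def enn2real_positive_iff)
  have hq: "h = (\<lambda>x. ennreal (q x))" using h_pos by (auto simp: q_def fun_eq_iff less_top)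
  let ?M = "density lborel h"
  interpret M: finite_measure ?M
    by (rule finite_measureI) (use h_int in \<open>simp add: emeasure_density\<close>)
  have K: "0 \<le> K" using u(2)[of 0 0] by linarith
  have intM: "integrable ?M f \<longleftrightarrow> integrable lborel (\<lambda>x. q x * f x)" if "f \<in> borel_measurable borel" for f :: "real^'n \<Rightarrow> real"
    unfolding hq using that q_pos by (subst integrable_density) (auto intro: less_imp_le)
  have lintM: "(\<integral>x. f x \<partial>?M) = (\<integral>x. q x * f x \<partial>lborel)" if "f \<in> borel_measurable borel" for f :: "real^'n \<Rightarrow> real"
    unfolding hq using that q_pos by (subst integral_density) (auto intro: less_imp_le)
  have uM: "(\<integral>x. w x * f x \<partial>?M) = pairing w (\<lambda>x. q x * f x)"
    if "f \<in> borel_measurable borel" "w \<in> borel_measurable borel" for f w :: "real^'n \<Rightarrow> real"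
    using that by (subst lintM) (auto simp: pairing_def mult_ac)
  obtain v where v: "v \<in> borel_measurable ?M" "\<And>x. \<bar>v x\<bar> \<le> K"
    "\<And>f. integrable ?M f \<Longrightarrow> (\<lambda>k. \<integral>x. u k x * f x \<partial>?M) \<longlonglongrightarrow> (\<integral>x. v x * f x \<partial>?M)"
  proof (rule M.weak_limit_density[of u K])
    show "convergent (\<lambda>k. \<integral>x. u k x * f x \<partial>?M)" if "integrable ?M f" for f
    proof -
      have f: "f \<in> borel_measurable borel" using borel_measurable_integrable[OF that] by simp
      then show ?thesis using conv[OF that[unfolded intM[OF f]]] by (simp only: uM[OF f u(1)])
    qed
  qed (use u K in auto)
  have v': "v \<in> borel_measurable borel" using v(1) by simp
  show ?thesis
  proof (rule that[OF v' v(2)])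
    fix f :: "real^'n \<Rightarrow> real" assume f: "integrable lborel f"
    then have fm[measurable]: "f \<in> borel_measurable borel" using borel_measurable_integrable by force
    have eq: "(\<lambda>x. q x * (f x / q x)) = f" using q_pos by (auto simp: fun_eq_iff less_imp_neq[symmetric])
    have m: "(\<lambda>x. f x / q x) \<in> borel_measurable borel" by measurable
    then have "integrable ?M (\<lambda>x. f x / q x)" using f by (simp only: intM eq)
    from v(3)[OF this] show "(\<lambda>k. pairing (u k) f) \<longlonglongrightarrow> pairing v f"
      by (simp only: uM[OF m u(1)] uM[OF m v'] eq)
  qed
qed

section \<open>Limits of approximate weak solutions\<close>

definition cyl_integrable :: "real \<Rightarrow> (real \<Rightarrow> real^'n \<Rightarrow> real) \<Rightarrow> bool" where
  "cyl_integrable T \<phi> \<longleftrightarrow> set_integrable lborel ({0<..<T} \<times> UNIV) (\<lambda>(s, x). \<phi> s x)"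

lemma cyl_integrable_integrable:
  fixes \<phi> :: "real \<Rightarrow> real^'n \<Rightarrow> real"
  assumes "cyl_integrable T \<phi>"
  shows "integrable (lborel \<Otimes>\<^sub>M lborel) (\<lambda>(s, x). indicator {0<..<T} s * \<phi> s x)"
proof -
  have "(\<lambda>p. indicat_real ({0<..<T} \<times> (UNIV :: (real^'n) set)) p *\<^sub>R (case p of (s, x) \<Rightarrow> \<phi> s x)) =
      (\<lambda>(s, x). indicator {0<..<T} s * \<phi> s x)"
    by (auto simp: indicator_def fun_eq_iff)
  then show ?thesis
    using assms unfolding cyl_integrable_def set_integrable_def by (simp add: lborel_prod)
qed

lemma cyl_integrableI:
  fixes \<phi> :: "real \<Rightarrow> real^'n \<Rightarrow> real"
  assumes "integrable (lborel \<Otimes>\<^sub>M lborel) (\<lambda>(s, x). indicator {0<..<T} s * \<phi> s x)"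
  shows "cyl_integrable T \<phi>"
proof -
  have "(\<lambda>p. indicat_real ({0<..<T} \<times> (UNIV :: (real^'n) set)) p *\<^sub>R (case p of (s, x) \<Rightarrow> \<phi> s x)) =
      (\<lambda>(s, x). indicator {0<..<T} s * \<phi> s x)"
    by (auto simp: indicator_def fun_eq_iff)
  then show ?thesis
    using assms unfolding cyl_integrable_def set_integrable_def by (simp add: lborel_prod)
qed

lemma cyl_integrable_add:
  fixes \<phi> \<psi> :: "real \<Rightarrow> real^'n \<Rightarrow> real"
  shows "cyl_integrable T \<phi> \<Longrightarrow> cyl_integrable T \<psi> \<Longrightarrow> cyl_integrable T (\<lambda>s x. \<phi> s x + \<psi> s x)"
  unfolding cyl_integrable_def split_beta by (rule set_integral_add(1))

lemma cyl_integrable_diff: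
  fixes \<phi> \<psi> :: "real \<Rightarrow> real^'n \<Rightarrow> real"
  shows "cyl_integrable T \<phi> \<Longrightarrow> cyl_integrable T \<psi> \<Longrightarrow> cyl_integrable T (\<lambda>s x. \<phi> s x - \<psi> s x)"
  unfolding cyl_integrable_def split_beta by (rule set_integral_diff(1))

lemma cyl_integrable_abs:
  fixes \<phi> :: "real \<Rightarrow> real^'n \<Rightarrow> real"
  shows "cyl_integrable T \<phi> \<Longrightarrow> cyl_integrable T (\<lambda>s x. \<bar>\<phi> s x\<bar>)"
  unfolding cyl_integrable_def split_beta by (rule set_integrable_abs)

lemma cyl_integrable_AE:
  fixes \<phi> :: "real \<Rightarrow> real^'n \<Rightarrow> real"
  assumes "cyl_integrable T \<phi>"
  shows "AE s in lborel. s \<in> {0<..<T} \<longrightarrow> integrable lborel (\<phi> s)"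
  using lborel_pair.AE_integrable_fst'[OF cyl_integrable_integrable[OF assms]]
  by eventually_elim (auto simp: indicator_def)

lemma cyl_integrable_section:
  fixes \<phi> :: "real \<Rightarrow> real^'n \<Rightarrow> real"
  assumes "cyl_integrable T \<phi>"
  shows "set_integrable lborel {0<..<T} (\<lambda>s. \<integral>x. \<phi> s x \<partial>lborel)"
  using lborel_pair.integrable_fst'[OF cyl_integrable_integrable[OF assms]]
  by (simp add: set_integrable_def)

definition bdd_on_strip :: "real \<Rightarrow> real \<Rightarrow> (real \<times> (real^'n) \<Rightarrow> real) \<Rightarrow> bool" where
  "bdd_on_strip T K u \<longleftrightarrow> u \<in> borel_measurable (restrict_space borel (strip T)) \<and> (\<forall>p\<in>strip T. \<bar>u p\<bar> \<le> K)"

lemma strip_borel[measurable]: "strip T \<in> sets borel"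
  unfolding strip_def by (intro borel_closed closed_Times) auto

lemma strip_iff: "(t, x) \<in> strip T \<longleftrightarrow> 0 \<le> t \<and> t \<le> T"
  by (auto simp: strip_def)

lemma bdd_on_strip_measurable:
  assumes "bdd_on_strip T K u"
  shows "(\<lambda>p. indicator (strip T) p * u p) \<in> borel_measurable borel"
  using assms by (simp add: bdd_on_strip_def borel_measurable_restrict_space_iff)

lemma bdd_on_strip_section:
  fixes u :: "real \<times> (real^'n) \<Rightarrow> real"
  assumes "bdd_on_strip T K u" "t \<in> {0..T}"
  shows "(\<lambda>x. u (t, x)) \<in> borel_measurable borel" "\<bar>u (t, x)\<bar> \<le> K"
proof -
  have "(\<lambda>x::real^'n. (t, x)) \<in> borel_measurable borel" by (intro borel_measurable_continuous_onI continuous_intros)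
  from measurable_compose[OF this bdd_on_strip_measurable[OF assms(1)]] assms(2)
  show "(\<lambda>x. u (t, x)) \<in> borel_measurable borel" by (simp add: strip_iff)
  show "\<bar>u (t, x)\<bar> \<le> K" using assms by (simp add: bdd_on_strip_def strip_iff)
qed

lemma cyl_integrable_bdd_mult:
  fixes u :: "real \<times> (real^'n) \<Rightarrow> real"
  assumes u: "bdd_on_strip T K u" and \<phi>: "cyl_integrable T \<phi>"
  shows "cyl_integrable T (\<lambda>s x. u (s, x) * \<phi> s x)"
proof (rule cyl_integrableI)
  have "integrable (lborel \<Otimes>\<^sub>M lborel) (\<lambda>p. (indicator (strip T) p * u p) * (case p of (s, x) \<Rightarrow> indicator {0<..<T} s * \<phi> s x))"
    (is "integrable _ ?g")
  proof (rule integrable_bounded_mult[OF cyl_integrable_integrable[OF \<phi>]])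
    show "(\<lambda>p. indicator (strip T) p * u p) \<in> borel_measurable (lborel \<Otimes>\<^sub>M lborel)"
      using bdd_on_strip_measurable[OF u] by (simp add: lborel_prod)
    show "\<bar>indicator (strip T) p * u p\<bar> \<le> \<bar>K\<bar>" for p
      using u by (auto simp: bdd_on_strip_def indicator_def intro: order_trans[OF _ abs_ge_self])
  qed
  also have "?g = (\<lambda>(s, x). indicator {0<..<T} s * (u (s, x) * \<phi> s x))"
    by (auto simp: fun_eq_iff indicator_def strip_iff)
  finally show "integrable (lborel \<Otimes>\<^sub>M lborel) \<dots>" .
qed

lemma set_integrable_pairing:
  fixes u :: "real \<times> (real^'n) \<Rightarrow> real"
  assumes "bdd_on_strip T K u" "cyl_integrable T \<phi>"
  shows "set_integrable lborel {0<..<T} (\<lambda>s. pairing (\<lambda>x. u (s, x)) (\<phi> s))"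
  unfolding pairing_def by (rule cyl_integrable_section[OF cyl_integrable_bdd_mult[OF assms]])

text \<open>Only for almost every \<open>s\<close>: at an exceptional time \<open>\<phi> s\<close> need not be integrable, and the integral on the
right then has the value \<open>0\<close>.\<close>

lemma AE_pairing_le:
  fixes u :: "real \<times> (real^'n) \<Rightarrow> real"
  assumes u: "bdd_on_strip T K u" and \<phi>: "cyl_integrable T \<phi>"
  shows "AE s in lborel. s \<in> {0<..<T} \<longrightarrow> \<bar>pairing (\<lambda>x. u (s, x)) (\<phi> s)\<bar> \<le> K * (\<integral>x. \<bar>\<phi> s x\<bar> \<partial>lborel)"
  using cyl_integrable_AE[OF \<phi>]
proof eventually_elim
  case (elim s)
  show ?case
  proof
    assume s: "s \<in> {0<..<T}"
    then have s': "s \<in> {0..T}" by auto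
    show "\<bar>pairing (\<lambda>x. u (s, x)) (\<phi> s)\<bar> \<le> K * (\<integral>x. \<bar>\<phi> s x\<bar> \<partial>lborel)"
      unfolding pairing_def
      by (rule integral_bounded_mult_le) (use elim s bdd_on_strip_section[OF u s'] in auto)
  qed
qed

lemma set_integral_greaterThanLessThan_split:
  fixes k :: "real \<Rightarrow> real"
  assumes "set_integrable lborel {0<..<T} k" "0 \<le> s" "s \<le> t" "t \<le> T"
  shows "(LBINT r:{0<..<t}. k r) = (LBINT r:{0<..<s}. k r) + (LBINT r:{s<..<t}. k r)"
proof -
  have "set_integrable lborel {0<..<t} k" by (rule set_integrable_subset[OF assms(1)]) (use assms in auto)
  then have "(LBINT r=ereal 0..ereal s. k r) + (LBINT r=ereal s..ereal t. k r) = (LBINT r=ereal 0..ereal t. k r)"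
    using assms by (intro interval_integral_sum) (auto simp: interval_lebesgue_integrable_def min_def max_def)
  then show ?thesis using assms by (simp add: interval_lebesgue_integral_le_eq)
qed

lemma set_integral_small_interval:
  fixes k :: "real \<Rightarrow> real"
  assumes k: "set_integrable lborel {0<..<T} k" and e: "e > 0" and T: "0 < T"
  obtains d where "d > 0" "\<And>s t. 0 \<le> s \<Longrightarrow> s \<le> t \<Longrightarrow> t \<le> T \<Longrightarrow> t - s < d \<Longrightarrow> \<bar>LBINT r:{s<..<t}. k r\<bar> < e"
proof -
  let ?I = "\<lambda>t. LBINT r:{0<..<t}. k r"
  have I_eq: "?I t = integral {0..t} k" if "t \<le> T" for t
  proof -
    have "set_integrable lborel {0<..<t} k" by (rule set_integrable_subset[OF k]) (use that in auto)
    then show ?thesis using set_borel_integral_eq_integral(2) integral_open_interval_real by metis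
  qed
  have "k integrable_on {0<..<T}" using set_borel_integral_eq_integral(1)[OF k] .
  then have "k integrable_on {0..T}" by (simp add: integrable_on_open_interval_real)
  then have "continuous_on {0..T} (\<lambda>t. integral {0..t} k)" by (rule indefinite_integral_continuous_1)
  then have "continuous_on {0..T} ?I" by (rule continuous_on_eq) (simp add: I_eq)
  then have "uniformly_continuous_on {0..T} ?I" by (intro compact_uniformly_continuous) auto
  then obtain d where d: "d > 0" "\<And>s t. s \<in> {0..T} \<Longrightarrow> t \<in> {0..T} \<Longrightarrow> dist t s < d \<Longrightarrow> dist (?I t) (?I s) < e"
    using e unfolding uniformly_continuous_on_def by metis
  show ?thesis
  proof (rule that[OF d(1)])
    fix s t assume st: "0 \<le> s" "s \<le> t" "t \<le> T" "t - s < d"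
    then have "dist (?I t) (?I s) < e" by (intro d(2)) (auto simp: dist_real_def)
    then show "\<bar>LBINT r:{s<..<t}. k r\<bar> < e"
      using set_integral_greaterThanLessThan_split[OF k st(1-3)] by (simp add: dist_real_def)
  qed
qed

lemma set_integral_abs_le:
  fixes k N :: "real \<Rightarrow> real"
  assumes "set_integrable M A k" "set_integrable M A N" "AE r in M. r \<in> A \<longrightarrow> \<bar>k r\<bar> \<le> N r"
  shows "\<bar>set_lebesgue_integral M A k\<bar> \<le> set_lebesgue_integral M A N"
proof -
  have "\<bar>set_lebesgue_integral M A k\<bar> \<le> (\<integral>r. \<bar>indicator A r *\<^sub>R k r\<bar> \<partial>M)"
    unfolding set_lebesgue_integral_def by (rule integral_abs_bound)
  also have "\<dots> \<le> set_lebesgue_integral M A N"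
    unfolding set_lebesgue_integral_def
  proof (rule integral_mono_AE)
    show "AE r in M. \<bar>indicator A r *\<^sub>R k r\<bar> \<le> indicator A r *\<^sub>R N r"
      using assms(3) by eventually_elim (auto simp: indicator_def)
  qed (use assms in \<open>auto simp: set_integrable_def\<close>)
  finally show ?thesis .
qed

definition residual where
  "residual A u0 F u \<zeta> t = pairing (\<lambda>x. u (t, x)) \<zeta> - (pairing u0 \<zeta>
       + (LBINT s:{0<..<t}. pairing (\<lambda>x. u (s, x)) (A s \<zeta>)) + (LBINT s:{0<..<t}. pairing (F s) \<zeta>))"

lemma weak_solution_iff_residual:
  "weak_solution T A u0 F u \<longleftrightarrow> (\<forall>\<zeta>\<in>C0_inf. \<forall>t\<in>{0..T}. residual A u0 F u \<zeta> t = 0)"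
  by (auto simp: weak_solution_def residual_def)

lemma pairing_increment_le:
  fixes u :: "real \<times> (real^'n) \<Rightarrow> real"
  assumes u: "bdd_on_strip T K u" and A: "cyl_integrable T (\<lambda>s. A s \<zeta>)"
    and F: "set_integrable lborel {0<..<T} (\<lambda>s. pairing (F s) \<zeta>)"
    and res: "\<And>t. t \<in> {0..T} \<Longrightarrow> \<bar>residual A u0 F u \<zeta> t\<bar> \<le> e"
    and st: "0 \<le> s" "s \<le> t" "t \<le> T"
  shows "\<bar>pairing (\<lambda>x. u (t, x)) \<zeta> - pairing (\<lambda>x. u (s, x)) \<zeta>\<bar> \<le>
    (LBINT r:{s<..<t}. K * (\<integral>x. \<bar>A r \<zeta> x\<bar> \<partial>lborel) + \<bar>pairing (F r) \<zeta>\<bar>) + 2 * e"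
proof -
  note P = set_integrable_pairing[OF u A]
  have sub: "set_integrable lborel {s<..<t} k" if "set_integrable lborel {0<..<T} k" for k :: "real \<Rightarrow> real"
    by (rule set_integrable_subset[OF that]) (use st in auto)
  have KN: "set_integrable lborel {0<..<T} (\<lambda>r. K * (\<integral>x. \<bar>A r \<zeta> x\<bar> \<partial>lborel))"
    using cyl_integrable_section[OF cyl_integrable_abs[OF A]] by (intro set_integrable_mult_right) simp
  have 1: "\<bar>LBINT r:{s<..<t}. pairing (\<lambda>x. u (r, x)) (A r \<zeta>)\<bar> \<le> (LBINT r:{s<..<t}. K * (\<integral>x. \<bar>A r \<zeta> x\<bar> \<partial>lborel))"
  proof (rule set_integral_abs_le[OF sub[OF P] sub[OF KN]])
    show "AE r in lborel. r \<in> {s<..<t} \<longrightarrow> \<bar>pairing (\<lambda>x. u (r, x)) (A r \<zeta>)\<bar> \<le> K * (\<integral>x. \<bar>A r \<zeta> x\<bar> \<partial>lborel)"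
      using AE_pairing_le[OF u A] by eventually_elim (use st in auto)
  qed
  have 2: "\<bar>LBINT r:{s<..<t}. pairing (F r) \<zeta>\<bar> \<le> (LBINT r:{s<..<t}. \<bar>pairing (F r) \<zeta>\<bar>)"
    by (rule set_integral_abs_le[OF sub[OF F] sub[OF set_integrable_abs[OF F]]]) auto
  have 3: "(LBINT r:{s<..<t}. K * (\<integral>x. \<bar>A r \<zeta> x\<bar> \<partial>lborel) + \<bar>pairing (F r) \<zeta>\<bar>) =
     (LBINT r:{s<..<t}. K * (\<integral>x. \<bar>A r \<zeta> x\<bar> \<partial>lborel)) + (LBINT r:{s<..<t}. \<bar>pairing (F r) \<zeta>\<bar>)"
    by (rule set_integral_add(2)[OF sub[OF KN] sub[OF set_integrable_abs[OF F]]])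
  have "\<bar>residual A u0 F u \<zeta> t\<bar> \<le> e" "\<bar>residual A u0 F u \<zeta> s\<bar> \<le> e" using st by (auto intro!: res)
  then show ?thesis
    using 1 2 unfolding 3 residual_def set_integral_greaterThanLessThan_split[OF P st] set_integral_greaterThanLessThan_split[OF F st]
    by linarith
qed

text \<open>First a subsequence is chosen that converges weakly at the times of a countable dense set. By
\<open>pairing_increment_le\<close> the functions \<open>t \<mapsto> (u\<^sub>t, \<zeta>)\<close> have a common modulus of continuity up to a
vanishing error, so the subsequence converges against test functions at every time. At a fixed time a
further subsequence, which may depend on the time, identifies the limit functional with a bounded Borel
function; (W4) replaces these functions by an element of \<open>W\<close>. In the integral term of the equation the
limit is taken by dominated convergence, using convergence against integrable functions at each time.\<close>

lemma weak_solution_of_approximate_solutions: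
  fixes u :: "nat \<Rightarrow> real \<times> (real^'n) \<Rightarrow> real"
  assumes T: "0 < T"
    and W: "\<And>w. w \<in> W \<Longrightarrow> bdd_on_strip T K w" and closed: "closed_under_weak_limits T W"
    and A: "\<And>\<zeta>. \<zeta> \<in> C0_inf \<Longrightarrow> cyl_integrable T (\<lambda>s. A s \<zeta>)"
    and F: "\<And>\<zeta>. \<zeta> \<in> C0_inf \<Longrightarrow> set_integrable lborel {0<..<T} (\<lambda>s. pairing (F s) \<zeta>)"
    and u: "\<And>m. u m \<in> W"
    and res: "\<And>\<zeta> e. \<zeta> \<in> C0_inf \<Longrightarrow> 0 < e \<Longrightarrow>
      \<forall>\<^sub>F m in sequentially. \<forall>t\<in>{0..T}. \<bar>residual A u0 F (u m) \<zeta> t\<bar> \<le> e"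
  shows "\<exists>w\<in>W. weak_solution T A u0 F w"
proof -
  note uW = W[OF u]
  (* a dense sequence in [0,T]: truncation to the interval only brings a rational closer *)
  define q where "q j = min T (max 0 (from_nat_into (\<rat>::real set) j))" for j
  have q: "q j \<in> {0..T}" for j using T by (auto simp: q_def)
  have q_dense: "\<exists>j. \<bar>q j - t\<bar> < d" if t: "t \<in> {0..T}" and d: "d > 0" for t d
  proof -
    obtain x where x: "x \<in> \<rat>" "t < x" "x < t + d" using Rats_dense_in_real[of t "t + d"] d by auto
    obtain j where "from_nat_into (\<rat>::real set) j = x" using from_nat_into_surj[OF countable_rat x(1)] by blast
    then show ?thesis using x t d by (intro exI[of _ j]) (auto simp: q_def min_def max_def)
  qed
  obtain r where r: "strict_mono r"
    and conv_q: "\<And>j f. integrable lborel f \<Longrightarrow> convergent (\<lambda>k. pairing (\<lambda>x. u (r k) (q j, x)) f)"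
    using convergent_pairing_subsequence[of "\<lambda>j k x. u k (q j, x)" K] bdd_on_strip_section[OF uW q] by blast
  have conv: "convergent (\<lambda>k. pairing (\<lambda>x. u (r k) (t, x)) \<zeta>)" if t: "t \<in> {0..T}" and \<zeta>: "\<zeta> \<in> C0_inf" for t \<zeta>
  proof (rule Cauchy_convergent, rule CauchyI)
    fix \<epsilon> :: real assume \<epsilon>: "\<epsilon> > 0"
    let ?k = "\<lambda>r. K * (\<integral>x. \<bar>A r \<zeta> x\<bar> \<partial>lborel) + \<bar>pairing (F r) \<zeta>\<bar>"
    have "set_integrable lborel {0<..<T} ?k"
      by (intro set_integral_add set_integrable_abs F \<zeta> set_integrable_mult_right
          cyl_integrable_section cyl_integrable_abs A)
    then obtain d where d: "d > 0" "\<And>s t. 0 \<le> s \<Longrightarrow> s \<le> t \<Longrightarrow> t \<le> T \<Longrightarrow> t - s < d \<Longrightarrow> \<bar>LBINT r:{s<..<t}. ?k r\<bar> < \<epsilon> / 8"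
      using set_integral_small_interval[of T ?k "\<epsilon> / 8"] \<epsilon> T by auto
    obtain j where j: "\<bar>q j - t\<bar> < d" using q_dense[OF t d(1)] by blast
    let ?p = "\<lambda>k t. pairing (\<lambda>x. u (r k) (t, x)) \<zeta>"
    have "Cauchy (\<lambda>k. ?p k (q j))"
      using conv_q[OF C0_inf_integrable[OF \<zeta>]] convergent_Cauchy by blast
    then obtain M1 where M1: "\<And>m n. m \<ge> M1 \<Longrightarrow> n \<ge> M1 \<Longrightarrow> \<bar>?p m (q j) - ?p n (q j)\<bar> < \<epsilon> / 4"
      using CauchyD[of "\<lambda>k. ?p k (q j)" "\<epsilon> / 4"] \<epsilon> by (auto simp: real_norm_def)
    have "\<epsilon> / 16 > 0" using \<epsilon> by simp
    from res[OF \<zeta> this] obtain M2 where M2: "\<forall>m\<ge>M2. \<forall>t\<in>{0..T}. \<bar>residual A u0 F (u m) \<zeta> t\<bar> \<le> \<epsilon> / 16"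
      unfolding eventually_sequentially by blast
    have near: "\<bar>?p m t - ?p m (q j)\<bar> < \<epsilon> / 4" if "m \<ge> M2" for m
    proof -
      have inc: "\<bar>?p m b - ?p m a\<bar> < \<epsilon> / 4" if ab: "0 \<le> a" "a \<le> b" "b \<le> T" "b - a < d" for a b
      proof -
        have "r m \<ge> M2" using seq_suble[OF r, of m] \<open>m \<ge> M2\<close> by linarith
        then have "\<bar>?p m b - ?p m a\<bar> \<le> (LBINT r:{a<..<b}. ?k r) + 2 * (\<epsilon> / 16)"
          by (intro pairing_increment_le[OF uW A[OF \<zeta>] F[OF \<zeta>] M2[rule_format]]) (use ab in auto)
        then show ?thesis using d(2)[OF ab] by linarith
      qed
      show ?thesis
        using inc[of t "q j"] inc[of "q j" t] j t q[of j] by (cases "t \<le> q j") (auto simp: abs_minus_commute)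
    qed
    have "norm (?p m t - ?p n t) < \<epsilon>" if "m \<ge> max M1 M2" "n \<ge> max M1 M2" for m n
    proof -
      have "\<bar>?p m t - ?p m (q j)\<bar> < \<epsilon> / 4" "\<bar>?p n t - ?p n (q j)\<bar> < \<epsilon> / 4" "\<bar>?p m (q j) - ?p n (q j)\<bar> < \<epsilon> / 4"
        using near[of m] near[of n] M1[of m n] that by simp_all
      then have "-\<epsilon> < ?p m t - ?p n t \<and> ?p m t - ?p n t < \<epsilon>"
        unfolding abs_less_iff using \<epsilon> by linarith
      then show ?thesis unfolding real_norm_def abs_less_iff by linarith
    qed
    then show "\<exists>M. \<forall>m\<ge>M. \<forall>n\<ge>M. norm (?p m t - ?p n t) < \<epsilon>" by blast
  qed
  have "\<exists>v. v \<in> borel_measurable borel \<and> (\<forall>x. \<bar>v x\<bar> \<le> K) \<and>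
      (\<forall>\<zeta>\<in>C0_inf. (\<lambda>k. pairing (\<lambda>x. u (r k) (t, x)) \<zeta>) \<longlonglongrightarrow> pairing v \<zeta>)" if t: "t \<in> {0..T}" for t
  proof -
    note ub = bdd_on_strip_section[OF uW t]
    obtain r' where r': "strict_mono r'"
      and conv': "\<And>f. integrable lborel f \<Longrightarrow> convergent (\<lambda>k. pairing (\<lambda>x. u (r (r' k)) (t, x)) f)"
      using convergent_pairing_subsequence[of "\<lambda>_ k x. u (r k) (t, x)" K] ub by metis
    obtain v where v: "v \<in> borel_measurable borel" "\<And>x. \<bar>v x\<bar> \<le> K"
      and lim: "\<And>f. integrable lborel f \<Longrightarrow> (\<lambda>k. pairing (\<lambda>x. u (r (r' k)) (t, x)) f) \<longlonglongrightarrow> pairing v f"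
      using weak_limit_lborel[of "\<lambda>k x. u (r (r' k)) (t, x)" K] ub conv' by metis
    have "(\<lambda>k. pairing (\<lambda>x. u (r k) (t, x)) \<zeta>) \<longlonglongrightarrow> pairing v \<zeta>" if \<zeta>: "\<zeta> \<in> C0_inf" for \<zeta>
    proof -
      obtain l where l: "(\<lambda>k. pairing (\<lambda>x. u (r k) (t, x)) \<zeta>) \<longlonglongrightarrow> l"
        using conv[OF t \<zeta>] unfolding convergent_def by blast
      from LIMSEQ_subseq_LIMSEQ[OF this r'] lim[OF C0_inf_integrable[OF \<zeta>]] have "l = pairing v \<zeta>"
        using LIMSEQ_unique by (fastforce simp: o_def)
      with l show ?thesis by simp
    qed
    with v show ?thesis by blast
  qed
  then obtain v where v: "\<And>t. t \<in> {0..T} \<Longrightarrow> v t \<in> borel_measurable borel" "\<And>t x. t \<in> {0..T} \<Longrightarrow> \<bar>v t x\<bar> \<le> K"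
    and lim_v: "\<And>t \<zeta>. t \<in> {0..T} \<Longrightarrow> \<zeta> \<in> C0_inf \<Longrightarrow> (\<lambda>k. pairing (\<lambda>x. u (r k) (t, x)) \<zeta>) \<longlonglongrightarrow> pairing (v t) \<zeta>"
    by metis
  have "\<exists>w\<in>W. \<forall>t\<in>{0..T}. AE x in lborel. w (t, x) = (\<lambda>(t, x). v t x) (t, x)"
  proof (rule closed[unfolded closed_under_weak_limits_def, rule_format, of "\<lambda>k. u (r k)"])
    show "bounded ((\<lambda>(t, x). v t x) ` strip T)"
      using v(2) by (intro boundedI[of _ K]) (auto simp: strip_def)
  qed (use u v lim_v in auto)
  then obtain w where w: "w \<in> W" and wv: "\<And>t. t \<in> {0..T} \<Longrightarrow> AE x in lborel. w (t, x) = v t x" by auto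
  note wW = W[OF w]
  have lim_w: "(\<lambda>k. pairing (\<lambda>x. u (r k) (t, x)) \<zeta>) \<longlonglongrightarrow> pairing (\<lambda>x. w (t, x)) \<zeta>"
    if t: "t \<in> {0..T}" and \<zeta>: "\<zeta> \<in> C0_inf" for t \<zeta>
  proof -
    have "pairing (\<lambda>x. w (t, x)) \<zeta> = pairing (v t) \<zeta>"
      unfolding pairing_def
    proof (rule integral_cong_AE)
      show "AE x in lborel. w (t, x) * \<zeta> x = v t x * \<zeta> x" using wv[OF t] by eventually_elim simp
    qed (use bdd_on_strip_section(1)[OF wW t] v(1)[OF t] C0_inf_borel[OF \<zeta>] in auto)
    then show ?thesis using lim_v[OF t \<zeta>] by simp
  qed
  have lim_f: "(\<lambda>k. pairing (\<lambda>x. u (r k) (t, x)) f) \<longlonglongrightarrow> pairing (\<lambda>x. w (t, x)) f"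
    if t: "t \<in> {0..T}" and f: "integrable lborel f" for t f
    by (rule weak_convergence_from_test_functions[where K=K])
       (use bdd_on_strip_section[OF uW t] bdd_on_strip_section[OF wW t] lim_w[OF t] f in auto)
  have lim_A: "(\<lambda>k. LBINT s:{0<..<t}. pairing (\<lambda>x. u (r k) (s, x)) (A s \<zeta>)) \<longlonglongrightarrow>
      (LBINT s:{0<..<t}. pairing (\<lambda>x. w (s, x)) (A s \<zeta>))" if t: "t \<in> {0..T}" and \<zeta>: "\<zeta> \<in> C0_inf" for t \<zeta>
  proof -
    have sub: "set_integrable lborel {0<..<t} k" if "set_integrable lborel {0<..<T} k" for k :: "real \<Rightarrow> real"
      by (rule set_integrable_subset[OF that]) (use t in auto)
    have KN: "set_integrable lborel {0<..<t} (\<lambda>r. K * (\<integral>x. \<bar>A r \<zeta> x\<bar> \<partial>lborel))"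
      using cyl_integrable_section[OF cyl_integrable_abs[OF A[OF \<zeta>]]] by (intro sub set_integrable_mult_right) simp
    note Pu = sub[OF set_integrable_pairing[OF uW A[OF \<zeta>]]]
    note Pw = sub[OF set_integrable_pairing[OF wW A[OF \<zeta>]]]
    show ?thesis
      unfolding set_lebesgue_integral_def
    proof (rule integral_dominated_convergence[where w="\<lambda>s. indicator {0<..<t} s *\<^sub>R (K * (\<integral>x. \<bar>A s \<zeta> x\<bar> \<partial>lborel))"])
      show "AE s in lborel. (\<lambda>k. indicator {0<..<t} s *\<^sub>R pairing (\<lambda>x. u (r k) (s, x)) (A s \<zeta>)) \<longlonglongrightarrow>
         indicator {0<..<t} s *\<^sub>R pairing (\<lambda>x. w (s, x)) (A s \<zeta>)"
        using cyl_integrable_AE[OF A[OF \<zeta>]]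
      proof eventually_elim
        case (elim s)
        show ?case
        proof (cases "s \<in> {0<..<t}")
          case True
          then show ?thesis using t elim by (intro tendsto_scaleR tendsto_const lim_f) auto
        qed simp
      qed
      show "AE s in lborel. norm (indicator {0<..<t} s *\<^sub>R pairing (\<lambda>x. u (r k) (s, x)) (A s \<zeta>)) \<le>
          indicator {0<..<t} s *\<^sub>R (K * (\<integral>x. \<bar>A s \<zeta> x\<bar> \<partial>lborel))" for k
        using AE_pairing_le[OF uW A[OF \<zeta>], of "r k"]
        by eventually_elim (use t in \<open>auto simp: indicator_def\<close>)
    qed (use KN Pu Pw in \<open>auto simp: set_integrable_def dest: borel_measurable_integrable\<close>)
  qed
  have "residual A u0 F w \<zeta> t = 0" if \<zeta>: "\<zeta> \<in> C0_inf" and t: "t \<in> {0..T}" for \<zeta> t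
  proof -
    have "(\<lambda>k. residual A u0 F (u (r k)) \<zeta> t) \<longlonglongrightarrow> residual A u0 F w \<zeta> t"
      unfolding residual_def by (intro tendsto_intros lim_w lim_A t \<zeta>)
    moreover have "(\<lambda>k. residual A u0 F (u (r k)) \<zeta> t) \<longlonglongrightarrow> 0"
    proof (rule LIMSEQ_I)
      fix e :: real assume "e > 0"
      then have "e / 2 > 0" by simp
      from res[OF \<zeta> this] obtain M where M: "\<And>m. m \<ge> M \<Longrightarrow> \<bar>residual A u0 F (u m) \<zeta> t\<bar> \<le> e / 2"
        using t unfolding eventually_sequentially by blast
      have "norm (residual A u0 F (u (r k)) \<zeta> t - 0) < e" if "k \<ge> M" for k
        using M[of "r k"] seq_suble[OF r, of k] that \<open>e > 0\<close> by auto
      then show "\<exists>no. \<forall>k\<ge>no. norm (residual A u0 F (u (r k)) \<zeta> t - 0) < e" by blast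
    qed
    ultimately show ?thesis using LIMSEQ_unique by blast
  qed
  then show ?thesis using w unfolding weak_solution_iff_residual by blast
qed

section \<open>Free terms moved by the group\<close>

lemma cyl_integrable_dominated:
  fixes \<Phi> :: "real \<Rightarrow> real^'n \<Rightarrow> real"
  assumes \<Phi>: "(\<lambda>(s, x). indicator {0<..<T} s * \<Phi> s x) \<in> borel_measurable borel"
    and \<phi>: "integrable lborel \<phi>"
    and le: "\<And>s x. s \<in> {0<..<T} \<Longrightarrow> \<bar>\<Phi> s x\<bar> \<le> \<bar>\<phi> x\<bar>"
  shows "cyl_integrable T \<Phi>"
proof (rule cyl_integrableI, rule lborel_pair.Fubini_integrable)
  let ?g = "\<lambda>(s, x). indicator {0<..<T} s * \<Phi> s x"
  show m: "?g \<in> borel_measurable (lborel \<Otimes>\<^sub>M lborel)" using \<Phi> by (simp add: lborel_prod)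
  have sec: "(\<lambda>x. ?g (s, x)) \<in> borel_measurable lborel" for s
    using measurable_compose[OF measurable_Pair1' m] by simp
  have int: "integrable lborel (\<lambda>x. ?g (s, x))" for s
    by (rule Bochner_Integration.integrable_bound[OF \<phi> sec]) (use le[of s] in \<open>auto simp: indicator_def\<close>)
  then show "AE s in lborel. integrable lborel (\<lambda>x. ?g (s, x))" by simp
  show "integrable lborel (\<lambda>s. \<integral>x. norm (?g (s, x)) \<partial>lborel)"
  proof (rule Bochner_Integration.integrable_bound)
    show "integrable lborel (\<lambda>s. indicator {0<..<T} s * (\<integral>x. \<bar>\<phi> x\<bar> \<partial>lborel))"
      using emeasure_lborel_box_finite[of "0::real" T]
      by (intro integrable_mult_left integrable_real_indicator) auto
    show "(\<lambda>s. \<integral>x. norm (?g (s, x)) \<partial>lborel) \<in> borel_measurable lborel"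
      using m by measurable
    show "AE s in lborel. norm (\<integral>x. norm (?g (s, x)) \<partial>lborel) \<le> norm (indicator {0<..<T} s * (\<integral>x. \<bar>\<phi> x\<bar> \<partial>lborel))"
    proof (intro AE_I2)
      fix s
      have "(\<integral>x. norm (?g (s, x)) \<partial>lborel) \<le> indicator {0<..<T} s * (\<integral>x. \<bar>\<phi> x\<bar> \<partial>lborel)"
      proof (cases "s \<in> {0<..<T}")
        case True
        have "(\<integral>x. norm (?g (s, x)) \<partial>lborel) \<le> (\<integral>x. \<bar>\<phi> x\<bar> \<partial>lborel)"
          by (intro integral_mono integrable_norm int integrable_abs \<phi>) (use le True in auto)
        then show ?thesis using True by simp
      qed simp
      then show "norm (\<integral>x. norm (?g (s, x)) \<partial>lborel) \<le> norm (indicator {0<..<T} s * (\<integral>x. \<bar>\<phi> x\<bar> \<partial>lborel))"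
        by (simp add: integral_nonneg_AE)
    qed
  qed
qed

lemma affine_borel: "g \<in> affine_maps \<Longrightarrow> g \<in> borel_measurable borel"
  by (auto simp: affine_maps_def intro!: borel_measurable_continuous_onI continuous_intros)

definition compose_coords ::
    "(real^'n^'n) \<times> (real^'n) \<Rightarrow> (real^'n^'n) \<times> (real^'n) \<Rightarrow> (real^'n^'n) \<times> (real^'n)" where
  "compose_coords c d = (fst c ** fst d, fst c *v snd d + snd c)"

lemma affine_coords_compose:
  assumes "g \<in> affine_maps" "k \<in> affine_maps"
  shows "affine_coords (g \<circ> k) = compose_coords (affine_coords g) (affine_coords k)"
proof -
  from assms obtain a b c d where *: "g = (\<lambda>x. a *v x + b)" "k = (\<lambda>x. c *v x + d)"
    by (auto simp: affine_maps_def)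
  have "g \<circ> k = (\<lambda>x. (a ** c) *v x + (a *v d + b))"
    by (auto simp: * fun_eq_iff matrix_vector_right_distrib matrix_vector_mul_assoc)
  then show ?thesis by (simp add: * affine_coords_affine compose_coords_def)
qed

lemma continuous_compose_coords: "continuous_on A (\<lambda>c. compose_coords c d)"
  unfolding compose_coords_def matrix_matrix_mult_def matrix_vector_mult_def
  by (intro continuous_intros)

lemma bdd_meas_maps_altdef:
  "g \<in> bdd_meas_maps I X \<longleftrightarrow> g \<in> I \<rightarrow>\<^sub>E X \<and>
     (\<lambda>t. affine_coords (g t)) \<in> borel_measurable (restrict_space borel I) \<and>
     bounded ((\<lambda>t. affine_coords (g t)) ` I)"
proof -
  have "(\<exists>C. \<forall>t\<in>I. norm (fst (affine_coords (g t))) + norm (snd (affine_coords (g t))) \<le> C) \<longleftrightarrow>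
    bounded ((\<lambda>t. affine_coords (g t)) ` I)"
  proof
    assume "\<exists>C. \<forall>t\<in>I. norm (fst (affine_coords (g t))) + norm (snd (affine_coords (g t))) \<le> C"
    then obtain C where C: "\<And>t. t \<in> I \<Longrightarrow> norm (fst (affine_coords (g t))) + norm (snd (affine_coords (g t))) \<le> C" by blast
    have "norm (affine_coords (g t)) \<le> C" if "t \<in> I" for t
      using norm_Pair_le[of "fst (affine_coords (g t))" "snd (affine_coords (g t))"] C[OF that] by simp
    then show "bounded ((\<lambda>t. affine_coords (g t)) ` I)" by (intro boundedI) auto
  next
    assume "bounded ((\<lambda>t. affine_coords (g t)) ` I)"
    then obtain C where C: "\<And>t. t \<in> I \<Longrightarrow> norm (affine_coords (g t)) \<le> C" by (auto simp: bounded_iff)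
    have "norm (fst (affine_coords (g t))) + norm (snd (affine_coords (g t))) \<le> 2 * C" if "t \<in> I" for t
      using C[OF that] norm_fst_le[of "fst (affine_coords (g t))" "snd (affine_coords (g t))"]
        norm_snd_le[of "snd (affine_coords (g t))" "fst (affine_coords (g t))"] by simp
    then show "\<exists>C. \<forall>t\<in>I. norm (fst (affine_coords (g t))) + norm (snd (affine_coords (g t))) \<le> C" by blast
  qed
  then show ?thesis by (auto simp: bdd_meas_maps_def)
qed

text \<open>The data of the theorem with one solution map \<open>U\<close> and one free term \<open>h\<close> fixed.\<close>

locale evolution =
  fixes T K :: real
    and G :: "(real ^ 'n \<Rightarrow> real ^ 'n) set"
    and W :: "(real \<times> (real ^ 'n) \<Rightarrow> real) set"
    and L :: "real \<Rightarrow> (real ^ 'n \<Rightarrow> real) \<Rightarrow> real ^ 'n \<Rightarrow> real"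
    and u0 :: "real ^ 'n \<Rightarrow> real"
    and f :: "real \<times> (real ^ 'n) \<Rightarrow> real"
    and U :: "(real \<Rightarrow> real ^ 'n \<Rightarrow> real ^ 'n) \<Rightarrow> real \<times> (real ^ 'n) \<Rightarrow> real"
    and h :: "real \<Rightarrow> real ^ 'n \<Rightarrow> real ^ 'n"
  assumes T: "0 < T"
    and G_affine: "G \<subseteq> affine_maps"
    and G_group: "group \<lparr>carrier = G, mult = (\<circ>), one = id\<rparr>"
    and G_volume: "\<And>g. g \<in> G \<Longrightarrow> volume_preserving g"
    and W_bdd: "\<And>w. w \<in> W \<Longrightarrow> bdd_on_strip T K w"
    and W_expectation: "closed_under_expectation T W"
    and W_transformations: "closed_under_transformations T G W"
    and W_limits: "closed_under_weak_limits T W"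
    and f: "f \<in> bdd_borel_on ({0<..<T} \<times> UNIV)"
    and L_family: "operator_family T L"
    and L_commutes: "commutes_with T G L"
    and L_integrable: "integrable_on_test_functions T L"
    and U: "solution_map T K G W L u0 f U"
    and h: "h \<in> bdd_meas_maps {0<..<T} G"
begin

lemma id_in_G: "id \<in> G"
  using group.is_monoid[OF G_group] monoid.one_closed by fastforce

lemma comp_in_G: "g \<in> G \<Longrightarrow> k \<in> G \<Longrightarrow> g \<circ> k \<in> G"
  using monoid.m_closed[OF group.is_monoid[OF G_group], of g k] by simp

definition inverse_map :: "(real ^ 'n \<Rightarrow> real ^ 'n) \<Rightarrow> real ^ 'n \<Rightarrow> real ^ 'n" where
  "inverse_map g = m_inv \<lparr>carrier = G, mult = (\<circ>), one = id\<rparr> g"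

lemma inverse_map:
  assumes "g \<in> G"
  shows "inverse_map g \<in> G" "inverse_map g (g x) = x"
  using group.inv_closed[OF G_group, of g] group.l_inv[OF G_group, of g] assms
  by (auto simp: inverse_map_def fun_eq_iff)

lemma G_borel: "g \<in> G \<Longrightarrow> g \<in> borel_measurable borel"
  using G_affine affine_borel by blast

lemma C0_inf_compose:
  assumes "\<zeta> \<in> C0_inf" "g \<in> G" shows "\<zeta> \<circ> g \<in> C0_inf"
proof (rule C0_infI)
  obtain a b where ab: "inverse_map g = (\<lambda>x. a *v x + b)"
    using inverse_map(1)[OF assms(2)] G_affine by (auto simp: affine_maps_def)
  obtain c d where cd: "g = (\<lambda>x. c *v x + d)"
    using assms(2) G_affine by (auto simp: affine_maps_def)
  show "Ck k (\<zeta> \<circ> g)" for k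
    unfolding cd o_def by (rule Ck_compose_affine[OF C0_inf_Ck[OF assms(1)]])
  have "{x. (\<zeta> \<circ> g) x \<noteq> 0} \<subseteq> inverse_map g ` {x. \<zeta> x \<noteq> 0}"
  proof
    fix x assume "x \<in> {x. (\<zeta> \<circ> g) x \<noteq> 0}"
    then show "x \<in> inverse_map g ` {x. \<zeta> x \<noteq> 0}"
      using inverse_map(2)[OF assms(2), of x] by (intro image_eqI[of _ _ "g x"]) auto
  qed
  moreover have "bounded (inverse_map g ` {x. \<zeta> x \<noteq> 0})"
  proof -
    have "bounded ((\<lambda>x. b + x) ` ((*v) a ` {x. \<zeta> x \<noteq> 0}))"
      by (intro bounded_translation bounded_linear_image C0_inf_bounded_support assms) simp
    then show ?thesis by (simp add: ab image_image add.commute)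
  qed
  ultimately show "bounded {x. (\<zeta> \<circ> g) x \<noteq> 0}" by (rule bounded_subset[rotated])
qed

text \<open>Invariance of Lebesgue measure under \<open>g\<close>.\<close>

lemma pairing_compose:
  assumes g: "g \<in> G" and a: "a \<in> borel_measurable borel" and b: "b \<in> borel_measurable borel"
  shows "pairing (\<lambda>x. a (g x)) (\<lambda>x. b (g x)) = pairing a b"
proof -
  have "pairing a b = (\<integral>x. a x * b x \<partial>distr lborel borel g)"
    using G_volume[OF g] by (simp add: pairing_def volume_preserving_def)
  also have "\<dots> = pairing (\<lambda>x. a (g x)) (\<lambda>x. b (g x))"
    unfolding pairing_def by (rule integral_distr) (use G_borel[OF g] a b in auto)
  finally show ?thesis by simp
qed

lemma pairing_inverse_map:
  assumes g: "g \<in> G" and a: "a \<in> borel_measurable borel" and b: "b \<in> borel_measurable borel"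
  shows "pairing (\<lambda>x. a (inverse_map g x)) b = pairing a (b \<circ> g)"
  using pairing_compose[OF g measurable_compose[OF G_borel[OF inverse_map(1)[OF g]] a] b]
  by (simp add: inverse_map(2)[OF g] o_def)

lemma bdd_meas_maps_borel:
  assumes "k \<in> bdd_meas_maps {0<..<T} G"
  shows "(\<lambda>(s, x). indicator {0<..<T} s * f (s, k s x)) \<in> borel_measurable borel"
proof -
  define c where "c s = indicator {0<..<T} s *\<^sub>R affine_coords (k s)" for s
  have c: "c \<in> borel_measurable borel"
    using assms unfolding c_def bdd_meas_maps_altdef by (simp add: borel_measurable_restrict_space_iff)
  define f' where "f' p = indicator ({0<..<T} \<times> UNIV) p * f p" for p
  have "{0<..<T} \<times> (UNIV :: (real^'n) set) \<in> sets borel"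
    by (intro borel_open open_Times) auto
  then have f': "f' \<in> borel_measurable borel"
    using f unfolding f'_def bdd_borel_on_def by (simp add: borel_measurable_restrict_space_iff)
  have act: "(\<lambda>q::((real^'n^'n) \<times> (real^'n)) \<times> (real^'n). fst (fst q) *v snd q + snd (fst q)) \<in> borel_measurable borel"
    unfolding matrix_vector_mult_def by (intro borel_measurable_continuous_onI continuous_intros)
  have "(\<lambda>p. c (fst p)) \<in> borel_measurable (borel :: (real \<times> (real^'n)) measure)"
    by (rule measurable_compose[OF _ c]) (intro borel_measurable_continuous_onI continuous_intros)
  moreover have "(snd :: real \<times> (real^'n) \<Rightarrow> _) \<in> borel_measurable borel" "(fst :: real \<times> (real^'n) \<Rightarrow> _) \<in> borel_measurable borel"
    by (intro borel_measurable_continuous_onI continuous_intros)+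
  ultimately have "(\<lambda>p::real \<times> (real^'n). (fst p, fst (c (fst p)) *v snd p + snd (c (fst p)))) \<in> borel_measurable borel"
    using measurable_compose[OF _ act, of "\<lambda>p::real \<times> (real^'n). (c (fst p), snd p)" borel]
    by (simp add: borel_measurable_Pair)
  from measurable_compose[OF this f']
  have "(\<lambda>p::real \<times> (real^'n). f' (fst p, fst (c (fst p)) *v snd p + snd (c (fst p)))) \<in> borel_measurable borel" .
  also have "(\<lambda>p::real \<times> (real^'n). f' (fst p, fst (c (fst p)) *v snd p + snd (c (fst p)))) =
     (\<lambda>(s, x). indicator {0<..<T} s * f (s, k s x))"
  proof (intro ext, clarify)
    fix s :: real and x :: "real^'n"
    show "f' (fst (s, x), fst (c (fst (s, x))) *v snd (s, x) + snd (c (fst (s, x)))) = indicator {0<..<T} s * f (s, k s x)"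
    proof (cases "s \<in> {0<..<T}")
      case True
      then have "k s \<in> affine_maps" using assms G_affine by (auto simp: bdd_meas_maps_def)
      from fun_cong[OF affine_eq_coords[OF this], of x] True show ?thesis
        by (simp add: f'_def c_def)
    qed (simp add: f'_def)
  qed
  finally show ?thesis .
qed

lemma forcing_bounded: obtains B where "\<And>s x. s \<in> {0<..<T} \<Longrightarrow> \<bar>f (s, x)\<bar> \<le> B"
proof -
  obtain B where "\<forall>p\<in>{0<..<T} \<times> UNIV. \<bar>f p\<bar> \<le> B"
    using f by (auto simp: bdd_borel_on_def bounded_iff)
  then show ?thesis using that[of B] by auto
qed

lemma forcing_section_borel:
  assumes "k \<in> bdd_meas_maps {0<..<T} G" "s \<in> {0<..<T}"
  shows "(\<lambda>x. f (s, k s x)) \<in> borel_measurable borel"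
proof -
  have "(\<lambda>x::real^'n. (s, x)) \<in> borel_measurable borel" by (intro borel_measurable_continuous_onI continuous_intros)
  from measurable_compose[OF this bdd_meas_maps_borel[OF assms(1)]] assms(2) show ?thesis by simp
qed

lemma forcing_cyl_integrable:
  assumes k: "k \<in> bdd_meas_maps {0<..<T} G" and \<zeta>: "\<zeta> \<in> C0_inf"
  shows "cyl_integrable T (\<lambda>s x. f (s, k s x) * \<zeta> x)"
proof -
  obtain B where B: "\<And>s x. s \<in> {0<..<T} \<Longrightarrow> \<bar>f (s, x)\<bar> \<le> B" using forcing_bounded by blast
  show ?thesis
  proof (rule cyl_integrable_dominated)
    have "(\<lambda>p::real \<times> (real^'n). \<zeta> (snd p)) \<in> borel_measurable borel"
      by (rule measurable_compose[OF _ C0_inf_borel[OF \<zeta>]]) (intro borel_measurable_continuous_onI continuous_intros)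
    from borel_measurable_times[OF bdd_meas_maps_borel[OF k] this]
    show "(\<lambda>(s, x). indicator {0<..<T} s * (f (s, k s x) * \<zeta> x)) \<in> borel_measurable borel"
      by (simp add: split_beta mult.assoc)
    show "integrable lborel (\<lambda>x. \<bar>B\<bar> * \<zeta> x)" using C0_inf_integrable[OF \<zeta>] by simp
    show "\<bar>f (s, k s x) * \<zeta> x\<bar> \<le> \<bar>\<bar>B\<bar> * \<zeta> x\<bar>" if "s \<in> {0<..<T}" for s x
      using B[OF that, of "k s x"] by (simp add: abs_mult mult_right_mono)
  qed
qed

lemma forcing_set_integrable:
  assumes "k \<in> bdd_meas_maps {0<..<T} G" "\<zeta> \<in> C0_inf"
  shows "set_integrable lborel {0<..<T} (\<lambda>s. pairing (\<lambda>x. f (s, k s x)) \<zeta>)"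
  unfolding pairing_def by (rule cyl_integrable_section[OF forcing_cyl_integrable[OF assms]])

lemma L_cyl_integrable: "\<zeta> \<in> C0_inf \<Longrightarrow> cyl_integrable T (\<lambda>s. L s \<zeta>)"
  using L_integrable by (simp add: integrable_on_test_functions_def cyl_integrable_def)

lemma L_borel: "\<zeta> \<in> C0_inf \<Longrightarrow> s \<in> {0<..<T} \<Longrightarrow> L s \<zeta> \<in> borel_measurable borel"
  using L_family by (auto simp: operator_family_def bdd_borel_on_def borel_measurable_restrict_space_iff)

lemma L_compose: "\<zeta> \<in> C0_inf \<Longrightarrow> s \<in> {0<..<T} \<Longrightarrow> g \<in> G \<Longrightarrow> L s (\<zeta> \<circ> g) = L s \<zeta> \<circ> g"
  using L_commutes by (auto simp: commutes_with_def)

lemma U_in_W: "k \<in> bdd_meas_maps {0<..<T} G \<Longrightarrow> U k \<in> W"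
  using U by (auto simp: solution_map_def)

lemma K_nonneg: "0 \<le> K"
proof -
  have "\<bar>U h (0, 0)\<bar> \<le> K" using bdd_on_strip_section(2)[OF W_bdd[OF U_in_W[OF h]]] T by auto
  then show ?thesis by linarith
qed

lemma U_equation:
  "k \<in> bdd_meas_maps {0<..<T} G \<Longrightarrow> \<zeta> \<in> C0_inf \<Longrightarrow> t \<in> {0..T} \<Longrightarrow>
    residual L u0 (\<lambda>s x. f (s, k s x)) (U k) \<zeta> t = 0"
  using U by (auto simp: solution_map_def weak_solution_iff_residual)

text \<open>In condition (iv) the supremum is \<open>0\<close> at all times before \<open>t\<close>, so the right-hand side vanishes.\<close>

lemma U_nonanticipating:
  assumes k: "k \<in> bdd_meas_maps {0<..<T} G" "k' \<in> bdd_meas_maps {0<..<T} G"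
    and t: "t \<in> {0..T}" and eq: "\<And>s. 0 < s \<Longrightarrow> s < t \<Longrightarrow> k s = k' s"
  shows "U k (t, x) = U k' (t, x)"
proof -
  have "\<bar>U k (t, x) - U k' (t, x)\<bar> \<le>
      K * (LINT r:{0<..<t}|lebesgue. (SUP y. \<bar>f (r, k r y) - f (r, k' r y)\<bar>))"
    using U k t by (auto simp: solution_map_def)
  also have "(LINT r:{0<..<t}|lebesgue. (SUP y. \<bar>f (r, k r y) - f (r, k' r y)\<bar>)) = (LINT r:{0<..<t}|lebesgue. 0)"
    unfolding set_lebesgue_integral_def
    by (rule Bochner_Integration.integral_cong) (auto simp: eq indicator_def)
  finally show ?thesis by simp
qed

end

section \<open>A walk in the group\<close>

primrec jumps :: "(nat \<Rightarrow> 'a \<Rightarrow> 'a) \<Rightarrow> nat \<Rightarrow> 'a \<Rightarrow> 'a" where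
  "jumps \<gamma> 0 = id"
| "jumps \<gamma> (Suc k) = \<gamma> k \<circ> jumps \<gamma> k"

text \<open>The number of grid points \<open>\<delta>, 2\<delta>, \<dots>\<close> in \<open>(0,t]\<close>. The walk makes its jump number \<open>k\<close>, counted from
\<open>0\<close>, at time \<open>(k+1) \<delta>\<close>; so \<open>cell \<delta> t\<close> is also the number of jumps made up to time \<open>t\<close>.\<close>

definition cell :: "real \<Rightarrow> real \<Rightarrow> nat" where
  "cell \<delta> t = nat \<lfloor>t / \<delta>\<rfloor>"

lemma cell_bounds: "0 < \<delta> \<Longrightarrow> 0 \<le> t \<Longrightarrow> real (cell \<delta> t) * \<delta> \<le> t \<and> t < real (Suc (cell \<delta> t)) * \<delta>"
proof -
  assume \<delta>: "0 < \<delta>" and t: "0 \<le> t"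
  have "real_of_int \<lfloor>t / \<delta>\<rfloor> * \<delta> \<le> t"
    by (rule iffD1[OF pos_le_divide_eq[OF \<delta>] of_int_floor_le])
  moreover have "t < (real_of_int \<lfloor>t / \<delta>\<rfloor> + 1) * \<delta>"
    by (rule iffD1[OF pos_divide_less_eq[OF \<delta>] real_of_int_floor_add_one_gt])
  moreover have "real (cell \<delta> t) = real_of_int \<lfloor>t / \<delta>\<rfloor>"
    using \<delta> t by (simp add: cell_def)
  ultimately show ?thesis by (simp add: add.commute)
qed

lemma cell_eq: "0 < \<delta> \<Longrightarrow> real k * \<delta> \<le> t \<Longrightarrow> t < real (Suc k) * \<delta> \<Longrightarrow> cell \<delta> t = k"
proof -
  assume *: "0 < \<delta>" "real k * \<delta> \<le> t" "t < real (Suc k) * \<delta>"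
  then have "\<lfloor>t / \<delta>\<rfloor> = int k" by (intro floor_unique) (auto simp: field_simps)
  then show ?thesis by (simp add: cell_def)
qed

lemma cell_measurable: "cell \<delta> \<in> measurable (restrict_space borel I) (count_space UNIV)"
proof (rule measurable_restrict_space1)
  show "cell \<delta> \<in> measurable borel (count_space UNIV)"
    unfolding cell_def[abs_def] by measurable
qed

lemma cell_le: "0 < \<delta> \<Longrightarrow> 0 \<le> t \<Longrightarrow> t \<le> real m * \<delta> \<Longrightarrow> cell \<delta> t \<le> m"
proof -
  assume *: "0 < \<delta>" "0 \<le> t" "t \<le> real m * \<delta>"
  have "real (cell \<delta> t) * \<delta> \<le> real m * \<delta>" using cell_bounds[of \<delta> t] * by linarith
  then show ?thesis using * by simp
qed

lemma jumps_cong: "(\<And>i. i < k \<Longrightarrow> \<gamma> i = \<gamma>' i) \<Longrightarrow> jumps \<gamma> k = jumps \<gamma>' k"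
  by (induction k) auto

context evolution
begin

definition walk_control :: "real \<Rightarrow> (nat \<Rightarrow> real^'n \<Rightarrow> real^'n) \<Rightarrow> real \<Rightarrow> real^'n \<Rightarrow> real^'n" where
  "walk_control \<delta> \<gamma> = restrict (\<lambda>s. h s \<circ> jumps \<gamma> (cell \<delta> s)) {0<..<T}"

definition walk :: "real \<Rightarrow> (nat \<Rightarrow> real^'n \<Rightarrow> real^'n) \<Rightarrow> real \<times> (real^'n) \<Rightarrow> real" where
  "walk \<delta> \<gamma> = restrict (\<lambda>(t, x). U (walk_control \<delta> \<gamma>) (t, inverse_map (jumps \<gamma> (cell \<delta> t)) x)) (strip T)"

text \<open>The state of the walk immediately before jump number \<open>k\<close>: the solution is taken at the time of the jump,
the position in the group is still that of the preceding cell.\<close>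

definition walk_before_jump :: "real \<Rightarrow> (nat \<Rightarrow> real^'n \<Rightarrow> real^'n) \<Rightarrow> nat \<Rightarrow> real^'n \<Rightarrow> real" where
  "walk_before_jump \<delta> \<gamma> k x = U (walk_control \<delta> \<gamma>) (real (Suc k) * \<delta>, inverse_map (jumps \<gamma> k) x)"

lemma jumps_in_G: "range \<gamma> \<subseteq> G \<Longrightarrow> jumps \<gamma> k \<in> G"
  by (induction k) (auto intro: id_in_G comp_in_G)

lemma walk_control_in:
  assumes \<gamma>: "range \<gamma> \<subseteq> G" and \<delta>: "0 < \<delta>"
  shows "walk_control \<delta> \<gamma> \<in> bdd_meas_maps {0<..<T} G"
  unfolding bdd_meas_maps_altdef
proof (intro conjI)
  note p = jumps_in_G[OF \<gamma>]
  have hG: "h s \<in> G" if "s \<in> {0<..<T}" for s using h that by (auto simp: bdd_meas_maps_def)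
  have coords: "affine_coords (walk_control \<delta> \<gamma> s) =
      compose_coords (affine_coords (h s)) (affine_coords (jumps \<gamma> (cell \<delta> s)))" if "s \<in> {0<..<T}" for s
    using that affine_coords_compose[of "h s" "jumps \<gamma> (cell \<delta> s)"] hG[OF that] p[of "cell \<delta> s"] G_affine
    by (auto simp: walk_control_def)
  show "walk_control \<delta> \<gamma> \<in> {0<..<T} \<rightarrow>\<^sub>E G"
    using hG p by (auto simp: walk_control_def intro!: comp_in_G)
  have hc: "(\<lambda>s. affine_coords (h s)) \<in> borel_measurable (restrict_space borel {0<..<T})"
    and hb: "bounded ((\<lambda>s. affine_coords (h s)) ` {0<..<T})"
    using h by (auto simp: bdd_meas_maps_altdef)
  have "(\<lambda>s. compose_coords (affine_coords (h s)) (affine_coords (jumps \<gamma> k))) \<in> borel_measurable (restrict_space borel {0<..<T})" for k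
    by (rule measurable_compose[OF hc]) (intro borel_measurable_continuous_onI continuous_compose_coords)
  from measurable_compose_countable[OF this cell_measurable]
  have "(\<lambda>s. compose_coords (affine_coords (h s)) (affine_coords (jumps \<gamma> (cell \<delta> s)))) \<in> borel_measurable (restrict_space borel {0<..<T})" .
  then show "(\<lambda>s. affine_coords (walk_control \<delta> \<gamma> s)) \<in> borel_measurable (restrict_space borel {0<..<T})"
    by (rule measurable_cong[THEN iffD1, rotated]) (auto simp: space_restrict_space coords)
  obtain m where m: "T / \<delta> \<le> real m" using real_arch_simple by blast
  obtain C where C: "(\<lambda>s. affine_coords (h s)) ` {0<..<T} \<subseteq> cball 0 C"
    using hb unfolding bounded_iff by (auto simp: subset_eq)
  have "bounded (\<Union>k\<le>m. (\<lambda>c. compose_coords c (affine_coords (jumps \<gamma> k))) ` cball 0 C)"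
    by (intro bounded_UN ballI compact_imp_bounded compact_continuous_image continuous_compose_coords) auto
  moreover have "(\<lambda>s. affine_coords (walk_control \<delta> \<gamma> s)) ` {0<..<T} \<subseteq>
      (\<Union>k\<le>m. (\<lambda>c. compose_coords c (affine_coords (jumps \<gamma> k))) ` cball 0 C)"
  proof (intro subsetI, elim imageE)
    fix c s assume s: "c = affine_coords (walk_control \<delta> \<gamma> s)" "s \<in> {0<..<T}"
    have "T \<le> real m * \<delta>" using m \<delta> by (simp add: field_simps)
    then have "cell \<delta> s \<le> m" using s \<delta> by (intro cell_le) auto
    then show "c \<in> (\<Union>k\<le>m. (\<lambda>c. compose_coords c (affine_coords (jumps \<gamma> k))) ` cball 0 C)"
      using s C unfolding s(1) coords[OF s(2)] by blast
  qed
  ultimately show "bounded ((\<lambda>s. affine_coords (walk_control \<delta> \<gamma> s)) ` {0<..<T})"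
    by (rule bounded_subset)
qed

lemma walk_in_W:
  assumes \<gamma>: "range \<gamma> \<subseteq> G" and \<delta>: "0 < \<delta>"
  shows "walk \<delta> \<gamma> \<in> W"
proof -
  let ?g = "restrict (\<lambda>t. inverse_map (jumps \<gamma> (cell \<delta> t))) {0..T}"
  note p = inverse_map(1)[OF jumps_in_G[OF \<gamma>]]
  obtain m where m: "T / \<delta> \<le> real m" using real_arch_simple by blast
  have "?g \<in> bdd_meas_maps {0..T} G"
    unfolding bdd_meas_maps_altdef
  proof (intro conjI)
    show "?g \<in> {0..T} \<rightarrow>\<^sub>E G" using p by auto
    have "(\<lambda>t. affine_coords (inverse_map (jumps \<gamma> (cell \<delta> t)))) \<in> borel_measurable (restrict_space borel {0..T})"
      by (rule measurable_compose[OF cell_measurable]) simp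
    then show "(\<lambda>t. affine_coords (?g t)) \<in> borel_measurable (restrict_space borel {0..T})"
      by (rule measurable_cong[THEN iffD1, rotated]) (auto simp: space_restrict_space)
    have "(\<lambda>t. affine_coords (?g t)) ` {0..T} \<subseteq> (\<lambda>k. affine_coords (inverse_map (jumps \<gamma> k))) ` {..m}"
    proof (intro subsetI, elim imageE)
      fix c t assume t: "c = affine_coords (?g t)" "t \<in> {0..T}"
      have "T \<le> real m * \<delta>" using m \<delta> by (simp add: field_simps)
      then have "cell \<delta> t \<le> m" using t \<delta> by (intro cell_le) auto
      then show "c \<in> (\<lambda>k. affine_coords (inverse_map (jumps \<gamma> k))) ` {..m}" using t by auto
    qed
    then show "bounded ((\<lambda>t. affine_coords (?g t)) ` {0..T})"
      by (rule bounded_subset[rotated]) (auto intro: finite_imp_bounded)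
  qed
  then have "restrict (\<lambda>(t, x). U (walk_control \<delta> \<gamma>) (t, ?g t x)) (strip T) \<in> W"
    by (rule W_transformations[unfolded closed_under_transformations_def, rule_format, OF U_in_W[OF walk_control_in[OF \<gamma> \<delta>]]])
  also have "restrict (\<lambda>(t, x). U (walk_control \<delta> \<gamma>) (t, ?g t x)) (strip T) = walk \<delta> \<gamma>"
    unfolding walk_def by (intro restrict_ext) (auto simp: strip_iff)
  finally show ?thesis .
qed

lemma walk_eq:
  "t \<in> {0..T} \<Longrightarrow> walk \<delta> \<gamma> (t, x) = U (walk_control \<delta> \<gamma>) (t, inverse_map (jumps \<gamma> (cell \<delta> t)) x)"
  by (auto simp: walk_def strip_iff)

lemma walk_before_jump_borel:
  assumes \<gamma>: "range \<gamma> \<subseteq> G" and \<delta>: "0 < \<delta>" and k: "real (Suc k) * \<delta> \<le> T"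
  shows "walk_before_jump \<delta> \<gamma> k \<in> borel_measurable borel" "\<bar>walk_before_jump \<delta> \<gamma> k x\<bar> \<le> K"
proof -
  have t: "real (Suc k) * \<delta> \<in> {0..T}" using \<delta> k by (simp del: of_nat_Suc)
  note ub = bdd_on_strip_section[OF W_bdd[OF U_in_W[OF walk_control_in[OF \<gamma> \<delta>]]] t]
  show "walk_before_jump \<delta> \<gamma> k \<in> borel_measurable borel"
    unfolding walk_before_jump_def
    by (rule measurable_compose[OF G_borel[OF inverse_map(1)[OF jumps_in_G[OF \<gamma>]]] ub(1)])
  show "\<bar>walk_before_jump \<delta> \<gamma> k x\<bar> \<le> K" unfolding walk_before_jump_def by (rule ub(2))
qed

text \<open>Independence of the present and later jumps: before its time the control is determined by the
earlier ones.\<close>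

lemma walk_before_jump_cong:
  assumes \<gamma>: "range \<gamma> \<subseteq> G" "range \<gamma>' \<subseteq> G" and \<delta>: "0 < \<delta>" and k: "real (Suc k) * \<delta> \<le> T"
    and eq: "\<And>i. i < k \<Longrightarrow> \<gamma> i = \<gamma>' i"
  shows "walk_before_jump \<delta> \<gamma> k = walk_before_jump \<delta> \<gamma>' k"
proof
  fix x
  have t: "real (Suc k) * \<delta> \<in> {0..T}" using \<delta> k by (simp del: of_nat_Suc)
  have "walk_control \<delta> \<gamma> s = walk_control \<delta> \<gamma>' s" if s: "0 < s" "s < real (Suc k) * \<delta>" for s
  proof -
    have "real (cell \<delta> s) * \<delta> < real (Suc k) * \<delta>" using cell_bounds[OF \<delta>, of s] s by linarith
    then have "cell \<delta> s \<le> k" using \<delta> by (simp del: of_nat_Suc)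
    then have "jumps \<gamma> (cell \<delta> s) = jumps \<gamma>' (cell \<delta> s)" by (intro jumps_cong eq) auto
    then show ?thesis by (simp add: walk_control_def restrict_def)
  qed
  moreover have "jumps \<gamma> k = jumps \<gamma>' k" by (intro jumps_cong eq)
  ultimately show "walk_before_jump \<delta> \<gamma> k x = walk_before_jump \<delta> \<gamma>' k x"
    unfolding walk_before_jump_def
    using U_nonanticipating[OF walk_control_in[OF \<gamma>(1) \<delta>] walk_control_in[OF \<gamma>(2) \<delta>] t] by simp
qed

text \<open>Within a cell the group element \<open>p\<close> is constant. The equation for \<open>u\<close> is tested against \<open>\<zeta> \<circ> p\<close>, and
\<open>p\<close> is then removed by \<open>L (\<zeta> \<circ> p) = L \<zeta> \<circ> p\<close> and the invariance of Lebesgue measure.\<close>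

lemma walk_cell_increment:
  assumes \<gamma>: "range \<gamma> \<subseteq> G" and \<delta>: "0 < \<delta>" and \<zeta>: "\<zeta> \<in> C0_inf"
    and ab: "real k * \<delta> \<le> a" "a \<le> b" "b \<le> real (Suc k) * \<delta>" "b \<le> T"
  shows "pairing (\<lambda>x. U (walk_control \<delta> \<gamma>) (b, x)) (\<zeta> \<circ> jumps \<gamma> k) - pairing (\<lambda>x. U (walk_control \<delta> \<gamma>) (a, x)) (\<zeta> \<circ> jumps \<gamma> k) =
    (LBINT r:{a<..<b}. pairing (\<lambda>x. walk \<delta> \<gamma> (r, x)) (L r \<zeta>)) + (LBINT r:{a<..<b}. pairing (\<lambda>x. f (r, h r x)) \<zeta>)"
proof -
  let ?c = "walk_control \<delta> \<gamma>" and ?p = "jumps \<gamma> k"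
  let ?u = "U ?c"
  note c = walk_control_in[OF \<gamma> \<delta>]
  note p = jumps_in_G[OF \<gamma>, of k]
  note \<zeta>p = C0_inf_compose[OF \<zeta> p]
  note uW = W_bdd[OF U_in_W[OF c]]
  have a0: "0 \<le> a" using ab(1) \<delta> mult_nonneg_nonneg[of "real k" \<delta>] by linarith
  have abT: "a \<in> {0..T}" "b \<in> {0..T}" using a0 ab by auto
  note P = set_integrable_pairing[OF uW L_cyl_integrable[OF \<zeta>p]]
  note F = forcing_set_integrable[OF c \<zeta>p]
  have "pairing (\<lambda>x. ?u (b, x)) (\<zeta> \<circ> ?p) - pairing (\<lambda>x. ?u (a, x)) (\<zeta> \<circ> ?p) =
    (LBINT r:{a<..<b}. pairing (\<lambda>x. ?u (r, x)) (L r (\<zeta> \<circ> ?p))) + (LBINT r:{a<..<b}. pairing (\<lambda>x. f (r, ?c r x)) (\<zeta> \<circ> ?p))"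
    using U_equation[OF c \<zeta>p abT(1)] U_equation[OF c \<zeta>p abT(2)]
    unfolding residual_def set_integral_greaterThanLessThan_split[OF P a0 ab(2,4)]
      set_integral_greaterThanLessThan_split[OF F a0 ab(2,4)]
    by linarith
  also have "(LBINT r:{a<..<b}. pairing (\<lambda>x. ?u (r, x)) (L r (\<zeta> \<circ> ?p))) = (LBINT r:{a<..<b}. pairing (\<lambda>x. walk \<delta> \<gamma> (r, x)) (L r \<zeta>))"
  proof (rule set_lebesgue_integral_cong)
    show "\<forall>r. r \<in> {a<..<b} \<longrightarrow> pairing (\<lambda>x. ?u (r, x)) (L r (\<zeta> \<circ> ?p)) = pairing (\<lambda>x. walk \<delta> \<gamma> (r, x)) (L r \<zeta>)"
    proof (intro allI impI)
      fix r assume r: "r \<in> {a<..<b}"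
      have rT: "r \<in> {0<..<T}" "r \<in> {0..T}" using r a0 ab by auto
      have cell: "cell \<delta> r = k" using r ab by (intro cell_eq \<delta>) auto
      have "pairing (\<lambda>x. walk \<delta> \<gamma> (r, x)) (L r \<zeta>) = pairing (\<lambda>x. ?u (r, inverse_map ?p x)) (L r \<zeta>)"
        by (simp add: walk_eq[OF rT(2)] cell)
      also have "\<dots> = pairing (\<lambda>x. ?u (r, x)) (L r \<zeta> \<circ> ?p)"
        by (rule pairing_inverse_map[OF p bdd_on_strip_section(1)[OF uW rT(2)] L_borel[OF \<zeta> rT(1)]])
      finally show "pairing (\<lambda>x. ?u (r, x)) (L r (\<zeta> \<circ> ?p)) = pairing (\<lambda>x. walk \<delta> \<gamma> (r, x)) (L r \<zeta>)"
        by (simp add: L_compose[OF \<zeta> rT(1) p])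
    qed
  qed simp
  also have "(LBINT r:{a<..<b}. pairing (\<lambda>x. f (r, ?c r x)) (\<zeta> \<circ> ?p)) = (LBINT r:{a<..<b}. pairing (\<lambda>x. f (r, h r x)) \<zeta>)"
  proof (rule set_lebesgue_integral_cong)
    show "\<forall>r. r \<in> {a<..<b} \<longrightarrow> pairing (\<lambda>x. f (r, ?c r x)) (\<zeta> \<circ> ?p) = pairing (\<lambda>x. f (r, h r x)) \<zeta>"
    proof (intro allI impI)
      fix r assume r: "r \<in> {a<..<b}"
      have rT: "r \<in> {0<..<T}" using r a0 ab by auto
      have cell: "cell \<delta> r = k" using r ab by (intro cell_eq \<delta>) auto
      show "pairing (\<lambda>x. f (r, ?c r x)) (\<zeta> \<circ> ?p) = pairing (\<lambda>x. f (r, h r x)) \<zeta>"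
        using pairing_compose[OF p forcing_section_borel[OF h rT] C0_inf_borel[OF \<zeta>]] rT
        by (simp add: walk_control_def cell o_def)
    qed
  qed simp
  finally show ?thesis .
qed

lemma walk_integrable:
  assumes "range \<gamma> \<subseteq> G" "0 < \<delta>" "\<zeta> \<in> C0_inf"
  shows "set_integrable lborel {0<..<T} (\<lambda>s. pairing (\<lambda>x. walk \<delta> \<gamma> (s, x)) (L s \<zeta>))"
  by (rule set_integrable_pairing[OF W_bdd[OF walk_in_W[OF assms(1,2)]] L_cyl_integrable[OF assms(3)]])

text \<open>Induction over the cells. At the end of cell \<open>k\<close> the test function passes from \<open>\<zeta> \<circ> p\<close> to
\<open>\<zeta> \<circ> \<gamma>\<^sub>k \<circ> p\<close>; this contributes the jump term.\<close>

lemma walk_equation_on_cell: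
  assumes \<gamma>: "range \<gamma> \<subseteq> G" and \<delta>: "0 < \<delta>" and \<zeta>: "\<zeta> \<in> C0_inf"
    and t: "real k * \<delta> \<le> t" "t \<le> real (Suc k) * \<delta>" "t \<le> T"
  shows "pairing (\<lambda>x. U (walk_control \<delta> \<gamma>) (t, x)) (\<zeta> \<circ> jumps \<gamma> k) = pairing u0 \<zeta>
      + (LBINT r:{0<..<t}. pairing (\<lambda>x. walk \<delta> \<gamma> (r, x)) (L r \<zeta>)) + (LBINT r:{0<..<t}. pairing (\<lambda>x. f (r, h r x)) \<zeta>)
      + (\<Sum>l<k. pairing (walk_before_jump \<delta> \<gamma> l) (\<zeta> \<circ> \<gamma> l) - pairing (walk_before_jump \<delta> \<gamma> l) \<zeta>)"
  using t
proof (induction k arbitrary: t)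
  case 0
  let ?u = "U (walk_control \<delta> \<gamma>)"
  have "residual L u0 (\<lambda>s x. f (s, walk_control \<delta> \<gamma> s x)) ?u \<zeta> 0 = 0"
    by (rule U_equation[OF walk_control_in[OF \<gamma> \<delta>] \<zeta>]) (use T in simp)
  then have "pairing (\<lambda>x. ?u (0, x)) \<zeta> = pairing u0 \<zeta>"
    by (simp add: residual_def set_lebesgue_integral_def)
  then show ?case
    using walk_cell_increment[OF \<gamma> \<delta> \<zeta>, of 0 0 t] 0 by simp
next
  case (Suc k)
  let ?u = "U (walk_control \<delta> \<gamma>)" and ?y = "walk_before_jump \<delta> \<gamma> k"
  define \<tau> where "\<tau> = real (Suc k) * \<delta>"
  have \<tau>: "real k * \<delta> \<le> \<tau>" "\<tau> \<le> T" "0 \<le> \<tau>" "\<tau> \<le> t"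
    using Suc.prems \<delta> by (auto simp: \<tau>_def field_simps)
  have \<tau>T: "\<tau> \<in> {0..T}" using \<tau> by simp
  note p = jumps_in_G[OF \<gamma>]
  note um = bdd_on_strip_section(1)[OF W_bdd[OF U_in_W[OF walk_control_in[OF \<gamma> \<delta>]]] \<tau>T]
  have y: "pairing ?y \<phi> = pairing (\<lambda>x. ?u (\<tau>, x)) (\<phi> \<circ> jumps \<gamma> k)" if "\<phi> \<in> borel_measurable borel" for \<phi>
    unfolding walk_before_jump_def \<tau>_def[symmetric] by (rule pairing_inverse_map[OF p um that])
  note sp = set_integral_greaterThanLessThan_split[OF walk_integrable[OF \<gamma> \<delta> \<zeta>] \<tau>(3,4) Suc.prems(3)]
    set_integral_greaterThanLessThan_split[OF forcing_set_integrable[OF h \<zeta>] \<tau>(3,4) Suc.prems(3)]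
  have "pairing (\<lambda>x. ?u (t, x)) (\<zeta> \<circ> jumps \<gamma> (Suc k)) - pairing (\<lambda>x. ?u (\<tau>, x)) (\<zeta> \<circ> jumps \<gamma> (Suc k)) =
      (LBINT r:{\<tau><..<t}. pairing (\<lambda>x. walk \<delta> \<gamma> (r, x)) (L r \<zeta>)) + (LBINT r:{\<tau><..<t}. pairing (\<lambda>x. f (r, h r x)) \<zeta>)"
    by (rule walk_cell_increment[OF \<gamma> \<delta> \<zeta>]) (use Suc.prems \<tau> in \<open>auto simp: \<tau>_def\<close>)
  moreover have "pairing (\<lambda>x. ?u (\<tau>, x)) (\<zeta> \<circ> jumps \<gamma> (Suc k)) = pairing ?y (\<zeta> \<circ> \<gamma> k)"
    using y[of "\<zeta> \<circ> \<gamma> k"] measurable_compose[OF G_borel[OF subsetD[OF \<gamma> rangeI]] C0_inf_borel[OF \<zeta>]] by (simp add: o_def)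
  moreover have "pairing (\<lambda>x. ?u (\<tau>, x)) (\<zeta> \<circ> jumps \<gamma> k) = pairing ?y \<zeta>"
    by (rule y[symmetric, OF C0_inf_borel[OF \<zeta>]])
  moreover note Suc.IH[OF \<tau>(1) _ \<tau>(2)]
  ultimately show ?case
    unfolding sp by (simp add: \<tau>_def o_def)
qed

text \<open>The formula for the cell containing \<open>t\<close>, with the group element moved back from the test function to
the solution.\<close>

lemma walk_equation:
  assumes \<gamma>: "range \<gamma> \<subseteq> G" and \<delta>: "0 < \<delta>" and \<zeta>: "\<zeta> \<in> C0_inf" and t: "t \<in> {0..T}"
  shows "residual L u0 (\<lambda>s x. f (s, h s x)) (walk \<delta> \<gamma>) \<zeta> t =
      (\<Sum>k<cell \<delta> t. pairing (walk_before_jump \<delta> \<gamma> k) (\<zeta> \<circ> \<gamma> k) - pairing (walk_before_jump \<delta> \<gamma> k) \<zeta>)"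
proof -
  have "pairing (\<lambda>x. walk \<delta> \<gamma> (t, x)) \<zeta> = pairing (\<lambda>x. U (walk_control \<delta> \<gamma>) (t, x)) (\<zeta> \<circ> jumps \<gamma> (cell \<delta> t))"
    unfolding walk_eq[OF t]
    by (rule pairing_inverse_map[OF jumps_in_G[OF \<gamma>] bdd_on_strip_section(1)[OF W_bdd[OF U_in_W[OF walk_control_in[OF \<gamma> \<delta>]]] t] C0_inf_borel[OF \<zeta>]])
  also note walk_equation_on_cell[OF \<gamma> \<delta> \<zeta>, of "cell \<delta> t" t]
  finally show ?thesis using cell_bounds[OF \<delta>, of t] t by (simp add: residual_def)
qed

text \<open>There is no jump between \<open>s\<close> and the end of its cell, so only the integral terms contribute to the
increment.\<close>

lemma walk_before_jump_close:
  assumes \<gamma>: "range \<gamma> \<subseteq> G" and \<delta>: "0 < \<delta>" and \<zeta>: "\<zeta> \<in> C0_inf"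
    and s: "real k * \<delta> \<le> s" "s < real (Suc k) * \<delta>" and k: "real (Suc k) * \<delta> \<le> T"
  shows "\<bar>pairing (walk_before_jump \<delta> \<gamma> k) \<zeta> - pairing (\<lambda>x. walk \<delta> \<gamma> (s, x)) \<zeta>\<bar> \<le>
    (LBINT r:{s<..<real (Suc k) * \<delta>}. K * (\<integral>x. \<bar>L r \<zeta> x\<bar> \<partial>lborel) + \<bar>pairing (\<lambda>x. f (r, h r x)) \<zeta>\<bar>)"
proof -
  let ?u = "U (walk_control \<delta> \<gamma>)" and ?\<tau> = "real (Suc k) * \<delta>"
  have s0: "0 \<le> s" using s(1) \<delta> mult_nonneg_nonneg[of "real k" \<delta>] by linarith
  have sT: "s \<in> {0..T}" "?\<tau> \<in> {0..T}" using s s0 k by auto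
  note p = jumps_in_G[OF \<gamma>]
  note um = bdd_on_strip_section(1)[OF W_bdd[OF U_in_W[OF walk_control_in[OF \<gamma> \<delta>]]]]
  have cell: "cell \<delta> s = k" by (rule cell_eq[OF \<delta> s])
  have 1: "pairing (walk_before_jump \<delta> \<gamma> k) \<zeta> = pairing (\<lambda>x. ?u (?\<tau>, x)) (\<zeta> \<circ> jumps \<gamma> k)"
    unfolding walk_before_jump_def by (rule pairing_inverse_map[OF p um[OF sT(2)] C0_inf_borel[OF \<zeta>]])
  have 2: "pairing (\<lambda>x. walk \<delta> \<gamma> (s, x)) \<zeta> = pairing (\<lambda>x. ?u (s, x)) (\<zeta> \<circ> jumps \<gamma> k)"
    unfolding walk_eq[OF sT(1)] cell by (rule pairing_inverse_map[OF p um[OF sT(1)] C0_inf_borel[OF \<zeta>]])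
  have sub: "set_integrable lborel {s<..<?\<tau>} q" if "set_integrable lborel {0<..<T} q" for q :: "real \<Rightarrow> real"
    by (rule set_integrable_subset[OF that]) (use s0 k in auto)
  note LP = walk_integrable[OF \<gamma> \<delta> \<zeta>] and FP = forcing_set_integrable[OF h \<zeta>]
  have KN: "set_integrable lborel {0<..<T} (\<lambda>r. K * (\<integral>x. \<bar>L r \<zeta> x\<bar> \<partial>lborel))"
    using cyl_integrable_section[OF cyl_integrable_abs[OF L_cyl_integrable[OF \<zeta>]]] by (intro set_integrable_mult_right) simp
  have "\<bar>LBINT r:{s<..<?\<tau>}. pairing (\<lambda>x. walk \<delta> \<gamma> (r, x)) (L r \<zeta>)\<bar> \<le> (LBINT r:{s<..<?\<tau>}. K * (\<integral>x. \<bar>L r \<zeta> x\<bar> \<partial>lborel))"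
  proof (rule set_integral_abs_le[OF sub[OF LP] sub[OF KN]])
    show "AE r in lborel. r \<in> {s<..<?\<tau>} \<longrightarrow> \<bar>pairing (\<lambda>x. walk \<delta> \<gamma> (r, x)) (L r \<zeta>)\<bar> \<le> K * (\<integral>x. \<bar>L r \<zeta> x\<bar> \<partial>lborel)"
      using AE_pairing_le[OF W_bdd[OF walk_in_W[OF \<gamma> \<delta>]] L_cyl_integrable[OF \<zeta>]]
      by eventually_elim (use s0 k in auto)
  qed
  moreover have "\<bar>LBINT r:{s<..<?\<tau>}. pairing (\<lambda>x. f (r, h r x)) \<zeta>\<bar> \<le> (LBINT r:{s<..<?\<tau>}. \<bar>pairing (\<lambda>x. f (r, h r x)) \<zeta>\<bar>)"
    by (rule set_integral_abs_le[OF sub[OF FP] sub[OF set_integrable_abs[OF FP]]]) auto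
  moreover note set_integral_add(2)[OF sub[OF KN] sub[OF set_integrable_abs[OF FP]]]
  moreover note walk_cell_increment[OF \<gamma> \<delta> \<zeta> s(1) less_imp_le[OF s(2)] order_refl k]
  ultimately show ?thesis unfolding 1 2 by linarith
qed

end

section \<open>Averaging over all walks\<close>

text \<open>Averaging out the coordinate \<open>k\<close>, of which \<open>H\<close> is independent. The map exchanging \<open>\<omega>\<^sub>k\<close> with an
additional variable \<open>j\<close> is an involution of \<open>\<Omega> \<times> Q\<close>; it turns \<open>H \<omega> j\<close> into \<open>H \<omega> (\<omega> k)\<close>.\<close>

lemma sum_PiE_resample:
  fixes H :: "(nat \<Rightarrow> 'q) \<Rightarrow> 'q \<Rightarrow> real"
  assumes Q: "finite Q" "Q \<noteq> {}" and k: "k < m"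
    and indep: "\<And>\<omega> i j. \<omega> \<in> PiE {..<m} (\<lambda>_. Q) \<Longrightarrow> i \<in> Q \<Longrightarrow> j \<in> Q \<Longrightarrow> H (fun_upd \<omega> k i) j = H \<omega> j"
  shows "(\<Sum>\<omega>\<in>PiE {..<m} (\<lambda>_. Q). H \<omega> (\<omega> k)) = (\<Sum>\<omega>\<in>PiE {..<m} (\<lambda>_. Q). (\<Sum>j\<in>Q. H \<omega> j) / card Q)"
proof -
  let ?\<Omega> = "PiE {..<m} (\<lambda>_. Q)"
  let ?\<sigma> = "\<lambda>(\<omega>, j). (fun_upd \<omega> k j, \<omega> k)"
  have upd: "(fun_upd \<omega> k j) \<in> ?\<Omega>" "\<omega> k \<in> Q" if "\<omega> \<in> ?\<Omega>" "j \<in> Q" for \<omega> j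
    using that k by (auto simp: PiE_iff extensional_def)
  have "(\<Sum>p\<in>?\<Omega> \<times> Q. case p of (\<omega>, j) \<Rightarrow> H \<omega> (\<omega> k)) = (\<Sum>p\<in>?\<Omega> \<times> Q. case p of (\<omega>, j) \<Rightarrow> H \<omega> j)"
    by (rule sum.reindex_bij_witness[of _ ?\<sigma> ?\<sigma>]) (use upd indep in auto)
  then have "(\<Sum>\<omega>\<in>?\<Omega>. card Q * H \<omega> (\<omega> k)) = (\<Sum>\<omega>\<in>?\<Omega>. \<Sum>j\<in>Q. H \<omega> j)"
    by (simp add: sum.cartesian_product[symmetric])
  then have "card Q * (\<Sum>\<omega>\<in>?\<Omega>. H \<omega> (\<omega> k)) = (\<Sum>\<omega>\<in>?\<Omega>. \<Sum>j\<in>Q. H \<omega> j)"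
    by (simp add: sum_distrib_left)
  then show ?thesis
    using Q by (simp add: sum_divide_distrib[symmetric] eq_divide_eq mult.commute)
qed

lemma pairing_average:
  assumes "\<And>\<omega>. \<omega> \<in> \<Omega> \<Longrightarrow> integrable lborel (\<lambda>x. a \<omega> x * \<phi> x)"
  shows "pairing (\<lambda>x. (\<Sum>\<omega>\<in>\<Omega>. a \<omega> x) / c) \<phi> = (\<Sum>\<omega>\<in>\<Omega>. pairing (a \<omega>) \<phi>) / c"
proof -
  have "pairing (\<lambda>x. (\<Sum>\<omega>\<in>\<Omega>. a \<omega> x) / c) \<phi> = (\<integral>x. (\<Sum>\<omega>\<in>\<Omega>. a \<omega> x * \<phi> x) / c \<partial>lborel)"
    by (simp add: pairing_def sum_distrib_right)
  also have "\<dots> = (\<Sum>\<omega>\<in>\<Omega>. pairing (a \<omega>) \<phi>) / c"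
    using assms by (simp add: pairing_def Bochner_Integration.integral_sum)
  finally show ?thesis .
qed

context evolution
begin

text \<open>Condition (W2) for the uniform distribution on a finite set, transported to constant real sequences to fit
the sample spaces in \<^const>\<open>closed_under_expectation\<close>.\<close>

lemma W_average:
  assumes \<Omega>: "finite \<Omega>" "\<Omega> \<noteq> {}" and v: "\<And>\<omega>. \<omega> \<in> \<Omega> \<Longrightarrow> v \<omega> \<in> W"
  shows "restrict (\<lambda>p. (\<Sum>\<omega>\<in>\<Omega>. v \<omega> p) / card \<Omega>) (strip T) \<in> W"
proof -
  define n where "n = card \<Omega>"
  obtain b where b: "bij_betw b {0..<n} \<Omega>" using ex_bij_betw_nat_finite[OF \<Omega>(1)] by (auto simp: n_def)
  define e where "e i = (\<lambda>_::nat. real i)" for i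
  define A where "A = e ` {0..<n}"
  have inj: "inj_on e {0..<n}" by (auto simp: inj_on_def e_def fun_eq_iff)
  have n: "n > 0" using \<Omega> by (simp add: n_def card_gt_0_iff)
  have A: "finite A" "A \<noteq> {}" "card A = n" using n inj by (auto simp: A_def card_image)
  define u where "u a = v (b (nat \<lfloor>a 0\<rfloor>))" for a :: "nat \<Rightarrow> real"
  have ue: "u (e i) = v (b i)" for i by (simp add: u_def e_def)
  have bi: "b i \<in> \<Omega>" if "i \<in> {0..<n}" for i using b that by (auto simp: bij_betw_def)
  have uW: "u a \<in> W" if "a \<in> A" for a using that bi v by (auto simp: A_def ue)
  have "restrict (\<lambda>p. LINT a|uniform_count_measure A. u a p) (strip T) \<in> W"
  proof (rule W_expectation[unfolded closed_under_expectation_def, rule_format])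
    show "prob_space (uniform_count_measure A)" by (rule prob_space_uniform_count_measure[OF A(1,2)])
    have "(\<lambda>(a, p). u a p) \<in> borel_measurable (count_space A \<Otimes>\<^sub>M restrict_space borel (strip T))"
      by (rule measurable_pair_measure_countable1)
         (use A uW W_bdd in \<open>auto simp: bdd_on_strip_def countable_finite\<close>)
    also have "borel_measurable (count_space A \<Otimes>\<^sub>M restrict_space borel (strip T)) =
        borel_measurable (uniform_count_measure A \<Otimes>\<^sub>M restrict_space borel (strip T))"
      by (intro measurable_cong_sets sets_pair_measure_cong refl) (simp add: sets_uniform_count_measure)
    finally show "(\<lambda>(a, p). u a p) \<in> borel_measurable (uniform_count_measure A \<Otimes>\<^sub>M restrict_space borel (strip T))" .
  qed (use uW in \<open>auto simp: space_uniform_count_measure\<close>)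
  also have "(\<lambda>p. LINT a|uniform_count_measure A. u a p) = (\<lambda>p. (\<Sum>\<omega>\<in>\<Omega>. v \<omega> p) / card \<Omega>)"
  proof
    fix p
    have "(LINT a|uniform_count_measure A. u a p) = (\<Sum>a\<in>A. u a p) / n"
      using integral_uniform_count_measure[OF A(1)] A(3) by simp
    also have "(\<Sum>a\<in>A. u a p) = (\<Sum>i\<in>{0..<n}. v (b i) p)"
      unfolding A_def by (subst sum.reindex[OF inj]) (simp add: ue)
    also have "\<dots> = (\<Sum>\<omega>\<in>\<Omega>. v \<omega> p)" by (rule sum.reindex_bij_betw[OF b])
    finally show "(LINT a|uniform_count_measure A. u a p) = (\<Sum>\<omega>\<in>\<Omega>. v \<omega> p) / card \<Omega>" by (simp add: n_def)
  qed
  finally show ?thesis .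
qed

lemma residual_average:
  assumes \<Omega>: "finite \<Omega>" "\<Omega> \<noteq> {}" and v: "\<And>\<omega>. \<omega> \<in> \<Omega> \<Longrightarrow> v \<omega> \<in> W"
    and \<zeta>: "\<zeta> \<in> C0_inf" and t: "t \<in> {0..T}"
  shows "residual L u0 F (restrict (\<lambda>p. (\<Sum>\<omega>\<in>\<Omega>. v \<omega> p) / card \<Omega>) (strip T)) \<zeta> t =
    (\<Sum>\<omega>\<in>\<Omega>. residual L u0 F (v \<omega>) \<zeta> t) / card \<Omega>"
proof -
  let ?w = "restrict (\<lambda>p. (\<Sum>\<omega>\<in>\<Omega>. v \<omega> p) / card \<Omega>) (strip T)"
  have c: "real (card \<Omega>) \<noteq> 0" using \<Omega> by simp
  have pair: "pairing (\<lambda>x. ?w (s, x)) \<phi> = (\<Sum>\<omega>\<in>\<Omega>. pairing (\<lambda>x. v \<omega> (s, x)) \<phi>) / card \<Omega>"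
    if s: "s \<in> {0..T}" and \<phi>: "integrable lborel \<phi>" for s \<phi>
  proof -
    have "pairing (\<lambda>x. ?w (s, x)) \<phi> = pairing (\<lambda>x. (\<Sum>\<omega>\<in>\<Omega>. v \<omega> (s, x)) / card \<Omega>) \<phi>"
      using s by (simp add: strip_iff)
    also have "\<dots> = (\<Sum>\<omega>\<in>\<Omega>. pairing (\<lambda>x. v \<omega> (s, x)) \<phi>) / card \<Omega>"
      by (rule pairing_average, rule integrable_bounded_mult[OF \<phi>])
         (use bdd_on_strip_section[OF W_bdd[OF v] s] in auto)
    finally show ?thesis .
  qed
  have sub: "set_integrable lborel {0<..<t} q" if "set_integrable lborel {0<..<T} q" for q :: "real \<Rightarrow> real"
    by (rule set_integrable_subset[OF that]) (use t in auto)
  note P = sub[OF set_integrable_pairing[OF W_bdd L_cyl_integrable[OF \<zeta>]]]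
  have "(LBINT s:{0<..<t}. pairing (\<lambda>x. ?w (s, x)) (L s \<zeta>)) =
      (LBINT s:{0<..<t}. (\<Sum>\<omega>\<in>\<Omega>. pairing (\<lambda>x. v \<omega> (s, x)) (L s \<zeta>)) / card \<Omega>)"
    unfolding set_lebesgue_integral_def
  proof (rule integral_cong_AE)
    show "AE s in lborel. indicator {0<..<t} s *\<^sub>R pairing (\<lambda>x. ?w (s, x)) (L s \<zeta>) =
        indicator {0<..<t} s *\<^sub>R ((\<Sum>\<omega>\<in>\<Omega>. pairing (\<lambda>x. v \<omega> (s, x)) (L s \<zeta>)) / card \<Omega>)"
      using cyl_integrable_AE[OF L_cyl_integrable[OF \<zeta>]]
    proof eventually_elim
      case (elim s)
      show ?case
      proof (cases "s \<in> {0<..<t}")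
        case True
        then have "s \<in> {0..T}" "integrable lborel (L s \<zeta>)" using t elim by auto
        from pair[OF this] show ?thesis by (rule arg_cong)
      qed simp
    qed
    show "(\<lambda>s. indicator {0<..<t} s *\<^sub>R pairing (\<lambda>x. ?w (s, x)) (L s \<zeta>)) \<in> borel_measurable lborel"
      using P[OF W_average[OF \<Omega> v]] unfolding set_integrable_def
      by (rule borel_measurable_integrable)
    have "integrable lborel (\<lambda>s. (\<Sum>\<omega>\<in>\<Omega>. indicator {0<..<t} s *\<^sub>R pairing (\<lambda>x. v \<omega> (s, x)) (L s \<zeta>)) / card \<Omega>)"
      using P[OF v] unfolding set_integrable_def
      by (intro Bochner_Integration.integrable_divide Bochner_Integration.integrable_sum) auto
    from borel_measurable_integrable[OF this]
    show "(\<lambda>s. indicator {0<..<t} s *\<^sub>R ((\<Sum>\<omega>\<in>\<Omega>. pairing (\<lambda>x. v \<omega> (s, x)) (L s \<zeta>)) / card \<Omega>)) \<in> borel_measurable lborel"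
      by (simp add: sum_distrib_left)
  qed
  also have "\<dots> = (\<Sum>\<omega>\<in>\<Omega>. LBINT s:{0<..<t}. pairing (\<lambda>x. v \<omega> (s, x)) (L s \<zeta>)) / card \<Omega>"
    using P[OF v] by (simp add: set_lebesgue_integral_def set_integrable_def sum_distrib_left
        Bochner_Integration.integral_sum sum_divide_distrib)
  finally show ?thesis
    unfolding residual_def pair[OF t C0_inf_integrable[OF \<zeta>]]
    using c by (simp add: sum.distrib sum_subtractf field_simps)
qed

text \<open>What is retained of the mean \<open>w\<close> over all walks with \<open>m\<close> cells whose jump number \<open>k\<close> is uniformly
distributed over \<open>\<gamma> k j\<close>, \<open>j \<in> Q\<close>: there are mean states \<open>Y k\<close> before the jumps, such that the defect
of \<open>w\<close> in the equation is a sum of terms testing \<open>Y k\<close> against mean increments of \<open>\<zeta>\<close>, and \<open>Y k\<close> is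
close to \<open>w\<close> throughout the cell before the jump.\<close>

definition averaged_walk ::
    "nat \<Rightarrow> 'q set \<Rightarrow> (nat \<Rightarrow> 'q \<Rightarrow> real^'n \<Rightarrow> real^'n) \<Rightarrow> (real \<times> (real^'n) \<Rightarrow> real) \<Rightarrow> (nat \<Rightarrow> real^'n \<Rightarrow> real) \<Rightarrow> bool" where
  "averaged_walk m Q \<gamma> w Y \<longleftrightarrow> w \<in> W \<and> (\<forall>k<m. Y k \<in> borel_measurable borel) \<and> (\<forall>k<m. \<forall>x. \<bar>Y k x\<bar> \<le> K) \<and>
    (\<forall>\<zeta>\<in>C0_inf. \<forall>t\<in>{0..T}. residual L u0 (\<lambda>s x. f (s, h s x)) w \<zeta> t =
       (\<Sum>k<cell (T / real m) t. pairing (Y k) (\<lambda>x. (\<Sum>j\<in>Q. \<zeta> (\<gamma> k j x)) / card Q - \<zeta> x))) \<and>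
    (\<forall>\<zeta>\<in>C0_inf. \<forall>k<m. \<forall>s. real k * (T / real m) \<le> s \<longrightarrow> s < real (Suc k) * (T / real m) \<longrightarrow>
       \<bar>pairing (Y k) \<zeta> - pairing (\<lambda>x. w (s, x)) \<zeta>\<bar> \<le>
       (LBINT r:{s<..<real (Suc k) * (T / real m)}. K * (\<integral>x. \<bar>L r \<zeta> x\<bar> \<partial>lborel) + \<bar>pairing (\<lambda>x. f (r, h r x)) \<zeta>\<bar>))"

lemma averaged_walk_exists:
  fixes \<gamma> :: "nat \<Rightarrow> 'q \<Rightarrow> real^'n \<Rightarrow> real^'n"
  assumes m: "0 < m" and Q: "finite Q" "Q \<noteq> {}" and \<gamma>: "\<And>k j. \<gamma> k j \<in> G"
  shows "\<exists>w Y. averaged_walk m Q \<gamma> w Y"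
proof -
  define \<delta> where "\<delta> = T / real m"
  define \<Omega> where "\<Omega> = PiE {..<m} (\<lambda>_. Q)"
  have \<Omega>: "finite \<Omega>" "\<Omega> \<noteq> {}" using Q by (auto simp: \<Omega>_def finite_PiE PiE_eq_empty_iff)
  have c: "real (card \<Omega>) \<noteq> 0" "real (card \<Omega>) > 0" using \<Omega> by (auto simp: card_gt_0_iff)
  have \<delta>: "0 < \<delta>" using m T by (simp add: \<delta>_def)
  have T_eq: "real m * \<delta> = T" using m by (simp add: \<delta>_def)
  (* the walk belonging to the sample point \<omega> *)
  define g where "g \<omega> k = \<gamma> k (\<omega> k)" for \<omega> k
  have g: "range (g \<omega>) \<subseteq> G" for \<omega> using \<gamma> by (auto simp: g_def)
  have kT: "real (Suc k) * \<delta> \<le> T" if "k < m" for k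
    using mult_right_mono[of "real (Suc k)" "real m" \<delta>] that \<delta> by (simp add: T_eq del: of_nat_Suc)
  define w where "w = restrict (\<lambda>p. (\<Sum>\<omega>\<in>\<Omega>. walk \<delta> (g \<omega>) p) / card \<Omega>) (strip T)"
  define Y where "Y k x = (\<Sum>\<omega>\<in>\<Omega>. walk_before_jump \<delta> (g \<omega>) k x) / card \<Omega>" for k x
  note walkW = walk_in_W[OF g \<delta>]
  note yb = walk_before_jump_borel[OF g \<delta> kT]
  have Y_pair: "pairing (Y k) \<phi> = (\<Sum>\<omega>\<in>\<Omega>. pairing (walk_before_jump \<delta> (g \<omega>) k) \<phi>) / card \<Omega>"
    if "k < m" "integrable lborel \<phi>" for k \<phi>
    unfolding Y_def[abs_def]
    by (rule pairing_average, rule integrable_bounded_mult[OF that(2)]) (use yb[OF that(1)] in auto)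
  have w_pair: "pairing (\<lambda>x. w (s, x)) \<phi> = (\<Sum>\<omega>\<in>\<Omega>. pairing (\<lambda>x. walk \<delta> (g \<omega>) (s, x)) \<phi>) / card \<Omega>"
    if s: "s \<in> {0..T}" and \<phi>: "integrable lborel \<phi>" for s \<phi>
  proof -
    have "pairing (\<lambda>x. w (s, x)) \<phi> = pairing (\<lambda>x. (\<Sum>\<omega>\<in>\<Omega>. walk \<delta> (g \<omega>) (s, x)) / card \<Omega>) \<phi>"
      using s by (simp add: strip_iff w_def)
    also have "\<dots> = (\<Sum>\<omega>\<in>\<Omega>. pairing (\<lambda>x. walk \<delta> (g \<omega>) (s, x)) \<phi>) / card \<Omega>"
      by (rule pairing_average, rule integrable_bounded_mult[OF \<phi>])
         (use bdd_on_strip_section[OF W_bdd[OF walkW] s] in auto)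
    finally show ?thesis .
  qed
  have "averaged_walk m Q \<gamma> w Y"
    unfolding averaged_walk_def \<delta>_def[symmetric]
  proof (intro conjI allI ballI impI)
    show "w \<in> W" unfolding w_def by (rule W_average[OF \<Omega> walkW])
    show Yb: "Y k \<in> borel_measurable borel" if "k < m" for k
      unfolding Y_def[abs_def] using yb(1)[OF that] by measurable
    show Yle: "\<bar>Y k x\<bar> \<le> K" if "k < m" for k x
    proof -
      have "\<bar>\<Sum>\<omega>\<in>\<Omega>. walk_before_jump \<delta> (g \<omega>) k x\<bar> \<le> (\<Sum>\<omega>\<in>\<Omega>. K)"
        by (rule order_trans[OF sum_abs sum_mono]) (rule yb(2)[OF that])
      then show ?thesis using c by (simp add: Y_def abs_divide pos_divide_le_eq mult.commute)
    qed
    show "residual L u0 (\<lambda>s x. f (s, h s x)) w \<zeta> t =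
       (\<Sum>k<cell \<delta> t. pairing (Y k) (\<lambda>x. (\<Sum>j\<in>Q. \<zeta> (\<gamma> k j x)) / card Q - \<zeta> x))"
      if \<zeta>: "\<zeta> \<in> C0_inf" and t: "t \<in> {0..T}" for \<zeta> t
    proof -
      let ?y = "\<lambda>\<omega> k. walk_before_jump \<delta> (g \<omega>) k"
      have cm: "cell \<delta> t \<le> m" using t by (intro cell_le \<delta>) (auto simp: T_eq)
      have "residual L u0 (\<lambda>s x. f (s, h s x)) w \<zeta> t =
          (\<Sum>\<omega>\<in>\<Omega>. \<Sum>k<cell \<delta> t. pairing (?y \<omega> k) (\<zeta> \<circ> g \<omega> k) - pairing (?y \<omega> k) \<zeta>) / card \<Omega>"
        unfolding w_def residual_average[OF \<Omega> walkW \<zeta> t] walk_equation[OF g \<delta> \<zeta> t] ..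
      also have "\<dots> = (\<Sum>k<cell \<delta> t. ((\<Sum>\<omega>\<in>\<Omega>. pairing (?y \<omega> k) (\<zeta> \<circ> g \<omega> k)) - (\<Sum>\<omega>\<in>\<Omega>. pairing (?y \<omega> k) \<zeta>)) / card \<Omega>)"
        by (subst sum.swap) (simp only: sum_subtractf sum_divide_distrib diff_divide_distrib)
      also have "\<dots> = (\<Sum>k<cell \<delta> t. pairing (Y k) (\<lambda>x. (\<Sum>j\<in>Q. \<zeta> (\<gamma> k j x)) / card Q - \<zeta> x))"
      proof (rule sum.cong[OF refl])
        fix k assume "k \<in> {..<cell \<delta> t}"
        then have k: "k < m" using cm by auto
        have int: "integrable lborel (\<zeta> \<circ> \<gamma> k j)" for j by (rule C0_inf_integrable[OF C0_inf_compose[OF \<zeta> \<gamma>]])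
        note int\<zeta> = C0_inf_integrable[OF \<zeta>]
        note iY = integrable_bounded_mult[OF _ Yb[OF k, folded measurable_lborel2] Yle[OF k]]
        have "(\<Sum>\<omega>\<in>\<Omega>. pairing (?y \<omega> k) (\<zeta> \<circ> g \<omega> k)) = (\<Sum>\<omega>\<in>\<Omega>. (\<Sum>j\<in>Q. pairing (?y \<omega> k) (\<zeta> \<circ> \<gamma> k j)) / card Q)"
          unfolding g_def \<Omega>_def
        proof (rule sum_PiE_resample[OF Q k, where H="\<lambda>\<omega> j. pairing (?y \<omega> k) (\<zeta> \<circ> \<gamma> k j)", unfolded g_def])
          fix \<omega> :: "nat \<Rightarrow> 'q" and i j
          have "?y (fun_upd \<omega> k i) k = ?y \<omega> k"
            by (rule walk_before_jump_cong[OF g g \<delta> kT[OF k]]) (simp add: g_def)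
          then show "pairing (walk_before_jump \<delta> (\<lambda>ka. \<gamma> ka ((fun_upd \<omega> k i) ka)) k) (\<zeta> \<circ> \<gamma> k j) =
              pairing (walk_before_jump \<delta> (\<lambda>k. \<gamma> k (\<omega> k)) k) (\<zeta> \<circ> \<gamma> k j)"
            by (simp add: g_def[abs_def])
        qed
        also have "\<dots> = (\<Sum>j\<in>Q. \<Sum>\<omega>\<in>\<Omega>. pairing (?y \<omega> k) (\<zeta> \<circ> \<gamma> k j)) / card Q"
          by (subst sum.swap) (simp add: sum_divide_distrib)
        finally have "((\<Sum>\<omega>\<in>\<Omega>. pairing (?y \<omega> k) (\<zeta> \<circ> g \<omega> k)) - (\<Sum>\<omega>\<in>\<Omega>. pairing (?y \<omega> k) \<zeta>)) / card \<Omega> =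
            (\<Sum>j\<in>Q. pairing (Y k) (\<zeta> \<circ> \<gamma> k j)) / card Q - pairing (Y k) \<zeta>"
          by (simp add: Y_pair[OF k int] Y_pair[OF k int\<zeta>] diff_divide_distrib sum_divide_distrib divide_divide_eq_left mult.commute)
        also have "\<dots> = pairing (Y k) (\<lambda>x. (\<Sum>j\<in>Q. \<zeta> (\<gamma> k j x)) / card Q - \<zeta> x)"
        proof -
          have "pairing (Y k) (\<lambda>x. (\<Sum>j\<in>Q. \<zeta> (\<gamma> k j x)) / card Q - \<zeta> x) =
              (\<integral>x. (\<Sum>j\<in>Q. Y k x * (\<zeta> \<circ> \<gamma> k j) x) / card Q - Y k x * \<zeta> x \<partial>lborel)"
            by (simp add: pairing_def right_diff_distrib sum_distrib_left)
          also have "\<dots> = (\<Sum>j\<in>Q. pairing (Y k) (\<zeta> \<circ> \<gamma> k j)) / card Q - pairing (Y k) \<zeta>"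
            using iY[OF int] iY[OF int\<zeta>] by (simp add: pairing_def Bochner_Integration.integral_sum)
          finally show ?thesis by simp
        qed
        finally show "((\<Sum>\<omega>\<in>\<Omega>. pairing (?y \<omega> k) (\<zeta> \<circ> g \<omega> k)) - (\<Sum>\<omega>\<in>\<Omega>. pairing (?y \<omega> k) \<zeta>)) / card \<Omega> =
            pairing (Y k) (\<lambda>x. (\<Sum>j\<in>Q. \<zeta> (\<gamma> k j x)) / card Q - \<zeta> x)" .
      qed
      finally show ?thesis .
    qed
    show "\<bar>pairing (Y k) \<zeta> - pairing (\<lambda>x. w (s, x)) \<zeta>\<bar> \<le>
       (LBINT r:{s<..<real (Suc k) * \<delta>}. K * (\<integral>x. \<bar>L r \<zeta> x\<bar> \<partial>lborel) + \<bar>pairing (\<lambda>x. f (r, h r x)) \<zeta>\<bar>)" (is "_ \<le> ?B")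
      if \<zeta>: "\<zeta> \<in> C0_inf" and k: "k < m" and s: "real k * \<delta> \<le> s" "s < real (Suc k) * \<delta>" for \<zeta> k s
    proof -
      have "0 \<le> s" using s(1) \<delta> mult_nonneg_nonneg[of "real k" \<delta>] by linarith
      then have sT: "s \<in> {0..T}" using s kT[OF k] by auto
      note i\<zeta> = C0_inf_integrable[OF \<zeta>]
      have "pairing (Y k) \<zeta> - pairing (\<lambda>x. w (s, x)) \<zeta> =
          (\<Sum>\<omega>\<in>\<Omega>. pairing (walk_before_jump \<delta> (g \<omega>) k) \<zeta> - pairing (\<lambda>x. walk \<delta> (g \<omega>) (s, x)) \<zeta>) / card \<Omega>"
        unfolding Y_pair[OF k i\<zeta>] w_pair[OF sT i\<zeta>] by (simp add: sum_subtractf diff_divide_distrib)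
      moreover have "\<bar>\<Sum>\<omega>\<in>\<Omega>. pairing (walk_before_jump \<delta> (g \<omega>) k) \<zeta> - pairing (\<lambda>x. walk \<delta> (g \<omega>) (s, x)) \<zeta>\<bar> \<le> (\<Sum>\<omega>\<in>\<Omega>. ?B)"
        by (rule order_trans[OF sum_abs sum_mono]) (rule walk_before_jump_close[OF g \<delta> \<zeta> s kT[OF k]])
      ultimately show ?thesis using c by (simp add: abs_divide pos_divide_le_eq mult.commute)
    qed
  qed
  then show ?thesis by blast
qed

end

section \<open>Finitely many directions\<close>

lemma residual_add_operator:
  assumes u: "bdd_on_strip T K u" and A: "cyl_integrable T (\<lambda>s. A s \<zeta>)" and B: "cyl_integrable T (\<lambda>s. B s \<zeta>)"
    and t: "t \<in> {0..T}"
  shows "residual (\<lambda>s \<zeta> x. A s \<zeta> x + B s \<zeta> x) u0 F u \<zeta> t =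
    residual A u0 F u \<zeta> t - (LBINT s:{0<..<t}. pairing (\<lambda>x. u (s, x)) (B s \<zeta>))"
proof -
  have sub: "set_integrable lborel {0<..<t} q" if "set_integrable lborel {0<..<T} q" for q :: "real \<Rightarrow> real"
    by (rule set_integrable_subset[OF that]) (use t in auto)
  note PA = sub[OF set_integrable_pairing[OF u A]] and PB = sub[OF set_integrable_pairing[OF u B]]
    and PAB = sub[OF set_integrable_pairing[OF u cyl_integrable_add[OF A B]]]
  have "(LBINT s:{0<..<t}. pairing (\<lambda>x. u (s, x)) (\<lambda>x. A s \<zeta> x + B s \<zeta> x)) =
    (LBINT s:{0<..<t}. pairing (\<lambda>x. u (s, x)) (A s \<zeta>) + pairing (\<lambda>x. u (s, x)) (B s \<zeta>))"
    unfolding set_lebesgue_integral_def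
  proof (rule integral_cong_AE)
    show "AE s in lborel. indicator {0<..<t} s *\<^sub>R pairing (\<lambda>x. u (s, x)) (\<lambda>x. A s \<zeta> x + B s \<zeta> x) =
        indicator {0<..<t} s *\<^sub>R (pairing (\<lambda>x. u (s, x)) (A s \<zeta>) + pairing (\<lambda>x. u (s, x)) (B s \<zeta>))"
      using cyl_integrable_AE[OF A] cyl_integrable_AE[OF B]
    proof eventually_elim
      case (elim s)
      show ?case
      proof (cases "s \<in> {0<..<t}")
        case True
        then have s: "s \<in> {0..T}" "s \<in> {0<..<T}" using t by auto
        have "integrable lborel (\<lambda>x. u (s, x) * A s \<zeta> x)" "integrable lborel (\<lambda>x. u (s, x) * B s \<zeta> x)"
          using elim s by (auto intro!: integrable_bounded_mult bdd_on_strip_section[OF u])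
        then show ?thesis by (simp add: pairing_def distrib_left)
      qed simp
    qed
    show "(\<lambda>s. indicator {0<..<t} s *\<^sub>R pairing (\<lambda>x. u (s, x)) (\<lambda>x. A s \<zeta> x + B s \<zeta> x)) \<in> borel_measurable lborel"
      using PAB by (auto simp: set_integrable_def dest: borel_measurable_integrable)
    show "(\<lambda>s. indicator {0<..<t} s *\<^sub>R (pairing (\<lambda>x. u (s, x)) (A s \<zeta>) + pairing (\<lambda>x. u (s, x)) (B s \<zeta>))) \<in> borel_measurable lborel"
      using set_integral_add(1)[OF PA PB] by (auto simp: set_integrable_def dest: borel_measurable_integrable)
  qed
  also have "\<dots> = (LBINT s:{0<..<t}. pairing (\<lambda>x. u (s, x)) (A s \<zeta>)) + (LBINT s:{0<..<t}. pairing (\<lambda>x. u (s, x)) (B s \<zeta>))"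
    by (rule set_integral_add(2)[OF PA PB])
  finally show ?thesis by (simp add: residual_def)
qed

lemma cyl_integrable_sum:
  fixes \<phi> :: "'i \<Rightarrow> real \<Rightarrow> real^'n \<Rightarrow> real"
  assumes "\<And>i. i \<in> I \<Longrightarrow> cyl_integrable T (\<phi> i)"
  shows "cyl_integrable T (\<lambda>s x. \<Sum>i\<in>I. \<phi> i s x)"
  using assms
proof (induction I rule: infinite_finite_induct)
  case (insert i I)
  then show ?case using cyl_integrable_add[of T "\<phi> i" "\<lambda>s x. \<Sum>i\<in>I. \<phi> i s x"] by simp
qed (auto simp: cyl_integrable_def split_beta set_integrable_def)

lemma cyl_integrable_weighted_sum:
  fixes \<eta> :: "'j \<Rightarrow> real^'n \<Rightarrow> real"
  assumes a: "\<And>j. a j \<in> borel_measurable borel" "\<And>j s. 0 \<le> a j s" "\<And>j s. a j s \<le> A"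
    and \<eta>: "\<And>j. \<eta> j \<in> C0_inf"
  shows "cyl_integrable T (\<lambda>s x. \<Sum>j\<in>J. a j s * \<eta> j x)"
proof (rule cyl_integrable_sum, rule cyl_integrable_dominated)
  fix j
  have fs: "(fst :: real \<times> (real^'n) \<Rightarrow> _) \<in> borel_measurable borel" "(snd :: real \<times> (real^'n) \<Rightarrow> _) \<in> borel_measurable borel"
    by (intro borel_measurable_continuous_onI continuous_intros)+
  have "(\<lambda>p::real \<times> (real^'n). indicator {0<..<T} (fst p) * (a j (fst p) * \<eta> j (snd p))) \<in> borel_measurable borel"
    by (intro borel_measurable_times measurable_compose[OF fs(1)] measurable_compose[OF fs(2)] a(1) C0_inf_borel \<eta>) simp
  then show "(\<lambda>(s, x). indicator {0<..<T} s * (a j s * \<eta> j x)) \<in> borel_measurable borel" by (simp add: split_beta)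
  show "integrable lborel (\<lambda>x. A * \<eta> j x)" using C0_inf_integrable[OF \<eta>] by simp
  show "\<bar>a j s * \<eta> j x\<bar> \<le> \<bar>A * \<eta> j x\<bar>" for s x
    using a(2,3)[of j s] by (simp add: abs_mult mult_right_mono)
qed

lemma set_integral_const_greaterThanLessThan:
  "a \<le> b \<Longrightarrow> set_integrable lborel {a<..<b} (\<lambda>_. c :: real)"
  "a \<le> b \<Longrightarrow> (LBINT s:{a<..<b}. (c :: real)) = (b - a) * c"
  by (simp_all add: set_integrable_def set_lebesgue_integral_def)

lemma pairing_weighted_sum:
  assumes "\<And>j. j \<in> J \<Longrightarrow> integrable lborel (\<lambda>x. v x * \<phi> j x)"
  shows "pairing v (\<lambda>x. \<Sum>j\<in>J. c j * \<phi> j x) = (\<Sum>j\<in>J. c j * pairing v (\<phi> j))"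
proof -
  have "pairing v (\<lambda>x. \<Sum>j\<in>J. c j * \<phi> j x) = (\<integral>x. (\<Sum>j\<in>J. c j * (v x * \<phi> j x)) \<partial>lborel)"
    by (simp add: pairing_def sum_distrib_left mult.left_commute)
  also have "\<dots> = (\<Sum>j\<in>J. \<integral>x. c j * (v x * \<phi> j x) \<partial>lborel)"
    by (rule Bochner_Integration.integral_sum) (intro integrable_mult_right assms)
  finally show ?thesis by (simp add: pairing_def)
qed

lemma set_integral_weighted_sum:
  fixes a :: "'j \<Rightarrow> 'a \<Rightarrow> real"
  assumes "\<And>j. j \<in> J \<Longrightarrow> set_integrable M S (a j)"
  shows "set_integrable M S (\<lambda>s. \<Sum>j\<in>J. a j s * c j)"
    "(LINT s:S|M. \<Sum>j\<in>J. a j s * c j) = (\<Sum>j\<in>J. (LINT s:S|M. a j s) * c j)"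
proof -
  have eq: "indicator S s *\<^sub>R (\<Sum>j\<in>J. a j s * c j) = (\<Sum>j\<in>J. (indicator S s *\<^sub>R a j s) * c j)" for s
    by (simp add: sum_distrib_left mult.assoc)
  note int = assms[unfolded set_integrable_def]
  show "set_integrable M S (\<lambda>s. \<Sum>j\<in>J. a j s * c j)"
    unfolding set_integrable_def eq by (intro Bochner_Integration.integrable_sum integrable_mult_left int)
  have "(\<integral>s. (\<Sum>j\<in>J. (indicator S s *\<^sub>R a j s) * c j) \<partial>M) = (\<Sum>j\<in>J. \<integral>s. (indicator S s *\<^sub>R a j s) * c j \<partial>M)"
    by (rule Bochner_Integration.integral_sum) (intro integrable_mult_left int)
  then show "(LINT s:S|M. \<Sum>j\<in>J. a j s * c j) = (\<Sum>j\<in>J. (LINT s:S|M. a j s) * c j)"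
    unfolding set_lebesgue_integral_def eq by simp
qed

lemma sum_signs: "(\<Sum>q\<in>J \<times> (UNIV :: bool set). F q) = (\<Sum>j\<in>J. F (j, True) + F (j, False) :: real)"
  by (simp add: sum.cartesian_product[symmetric, of "\<lambda>j b. F (j, b)", simplified] UNIV_bool add.commute)

lemma integrable_indicator_cball:
  "integrable lborel (indicator (cball (x::'a::euclidean_space) r) :: 'a \<Rightarrow> real)"
  by (intro integrable_real_indicator) (simp, rule emeasure_compact_finite[OF compact_cball])

lemma aff_exp_0: "\<nu> \<in> affine_maps \<Longrightarrow> aff_exp \<nu> 0 x = x"
  by (auto simp: affine_maps_def aff_exp_eq_flow flow_0)

context evolution
begin

text \<open>The walk with \<open>m+1\<close> cells chooses in each cell \<open>I\<close> an index \<open>j\<close> and a sign, uniformly among \<open>2 p\<close>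
possibilities, and jumps by \<open>e\<^sup>\<plusminus>\<^sup>\<epsilon>\<^sup>\<nu>\<close> with \<open>\<nu> = \<nu>\<^sub>j\<close>. With \<open>c\<^sub>j = \<integral>\<^sub>I a\<^sub>j\<close> and
\<open>\<epsilon>\<^sup>2 = 2 p c\<^sub>j\<close>, the mean increment of \<open>\<zeta>\<close> is \<open>\<Sum>\<^sub>j c\<^sub>j\<close> times a second difference quotient, hence
nearly \<open>\<Sum>\<^sub>j c\<^sub>j \<eta>\<^sub>j\<close> with \<open>\<eta>\<^sub>j = M \<zeta>\<close> for the direction \<open>\<nu>\<^sub>j\<close>. Three errors remain: this replacement
(\<open>e1\<close>), replacing the state before the jump by \<open>w\<^sub>s\<close> within the cell (\<open>e2\<close>), and the incomplete cell at
the end. The second one is small because \<open>\<eta>\<^sub>j\<close> is a test function and there are only finitely many of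
them, so one modulus of continuity serves all.\<close>

lemma finitely_many_directions:
  fixes \<nu> :: "nat \<Rightarrow> real^'n \<Rightarrow> real^'n" and a :: "nat \<Rightarrow> real \<Rightarrow> real"
  assumes \<nu>: "\<And>j. \<nu> j \<in> affine_maps" and \<nu>G: "\<And>j t. aff_exp (\<nu> j) t \<in> G"
    and p: "0 < p"
    and a: "\<And>j. a j \<in> borel_measurable borel" "\<And>j s. 0 \<le> a j s" "\<And>j s. a j s \<le> A"
  shows "\<exists>w\<in>W. weak_solution T (\<lambda>s \<zeta> x. L s \<zeta> x + (\<Sum>j<p. a j s * second_diff (\<nu> j) \<zeta> x)) u0 (\<lambda>s x. f (s, h s x)) w"
proof -
  let ?F = "\<lambda>s x. f (s, h s x)"
  let ?Q = "{..<p} \<times> (UNIV :: bool set)"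
  have Q: "finite ?Q" "?Q \<noteq> {}" "card ?Q = 2 * p" using p by auto
  have A: "0 \<le> A" using a(2,3)[of 0 0] by linarith
  note K = K_nonneg
  (* m + 1 cells, so that the number of cells is never 0 *)
  define \<delta> where "\<delta> m = T / real (Suc m)" for m
  have \<delta>: "0 < \<delta> m" for m using T by (simp add: \<delta>_def)
  have \<delta>m: "real (Suc m) * \<delta> m = T" for m by (simp add: \<delta>_def del: of_nat_Suc)
  have \<delta>_lim: "\<delta> \<longlonglongrightarrow> 0"
    using tendsto_mult[OF tendsto_const[of T] LIMSEQ_inverse_real_of_nat] by (simp add: \<delta>_def[abs_def] divide_inverse)
  define I where "I m k = {real k * \<delta> m<..<real (Suc k) * \<delta> m}" for m k
  have a_int: "set_integrable lborel {x<..<y} (a j)" if "x \<le> y" for x y j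
    unfolding set_integrable_def
    by (rule Bochner_Integration.integrable_bound[OF set_integral_const_greaterThanLessThan(1)[OF that, of A, unfolded set_integrable_def]])
       (use a A in \<open>auto simp: indicator_def\<close>)
  define c where "c m k j = (LBINT s:I m k. a j s)" for m k j
  have kk: "real k * \<delta> m \<le> real (Suc k) * \<delta> m" for k m using \<delta>[of m] by (simp add: algebra_simps)
  have Ilen: "real (Suc k) * \<delta> m - real k * \<delta> m = \<delta> m" for k m by (simp add: algebra_simps)
  have c_nonneg: "0 \<le> c m k j" for m k j
    unfolding c_def set_lebesgue_integral_def by (intro integral_nonneg_AE AE_I2) (simp add: a(2))
  have c_le: "c m k j \<le> \<delta> m * A" for m k j
  proof -
    have "c m k j \<le> (LBINT s:I m k. A)"
      unfolding c_def I_def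
      by (intro set_integral_mono a_int set_integral_const_greaterThanLessThan kk a(3))
    then show ?thesis using kk[of k m] Ilen[of k m] by (simp add: I_def set_integral_const_greaterThanLessThan(2))
  qed
  (* a jump of this size has the mean effect c m k j, after averaging over 2 p choices *)
  define \<epsilon> where "\<epsilon> m k j = sqrt (2 * real p * c m k j)" for m k j
  have \<epsilon>: "0 \<le> \<epsilon> m k j" "(\<epsilon> m k j)\<^sup>2 = 2 * real p * c m k j" for m k j
    using c_nonneg by (auto simp: \<epsilon>_def)
  define \<gamma> where "\<gamma> m k q = aff_exp (\<nu> (fst q)) ((if snd q then 1 else -1) * \<epsilon> m k (fst q))" for m k q
  have "\<exists>w Y. averaged_walk (Suc m) ?Q (\<gamma> m) w Y" for m
  proof (rule averaged_walk_exists[OF _ Q(1,2)])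
    show "\<gamma> m k q \<in> G" for k q unfolding \<gamma>_def by (rule \<nu>G)
  qed simp
  then obtain w Y where wY: "\<And>m. averaged_walk (Suc m) ?Q (\<gamma> m) (w m) (Y m)" by metis
  note wY' = wY[unfolded averaged_walk_def, folded \<delta>_def]
  have wW: "w m \<in> W" for m using wY' by blast
  have Yb: "Y m k \<in> borel_measurable borel" if "k < Suc m" for m k using wY' that by blast
  have Yle: "\<bar>Y m k x\<bar> \<le> K" if "k < Suc m" for m k x using wY' that by blast
  have res: "residual L u0 ?F (w m) \<zeta> t =
       (\<Sum>k<cell (\<delta> m) t. pairing (Y m k) (\<lambda>x. (\<Sum>q\<in>?Q. \<zeta> (\<gamma> m k q x)) / card ?Q - \<zeta> x))"
    if "\<zeta> \<in> C0_inf" "t \<in> {0..T}" for m \<zeta> t using wY' that by blast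
  have close: "\<bar>pairing (Y m k) \<zeta> - pairing (\<lambda>x. w m (s, x)) \<zeta>\<bar> \<le>
       (LBINT r:{s<..<real (Suc k) * \<delta> m}. K * (\<integral>x. \<bar>L r \<zeta> x\<bar> \<partial>lborel) + \<bar>pairing (?F r) \<zeta>\<bar>)"
    if "\<zeta> \<in> C0_inf" "k < Suc m" "real k * \<delta> m \<le> s" "s < real (Suc k) * \<delta> m" for m \<zeta> k s
    using wY' that by blast
  define \<eta> where "\<eta> \<zeta> j = second_diff (\<nu> j) \<zeta>" for \<zeta> j
  have \<eta>: "\<eta> \<zeta> j \<in> C0_inf" if "\<zeta> \<in> C0_inf" for \<zeta> j unfolding \<eta>_def by (rule second_diff_C0_inf[OF \<nu> that])
  have M_cyl: "cyl_integrable T (\<lambda>s x. \<Sum>j<p. a j s * \<eta> \<zeta> j x)" if "\<zeta> \<in> C0_inf" for \<zeta>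
    by (rule cyl_integrable_weighted_sum[OF a \<eta>[OF that]])
  show ?thesis
    unfolding \<eta>_def[symmetric]
  proof (rule weak_solution_of_approximate_solutions[OF T W_bdd W_limits _ forcing_set_integrable[OF h] wW])
    show "cyl_integrable T (\<lambda>s x. L s \<zeta> x + (\<Sum>j<p. a j s * \<eta> \<zeta> j x))" if "\<zeta> \<in> C0_inf" for \<zeta>
      by (intro cyl_integrable_add L_cyl_integrable M_cyl that)
    fix \<zeta> :: "real^'n \<Rightarrow> real" and e :: real assume \<zeta>: "\<zeta> \<in> C0_inf" and e: "0 < e"
    have i\<eta>: "integrable lborel (\<eta> \<zeta> j)" for j by (rule C0_inf_integrable[OF \<eta>[OF \<zeta>]])
    define \<Delta> where "\<Delta> j \<epsilon> x = (\<zeta> (aff_exp (\<nu> j) \<epsilon> x) - 2 * \<zeta> x + \<zeta> (aff_exp (\<nu> j) (- \<epsilon>) x)) / \<epsilon>\<^sup>2" for j \<epsilon> x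
    obtain R where R: "\<And>j e. 0 < e \<Longrightarrow> \<exists>d>0. \<forall>\<epsilon>. 0 < \<epsilon> \<and> \<epsilon> < d \<longrightarrow>
        (\<forall>x. \<bar>\<Delta> j \<epsilon> x - \<eta> \<zeta> j x\<bar> \<le> e * indicator (cball (0::real^'n) (R j)) x)"
      unfolding \<Delta>_def \<eta>_def using second_difference_tendsto_second_diff[OF \<nu> \<zeta>] by metis
    define V where "V = (\<Sum>j<p. measure lborel (cball (0::real^'n) (R j)))"
    have V: "0 \<le> V" by (auto simp: V_def intro: sum_nonneg)
    define S where "S = (\<Sum>j<p. A * (K * (\<integral>x. \<bar>\<eta> \<zeta> j x\<bar> \<partial>lborel)))"
    have S: "0 \<le> S" unfolding S_def by (intro sum_nonneg mult_nonneg_nonneg A K integral_nonneg_AE) auto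
    (* each error gets a third of e; adding 1 avoids a vanishing denominator *)
    define e1 where "e1 = e / (3 * (T * A * K * V + 1))"
    define e2 where "e2 = e / (3 * (T * real p * A + 1))"
    have TAKV: "0 \<le> T * A * K * V" "0 \<le> T * real p * A" using T A K V by (auto intro!: mult_nonneg_nonneg)
    have e1: "0 < e1" "T * A * K * V * e1 \<le> e / 3"
      using e TAKV(1) by (auto simp: e1_def divide_simps add_pos_nonneg mult_le_cancel_right1)
    have e2: "0 < e2" "T * real p * A * e2 \<le> e / 3"
      using e TAKV(2) by (auto simp: e2_def divide_simps add_pos_nonneg mult_le_cancel_right1)
    let ?\<kappa> = "\<lambda>j r. K * (\<integral>x. \<bar>L r (\<eta> \<zeta> j) x\<bar> \<partial>lborel) + \<bar>pairing (?F r) (\<eta> \<zeta> j)\<bar>"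
    have ev1: "\<forall>\<^sub>F m in sequentially. \<forall>j\<in>{..<p}. \<forall>\<epsilon>. 0 < \<epsilon> \<longrightarrow> \<epsilon>\<^sup>2 \<le> 2 * real p * (\<delta> m * A) \<longrightarrow>
        (\<forall>x. \<bar>\<Delta> j \<epsilon> x - \<eta> \<zeta> j x\<bar> \<le> e1 * indicator (cball (0::real^'n) (R j)) x)"
    proof (rule eventually_ball_finite, simp, rule ballI)
      fix j
      obtain d where d: "d > 0" "\<And>\<epsilon> x. 0 < \<epsilon> \<Longrightarrow> \<epsilon> < d \<Longrightarrow> \<bar>\<Delta> j \<epsilon> x - \<eta> \<zeta> j x\<bar> \<le> e1 * indicator (cball (0::real^'n) (R j)) x"
        using R[OF e1(1), of j] by blast
      have "(\<lambda>m. 2 * real p * (\<delta> m * A)) \<longlonglongrightarrow> 2 * real p * (0 * A)" by (intro tendsto_intros \<delta>_lim)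
      then have "\<forall>\<^sub>F m in sequentially. 2 * real p * (\<delta> m * A) < d\<^sup>2" using d(1) by (intro order_tendstoD(2)) auto
      then show "\<forall>\<^sub>F m in sequentially. \<forall>\<epsilon>. 0 < \<epsilon> \<longrightarrow> \<epsilon>\<^sup>2 \<le> 2 * real p * (\<delta> m * A) \<longrightarrow>
        (\<forall>x. \<bar>\<Delta> j \<epsilon> x - \<eta> \<zeta> j x\<bar> \<le> e1 * indicator (cball (0::real^'n) (R j)) x)"
      proof eventually_elim
        case (elim m)
        show ?case
        proof (intro allI impI)
          fix \<epsilon> x assume \<epsilon>: "0 < \<epsilon>" "\<epsilon>\<^sup>2 \<le> 2 * real p * (\<delta> m * A)"
          then have "\<epsilon>\<^sup>2 < d\<^sup>2" using elim by linarith
          then have "\<epsilon> < d" using d(1) by (intro power_less_imp_less_base[of \<epsilon> 2 d]) auto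
          then show "\<bar>\<Delta> j \<epsilon> x - \<eta> \<zeta> j x\<bar> \<le> e1 * indicator (cball (0::real^'n) (R j)) x" by (intro d(2) \<epsilon>(1))
        qed
      qed
    qed
    have ev2: "\<forall>\<^sub>F m in sequentially. \<forall>j\<in>{..<p}. \<forall>s t. 0 \<le> s \<longrightarrow> s \<le> t \<longrightarrow> t \<le> T \<longrightarrow> t - s \<le> \<delta> m \<longrightarrow>
        (LBINT r:{s<..<t}. ?\<kappa> j r) \<le> e2"
    proof (rule eventually_ball_finite, simp, rule ballI)
      fix j
      have "set_integrable lborel {0<..<T} (?\<kappa> j)"
        by (intro set_integral_add set_integrable_abs forcing_set_integrable h \<eta> \<zeta> set_integrable_mult_right
            cyl_integrable_section cyl_integrable_abs L_cyl_integrable)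
      then obtain d where d: "d > 0" "\<And>s t. 0 \<le> s \<Longrightarrow> s \<le> t \<Longrightarrow> t \<le> T \<Longrightarrow> t - s < d \<Longrightarrow> \<bar>LBINT r:{s<..<t}. ?\<kappa> j r\<bar> < e2"
        using set_integral_small_interval[of T "?\<kappa> j" e2] e2 T by auto
      have "\<forall>\<^sub>F m in sequentially. \<delta> m < d" using order_tendstoD(2)[OF \<delta>_lim d(1)] .
      then show "\<forall>\<^sub>F m in sequentially. \<forall>s t. 0 \<le> s \<longrightarrow> s \<le> t \<longrightarrow> t \<le> T \<longrightarrow> t - s \<le> \<delta> m \<longrightarrow>
        (LBINT r:{s<..<t}. ?\<kappa> j r) \<le> e2"
      proof eventually_elim
        case (elim m)
        show ?case
        proof (intro allI impI)
          fix s t assume "0 \<le> s" "s \<le> t" "t \<le> T" "t - s \<le> \<delta> m"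
          then show "(LBINT r:{s<..<t}. ?\<kappa> j r) \<le> e2" using d(2)[of s t] elim by linarith
        qed
      qed
    qed
    have ev3: "\<forall>\<^sub>F m in sequentially. \<delta> m * S < e / 3"
    proof -
      have "(\<lambda>m. \<delta> m * S) \<longlonglongrightarrow> 0 * S" by (intro tendsto_intros \<delta>_lim)
      then show ?thesis using e by (intro order_tendstoD(2)) auto
    qed
    show "\<forall>\<^sub>F m in sequentially. \<forall>t\<in>{0..T}.
       \<bar>residual (\<lambda>s \<zeta> x. L s \<zeta> x + (\<Sum>j<p. a j s * \<eta> \<zeta> j x)) u0 ?F (w m) \<zeta> t\<bar> \<le> e"
      using ev1 ev2 ev3
    proof eventually_elim
      case (elim m)
      note wb = W_bdd[OF wW[of m]]
      define g where "g s j = pairing (\<lambda>x. w m (s, x)) (\<eta> \<zeta> j)" for s j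
      define b where "b s = pairing (\<lambda>x. w m (s, x)) (\<lambda>x. \<Sum>j<p. a j s * \<eta> \<zeta> j x)" for s
      have b_int: "set_integrable lborel {0<..<T} b"
        unfolding b_def[abs_def] by (rule set_integrable_pairing[OF wb M_cyl[OF \<zeta>]])
      have b_eq: "b s = (\<Sum>j<p. a j s * g s j)" if s: "s \<in> {0..T}" for s
      proof -
        have "integrable lborel (\<lambda>x. w m (s, x) * \<eta> \<zeta> j x)" for j
          by (rule integrable_bounded_mult[OF i\<eta>]) (use bdd_on_strip_section[OF wb s] in auto)
        then show ?thesis
          unfolding b_def g_def by (rule pairing_weighted_sum)
      qed
      have g_le: "\<bar>g s j\<bar> \<le> K * (\<integral>x. \<bar>\<eta> \<zeta> j x\<bar> \<partial>lborel)" if s: "s \<in> {0..T}" for s j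
        unfolding g_def pairing_def
        by (rule integral_bounded_mult_le[OF i\<eta>]) (use bdd_on_strip_section[OF wb s] in auto)
      have b_le: "\<bar>b s\<bar> \<le> S" if s: "s \<in> {0..T}" for s
        unfolding b_eq[OF s] S_def
      proof (rule order_trans[OF sum_abs sum_mono])
        fix j
        show "\<bar>a j s * g s j\<bar> \<le> A * (K * (\<integral>x. \<bar>\<eta> \<zeta> j x\<bar> \<partial>lborel))"
          unfolding abs_mult using a(2,3)[of j s] g_le[OF s, of j] A by (intro mult_mono) auto
      qed
      (* the first two errors within one cell *)
      have cell_error: "\<bar>pairing (Y m k) (\<lambda>x. (\<Sum>q\<in>?Q. \<zeta> (\<gamma> m k q x)) / card ?Q - \<zeta> x) - (LBINT s:I m k. b s)\<bar>
          \<le> \<delta> m * (A * K * V * e1 + real p * A * e2)" if k: "k < Suc m" for k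
      proof -
        have kT: "real (Suc k) * \<delta> m \<le> T"
          using mult_right_mono[of "real (Suc k)" "real (Suc m)" "\<delta> m"] k \<delta>[of m] by (simp add: \<delta>m del: of_nat_Suc)
        have k0: "0 \<le> real k * \<delta> m" using \<delta>[of m] by simp
        have IT: "s \<in> {0..T}" if "s \<in> I m k" for s using that k0 kT by (auto simp: I_def)
        have subI: "set_integrable lborel (I m k) q" if "set_integrable lborel {0<..<T} q" for q :: "real \<Rightarrow> real"
          by (rule set_integrable_subset[OF that]) (use k0 kT in \<open>auto simp: I_def\<close>)
        let ?D = "\<lambda>x. (\<Sum>q\<in>?Q. \<zeta> (\<gamma> m k q x)) / card ?Q - \<zeta> x"
        let ?E = "\<lambda>x. \<Sum>j<p. c m k j * \<eta> \<zeta> j x"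
        have D_eq: "?D x = (\<Sum>j<p. c m k j * \<Delta> j (\<epsilon> m k j) x)" for x
        proof -
          have term_eq: "\<zeta> (\<gamma> m k (j, True) x) + \<zeta> (\<gamma> m k (j, False) x) - 2 * \<zeta> x = 2 * real p * (c m k j * \<Delta> j (\<epsilon> m k j) x)" for j
          proof (cases "\<epsilon> m k j = 0")
            case True
            then have "c m k j = 0" using \<epsilon>(2)[of m k j] p by simp
            then show ?thesis using True by (simp add: \<gamma>_def aff_exp_0[OF \<nu>])
          next
            case False
            have "(\<epsilon> m k j)\<^sup>2 * \<Delta> j (\<epsilon> m k j) x = \<zeta> (\<gamma> m k (j, True) x) + \<zeta> (\<gamma> m k (j, False) x) - 2 * \<zeta> x"
              using False by (simp add: \<Delta>_def \<gamma>_def)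
            then show ?thesis unfolding \<epsilon>(2) by simp
          qed
          have "(\<Sum>q\<in>?Q. \<zeta> (\<gamma> m k q x)) - 2 * real p * \<zeta> x = (\<Sum>j<p. \<zeta> (\<gamma> m k (j, True) x) + \<zeta> (\<gamma> m k (j, False) x) - 2 * \<zeta> x)"
            unfolding sum_signs by (simp add: sum_subtractf)
          also have "\<dots> = 2 * real p * (\<Sum>j<p. c m k j * \<Delta> j (\<epsilon> m k j) x)"
            unfolding term_eq by (simp add: sum_distrib_left)
          finally show ?thesis unfolding Q(3) using p by (simp add: field_simps)
        qed
        have i\<gamma>: "integrable lborel (\<lambda>x. \<zeta> (\<gamma> m k q x))" for q
          using C0_inf_integrable[OF C0_inf_compose[OF \<zeta> \<nu>G]] by (simp add: \<gamma>_def o_def)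
        have iD: "integrable lborel ?D" using i\<gamma> C0_inf_integrable[OF \<zeta>] by auto
        have iE: "integrable lborel ?E" using i\<eta> by auto
        note Ym = Yb[OF k, folded measurable_lborel2] and Yk = Yle[OF k]
        have DE: "\<bar>pairing (Y m k) ?D - pairing (Y m k) ?E\<bar> \<le> \<delta> m * (A * K * V * e1)"
        proof -
          have D_close: "\<bar>?D x - ?E x\<bar> \<le> (\<Sum>j<p. \<delta> m * A * e1 * indicator (cball (0::real^'n) (R j)) x)" for x
          proof -
            have "?D x - ?E x = (\<Sum>j<p. c m k j * (\<Delta> j (\<epsilon> m k j) x - \<eta> \<zeta> j x))"
              unfolding D_eq by (simp add: sum_subtractf right_diff_distrib)
            also have "\<bar>\<dots>\<bar> \<le> (\<Sum>j<p. \<delta> m * A * e1 * indicator (cball (0::real^'n) (R j)) x)"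
            proof (rule order_trans[OF sum_abs sum_mono])
              fix j assume j: "j \<in> {..<p}"
              show "\<bar>c m k j * (\<Delta> j (\<epsilon> m k j) x - \<eta> \<zeta> j x)\<bar> \<le> \<delta> m * A * e1 * indicator (cball (0::real^'n) (R j)) x"
              proof (cases "\<epsilon> m k j = 0")
                case True
                then have "c m k j = 0" using \<epsilon>(2)[of m k j] p by simp
                then show ?thesis using \<delta>[of m] A e1 by simp
              next
                case False
                then have "0 < \<epsilon> m k j" using \<epsilon>(1)[of m k j] by simp
                moreover have "(\<epsilon> m k j)\<^sup>2 \<le> 2 * real p * (\<delta> m * A)"
                  unfolding \<epsilon>(2) using c_le[of m k j] by (intro mult_left_mono) auto
                ultimately have "\<bar>\<Delta> j (\<epsilon> m k j) x - \<eta> \<zeta> j x\<bar> \<le> e1 * indicator (cball (0::real^'n) (R j)) x"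
                  using elim(1) j by blast
                then have "c m k j * \<bar>\<Delta> j (\<epsilon> m k j) x - \<eta> \<zeta> j x\<bar> \<le> (\<delta> m * A) * (e1 * indicator (cball (0::real^'n) (R j)) x)"
                  using c_nonneg[of m k j] c_le[of m k j] \<delta>[of m] A by (intro mult_mono) auto
                then show ?thesis using c_nonneg[of m k j] by (simp add: abs_mult mult.assoc)
              qed
            qed
            finally show ?thesis .
          qed
          have iB: "integrable lborel (\<lambda>x. \<Sum>j<p. \<delta> m * A * e1 * indicat_real (cball (0::real^'n) (R j)) x)"
            by (intro Bochner_Integration.integrable_sum integrable_mult_right integrable_indicator_cball)
          have iDE: "integrable lborel (\<lambda>x. \<bar>?D x - ?E x\<bar>)"
            by (rule integrable_abs[OF Bochner_Integration.integrable_diff[OF iD iE]])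
          have "(\<integral>x. \<bar>?D x - ?E x\<bar> \<partial>lborel) \<le> (\<integral>x. (\<Sum>j<p. \<delta> m * A * e1 * indicator (cball (0::real^'n) (R j)) x) \<partial>lborel)"
            by (rule integral_mono[OF iDE iB D_close])
          also have "\<dots> = (\<Sum>j<p. \<integral>x. \<delta> m * A * e1 * indicator (cball (0::real^'n) (R j)) x \<partial>lborel)"
            by (rule Bochner_Integration.integral_sum) (intro integrable_mult_right integrable_indicator_cball)
          also have "\<dots> = \<delta> m * A * e1 * V"
            by (simp add: V_def sum_distrib_left)
          finally have L1: "(\<integral>x. \<bar>?D x - ?E x\<bar> \<partial>lborel) \<le> \<delta> m * A * e1 * V" .
          have "pairing (Y m k) ?D - pairing (Y m k) ?E = pairing (Y m k) (\<lambda>x. ?D x - ?E x)"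
            using integrable_bounded_mult[OF iD Ym Yk] integrable_bounded_mult[OF iE Ym Yk]
            by (simp add: pairing_def right_diff_distrib)
          also have "\<bar>\<dots>\<bar> \<le> K * (\<integral>x. \<bar>?D x - ?E x\<bar> \<partial>lborel)"
            unfolding pairing_def by (rule integral_bounded_mult_le[OF _ Ym Yk]) (use iD iE in auto)
          also have "\<dots> \<le> K * (\<delta> m * A * e1 * V)" by (rule mult_left_mono[OF L1 K])
          also have "\<dots> = \<delta> m * (A * K * V * e1)" by simp
          finally show ?thesis .
        qed
        have Eb: "\<bar>pairing (Y m k) ?E - (LBINT s:I m k. b s)\<bar> \<le> \<delta> m * (real p * A * e2)"
        proof -
          have "pairing (Y m k) ?E = (\<Sum>j<p. c m k j * pairing (Y m k) (\<eta> \<zeta> j))"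
            by (rule pairing_weighted_sum[OF integrable_bounded_mult[OF i\<eta> Ym Yk]])
          moreover have "set_integrable lborel (I m k) (a j)" for j
            unfolding I_def by (rule a_int[OF kk])
          note intE = set_integral_weighted_sum[of "{..<p}", OF this]
          ultimately have E_eq: "pairing (Y m k) ?E = (LBINT s:I m k. \<Sum>j<p. a j s * pairing (Y m k) (\<eta> \<zeta> j))"
            unfolding intE(2) c_def by simp
          have "pairing (Y m k) ?E - (LBINT s:I m k. b s) = (LBINT s:I m k. (\<Sum>j<p. a j s * pairing (Y m k) (\<eta> \<zeta> j)) - b s)"
            unfolding E_eq by (rule set_integral_diff(2)[OF intE(1) subI[OF b_int], symmetric])
          also have "\<bar>\<dots>\<bar> \<le> (LBINT s:I m k. real p * A * e2)"
          proof (rule set_integral_abs_le)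
            show "set_integrable lborel (I m k) (\<lambda>s. (\<Sum>j<p. a j s * pairing (Y m k) (\<eta> \<zeta> j)) - b s)"
              by (rule set_integral_diff(1)[OF intE(1) subI[OF b_int]])
            show "set_integrable lborel (I m k) (\<lambda>s. real p * A * e2)"
              unfolding I_def by (rule set_integral_const_greaterThanLessThan(1)[OF kk])
            show "AE s in lborel. s \<in> I m k \<longrightarrow> \<bar>(\<Sum>j<p. a j s * pairing (Y m k) (\<eta> \<zeta> j)) - b s\<bar> \<le> real p * A * e2"
            proof (intro AE_I2 impI)
              fix s assume s: "s \<in> I m k"
              have "(\<Sum>j<p. a j s * pairing (Y m k) (\<eta> \<zeta> j)) - b s = (\<Sum>j<p. a j s * (pairing (Y m k) (\<eta> \<zeta> j) - g s j))"
                unfolding b_eq[OF IT[OF s]] by (simp add: sum_subtractf right_diff_distrib)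
              also have "\<bar>\<dots>\<bar> \<le> (\<Sum>j<p. A * e2)"
              proof (rule order_trans[OF sum_abs sum_mono])
                fix j assume j: "j \<in> {..<p}"
                have "\<bar>pairing (Y m k) (\<eta> \<zeta> j) - g s j\<bar> \<le> (LBINT r:{s<..<real (Suc k) * \<delta> m}. ?\<kappa> j r)"
                  unfolding g_def by (rule close[OF \<eta>[OF \<zeta>] k]) (use s in \<open>auto simp: I_def\<close>)
                also have "\<dots> \<le> e2"
                  using elim(2) j s IT[OF s] kT Ilen[of k m] by (auto simp: I_def)
                finally show "\<bar>a j s * (pairing (Y m k) (\<eta> \<zeta> j) - g s j)\<bar> \<le> A * e2"
                  unfolding abs_mult using a(2,3)[of j s] A by (intro mult_mono) auto
              qed
              finally show "\<bar>(\<Sum>j<p. a j s * pairing (Y m k) (\<eta> \<zeta> j)) - b s\<bar> \<le> real p * A * e2" by simp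
            qed
          qed
          also have "\<dots> = \<delta> m * (real p * A * e2)"
            unfolding I_def using Ilen[of k m] by (simp only: set_integral_const_greaterThanLessThan(2)[OF kk])
          finally show ?thesis .
        qed
        have "\<bar>x - z\<bar> \<le> d * (B + C)" if "\<bar>x - y\<bar> \<le> d * B" "\<bar>y - z\<bar> \<le> d * C" for x y z d B C :: real
          using that by (simp add: distrib_left)
        from this[OF DE Eb] show ?thesis .
      qed
      (* the errors of the cells up to time n * \<delta> m add up *)
      have sum_error: "\<bar>(\<Sum>k<n. pairing (Y m k) (\<lambda>x. (\<Sum>q\<in>?Q. \<zeta> (\<gamma> m k q x)) / card ?Q - \<zeta> x)) - (LBINT s:{0<..<real n * \<delta> m}. b s)\<bar>
          \<le> real n * \<delta> m * (A * K * V * e1 + real p * A * e2)" if "n \<le> Suc m" for n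
        using that
      proof (induction n)
        case 0
        then show ?case by (simp add: set_lebesgue_integral_def)
      next
        case (Suc n)
        have nT: "real (Suc n) * \<delta> m \<le> T"
          using mult_right_mono[of "real (Suc n)" "real (Suc m)" "\<delta> m"] Suc.prems \<delta>[of m] by (simp add: \<delta>m del: of_nat_Suc)
        have "(LBINT s:{0<..<real (Suc n) * \<delta> m}. b s) = (LBINT s:{0<..<real n * \<delta> m}. b s) + (LBINT s:I m n. b s)"
          unfolding I_def by (rule set_integral_greaterThanLessThan_split[OF b_int _ kk nT]) (use \<delta>[of m] in simp)
        moreover have "\<bar>(x + y) - (x' + y')\<bar> \<le> real (Suc n) * d * B" if "\<bar>x - x'\<bar> \<le> real n * d * B" "\<bar>y - y'\<bar> \<le> d * B" for x y x' y' d B :: real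
        proof -
          have "real (Suc n) * d * B = real n * d * B + d * B" by (simp add: algebra_simps)
          then show ?thesis using that by linarith
        qed
        ultimately show ?case
          using Suc.IH cell_error[of n] Suc.prems by simp
      qed
      show ?case
      proof
        fix t assume t: "t \<in> {0..T}"
        define n where "n = cell (\<delta> m) t"
        have n: "real n * \<delta> m \<le> t" "t < real (Suc n) * \<delta> m" using cell_bounds[OF \<delta>[of m], of t] t by (auto simp: n_def)
        have nm: "n \<le> Suc m" unfolding n_def by (rule cell_le[OF \<delta>[of m]]) (use t \<delta>m in auto)
        have n0: "0 \<le> real n * \<delta> m" using \<delta>[of m] by simp
        have "residual (\<lambda>s \<zeta> x. L s \<zeta> x + (\<Sum>j<p. a j s * \<eta> \<zeta> j x)) u0 ?F (w m) \<zeta> t =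
            residual L u0 ?F (w m) \<zeta> t - (LBINT s:{0<..<t}. b s)"
          unfolding b_def
          by (rule residual_add_operator[where A=L and B="\<lambda>s \<zeta> x. \<Sum>j<p. a j s * \<eta> \<zeta> j x" and \<zeta>=\<zeta>,
                OF wb L_cyl_integrable[OF \<zeta>] M_cyl[OF \<zeta>] t])
        also have "(LBINT s:{0<..<t}. b s) = (LBINT s:{0<..<real n * \<delta> m}. b s) + (LBINT s:{real n * \<delta> m<..<t}. b s)"
          by (rule set_integral_greaterThanLessThan_split[OF b_int n0 n(1)]) (use t in simp)
        finally have eq: "residual (\<lambda>s \<zeta> x. L s \<zeta> x + (\<Sum>j<p. a j s * \<eta> \<zeta> j x)) u0 ?F (w m) \<zeta> t =
            ((\<Sum>k<n. pairing (Y m k) (\<lambda>x. (\<Sum>q\<in>?Q. \<zeta> (\<gamma> m k q x)) / card ?Q - \<zeta> x)) - (LBINT s:{0<..<real n * \<delta> m}. b s))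
            - (LBINT s:{real n * \<delta> m<..<t}. b s)"
          unfolding res[OF \<zeta> t] n_def by simp
        (* the incomplete cell at the end *)
        have "\<bar>LBINT s:{real n * \<delta> m<..<t}. b s\<bar> \<le> (LBINT s:{real n * \<delta> m<..<t}. S)"
        proof (rule set_integral_abs_le[OF set_integrable_subset[OF b_int] set_integral_const_greaterThanLessThan(1)[OF n(1)]])
          show "AE s in lborel. s \<in> {real n * \<delta> m<..<t} \<longrightarrow> \<bar>b s\<bar> \<le> S"
            using t n0 by (intro AE_I2 impI b_le) auto
        qed (use t n0 in auto)
        also have "\<dots> = (t - real n * \<delta> m) * S" by (rule set_integral_const_greaterThanLessThan(2)[OF n(1)])
        also have "\<dots> \<le> \<delta> m * S" using n(2) Ilen[of n m] by (intro mult_right_mono S) linarith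
        finally have left: "\<bar>LBINT s:{real n * \<delta> m<..<t}. b s\<bar> \<le> e / 3" using elim(3) by linarith
        have "real n * \<delta> m * (A * K * V * e1 + real p * A * e2) \<le> T * (A * K * V * e1 + real p * A * e2)"
          using n(1) t A K V e1(1) e2(1) by (intro mult_right_mono add_nonneg_nonneg mult_nonneg_nonneg) auto
        also have "\<dots> \<le> e / 3 + e / 3" using e1(2) e2(2) by (simp add: distrib_left mult.assoc)
        finally show "\<bar>residual (\<lambda>s \<zeta> x. L s \<zeta> x + (\<Sum>j<p. a j s * \<eta> \<zeta> j x)) u0 ?F (w m) \<zeta> t\<bar> \<le> e"
          using left sum_error[OF nm] unfolding eq by linarith
      qed
    qed
  qed
qed

end

section \<open>Measurable directions\<close>

lemma finite_net:
  fixes S :: "'a::heine_borel set"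
  assumes "bounded S" "0 < \<epsilon>"
  obtains F where "finite F" "F \<subseteq> S" "\<And>x. x \<in> S \<Longrightarrow> \<exists>c\<in>F. dist c x < \<epsilon>"
proof -
  have "compact (closure S)" using assms(1) by (simp add: compact_closure)
  moreover have "closure S \<subseteq> (\<Union>c\<in>S. ball c \<epsilon>)"
  proof
    fix x assume "x \<in> closure S"
    then obtain c where "c \<in> S" "dist c x < \<epsilon>" using closure_approachable assms(2) by metis
    then show "x \<in> (\<Union>c\<in>S. ball c \<epsilon>)" by auto
  qed
  ultimately obtain F where F: "F \<subseteq> S" "finite F" "closure S \<subseteq> (\<Union>c\<in>F. ball c \<epsilon>)"
    using compactE_image[of "closure S" S "\<lambda>c. ball c \<epsilon>"] by (metis open_ball)
  show ?thesis
  proof (rule that[OF F(2,1)])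
    fix x assume "x \<in> S"
    then have "x \<in> closure S" using closure_subset by blast
    then obtain c where "c \<in> F" "x \<in> ball c \<epsilon>" using F(3) by blast
    then show "\<exists>c\<in>F. dist c x < \<epsilon>" unfolding mem_ball by blast
  qed
qed

context evolution
begin

text \<open>The coordinates of all \<open>\<mu>\<^sub>i s\<close> lie in a bounded set, which has a finite net of coordinates of elements of
\<open>N\<close>. Each \<open>\<mu>\<^sub>i s\<close> is replaced by the first point of the net within distance \<open>\<epsilon>\<close>; then the operator is a
combination of finitely many directions, whose weight \<open>a\<^sub>j s\<close> counts the \<open>i\<close> with \<open>\<mu>\<^sub>i s\<close> replaced
by the point number \<open>j\<close>.\<close>

lemma finite_valued_approximation:
  fixes N :: "(real ^ 'n \<Rightarrow> real ^ 'n) set" and n :: nat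
  assumes N: "N \<subseteq> affine_maps" "G = exp_set N" and n: "1 \<le> n"
    and \<mu>: "\<And>i. i \<in> {1..n} \<Longrightarrow> \<mu> i \<in> bdd_meas_maps {0<..<T} N"
    and C: "\<And>i s. i \<in> {1..n} \<Longrightarrow> s \<in> {0<..<T} \<Longrightarrow> norm (affine_coords (\<mu> i s)) \<le> C"
    and \<epsilon>: "0 < \<epsilon>"
  shows "\<exists>w\<in>W. \<exists>B. weak_solution T (\<lambda>s \<zeta> x. L s \<zeta> x + B s \<zeta> x) u0 (\<lambda>s x. f (s, h s x)) w \<and>
    (\<forall>\<zeta>\<in>C0_inf. cyl_integrable T (\<lambda>s. B s \<zeta>)) \<and>
    (\<forall>s\<in>{0<..<T}. \<exists>c. (\<forall>i\<in>{1..n}. norm (c i) \<le> C \<and> dist (c i) (affine_coords (\<mu> i s)) < \<epsilon>) \<and>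
      (\<forall>\<zeta>\<in>C0_inf. \<forall>x. B s \<zeta> x = (\<Sum>i=1..n. second_order \<zeta> (c i) x)))"
proof -
  define S where "S = affine_coords ` N \<inter> cball 0 C"
  have "bounded S" unfolding S_def by (intro bounded_Int) auto
  then obtain F where F: "finite F" "F \<subseteq> S" "\<And>x. x \<in> S \<Longrightarrow> \<exists>c\<in>F. dist c x < \<epsilon>"
    using finite_net \<epsilon> by blast
  have X_S: "affine_coords (\<mu> i s) \<in> S" if "i \<in> {1..n}" "s \<in> {0<..<T}" for i s
    using C[OF that] \<mu>[OF that(1)] that(2) by (auto simp: S_def bdd_meas_maps_def)
  have "F \<noteq> {}" using F(3)[OF X_S[of 1 "T / 2"]] n T by auto
  define p where "p = card F"
  have p: "0 < p" using F(1) \<open>F \<noteq> {}\<close> by (simp add: p_def card_gt_0_iff)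
  obtain b where b: "bij_betw b {0..<p} F" using ex_bij_betw_nat_finite[OF F(1)] by (auto simp: p_def)
  have bF: "b j \<in> F" if "j < p" for j using b that by (auto simp: bij_betw_def)
  have "\<exists>\<nu>\<in>N. affine_coords \<nu> = b (if j < p then j else 0)" for j
  proof -
    have "(if j < p then j else 0) < p" using p by simp
    then have "b (if j < p then j else 0) \<in> affine_coords ` N" using bF F(2) unfolding S_def by blast
    then show ?thesis by (metis imageE)
  qed
  then obtain \<nu> where \<nu>: "\<And>j. \<nu> j \<in> N" "\<And>j. affine_coords (\<nu> j) = b (if j < p then j else 0)" by metis
  define J where "J x = (LEAST j. dist (b j) x < \<epsilon> \<and> j < p)" for x
  have J: "J x < p" "dist (b (J x)) x < \<epsilon>" if "x \<in> S" for x
  proof -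
    obtain c where c: "c \<in> F" "dist c x < \<epsilon>" using F(3)[OF \<open>x \<in> S\<close>] by blast
    then obtain j where "j < p" "b j = c" using b by (auto simp: bij_betw_def)
    then have "dist (b j) x < \<epsilon> \<and> j < p" using c by simp
    from LeastI[of "\<lambda>j. dist (b j) x < \<epsilon> \<and> j < p", OF this] show "J x < p" "dist (b (J x)) x < \<epsilon>"
      by (auto simp: J_def)
  qed
  have J_meas[measurable]: "J \<in> measurable borel (count_space UNIV)"
    unfolding J_def[abs_def] by measurable
  define X where "X i s = indicator {0<..<T} s *\<^sub>R affine_coords (\<mu> i s)" for i s
  have X: "X i \<in> borel_measurable borel" if "i \<in> {1..n}" for i
    using \<mu>[OF that] unfolding X_def[abs_def] bdd_meas_maps_altdef by (simp add: borel_measurable_restrict_space_iff)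
  define a where "a j s = (\<Sum>i=1..n. indicator {0<..<T} s * indicator {j} (J (X i s)) :: real)" for j s
  have a1: "a j \<in> borel_measurable borel" for j
  proof -
    have "(\<lambda>s. indicator {j} (J (X i s)) :: real) \<in> borel_measurable borel" if "i \<in> {1..n}" for i
      by (rule measurable_compose[OF measurable_compose[OF X[OF that] J_meas]]) simp
    then show ?thesis
      unfolding a_def[abs_def] by (intro borel_measurable_sum borel_measurable_times) auto
  qed
  have a2: "0 \<le> a j s" for j s unfolding a_def by (intro sum_nonneg) auto
  have a3: "a j s \<le> real n" for j s
  proof -
    have "a j s \<le> (\<Sum>i=1..n. 1)" unfolding a_def by (intro sum_mono) (auto simp: indicator_def)
    then show ?thesis by simp
  qed
  have \<nu>_affine: "\<nu> j \<in> affine_maps" for j using \<nu>(1) N(1) by blast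
  have \<nu>_G: "aff_exp (\<nu> j) t \<in> G" for j t using \<nu>(1) N(2) by (auto simp: exp_set_def)
  define B where "B s \<zeta> x = (\<Sum>j<p. a j s * second_diff (\<nu> j) \<zeta> x)" for s \<zeta> x
  obtain w where w: "w \<in> W" "weak_solution T (\<lambda>s \<zeta> x. L s \<zeta> x + B s \<zeta> x) u0 (\<lambda>s x. f (s, h s x)) w"
    using finitely_many_directions[where \<nu>=\<nu> and a=a, OF \<nu>_affine \<nu>_G p a1 a2 a3] unfolding B_def by blast
  moreover have "cyl_integrable T (\<lambda>s. B s \<zeta>)" if "\<zeta> \<in> C0_inf" for \<zeta>
    unfolding B_def[abs_def] by (rule cyl_integrable_weighted_sum[where a=a, OF a1 a2 a3 second_diff_C0_inf[OF \<nu>_affine that]])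
  moreover have "\<exists>c. (\<forall>i\<in>{1..n}. norm (c i) \<le> C \<and> dist (c i) (affine_coords (\<mu> i s)) < \<epsilon>) \<and>
      (\<forall>\<zeta>\<in>C0_inf. \<forall>x. B s \<zeta> x = (\<Sum>i=1..n. second_order \<zeta> (c i) x))" if s: "s \<in> {0<..<T}" for s
  proof (intro exI[of _ "\<lambda>i. b (J (X i s))"] conjI ballI allI)
    have Xs: "X i s = affine_coords (\<mu> i s)" for i using s by (simp add: X_def)
    have XS: "X i s \<in> S" if "i \<in> {1..n}" for i unfolding Xs by (rule X_S[OF that s])
    show "norm (b (J (X i s))) \<le> C" "dist (b (J (X i s))) (affine_coords (\<mu> i s)) < \<epsilon>" if "i \<in> {1..n}" for i
      using J[OF XS[OF that]] bF[OF J(1)[OF XS[OF that]]] F(2) by (auto simp: S_def Xs[symmetric])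
    fix \<zeta> :: "real^'n \<Rightarrow> real" and x assume \<zeta>: "\<zeta> \<in> C0_inf"
    have "B s \<zeta> x = (\<Sum>j<p. \<Sum>i=1..n. indicator {j} (J (X i s)) * second_order \<zeta> (b j) x)"
      using s by (simp add: B_def a_def sum_distrib_right second_diff_eq_second_order[OF \<nu>_affine \<zeta>] \<nu>(2))
    also have "\<dots> = (\<Sum>i=1..n. \<Sum>j<p. indicator {j} (J (X i s)) * second_order \<zeta> (b j) x)"
      by (rule sum.swap)
    also have "\<dots> = (\<Sum>i=1..n. second_order \<zeta> (b (J (X i s))) x)"
    proof (rule sum.cong[OF refl])
      fix i assume i: "i \<in> {1..n}"
      have "(\<Sum>j<p. indicator {j} (J (X i s)) * second_order \<zeta> (b j) x) =
          (\<Sum>j<p. if j = J (X i s) then second_order \<zeta> (b j) x else 0)"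
        by (rule sum.cong) (auto simp: indicator_def)
      also have "\<dots> = second_order \<zeta> (b (J (X i s))) x"
        using J(1)[OF XS[OF i]] by simp
      finally show "(\<Sum>j<p. indicator {j} (J (X i s)) * second_order \<zeta> (b j) x) = second_order \<zeta> (b (J (X i s))) x" .
    qed
    finally show "B s \<zeta> x = (\<Sum>i=1..n. second_order \<zeta> (b (J (X i s))) x)" .
  qed
  ultimately show ?thesis by blast
qed

lemma second_diff_cyl_integrable:
  fixes N :: "(real ^ 'n \<Rightarrow> real ^ 'n) set" and n :: nat
  assumes N: "N \<subseteq> affine_maps" and \<mu>: "\<And>i. i \<in> {1..n} \<Longrightarrow> \<mu> i \<in> bdd_meas_maps {0<..<T} N"
    and C: "\<And>i s. i \<in> {1..n} \<Longrightarrow> s \<in> {0<..<T} \<Longrightarrow> norm (affine_coords (\<mu> i s)) \<le> C"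
    and \<zeta>: "\<zeta> \<in> C0_inf"
  shows "cyl_integrable T (\<lambda>s x. \<Sum>i=1..n. second_diff (\<mu> i s) \<zeta> x)"
proof (rule cyl_integrable_sum)
  fix i assume i: "i \<in> {1..n}"
  have eq: "second_diff (\<mu> i s) \<zeta> = second_order \<zeta> (affine_coords (\<mu> i s))" if "s \<in> {0<..<T}" for s
    using \<mu>[OF i] that N by (intro second_diff_eq_second_order \<zeta>) (auto simp: bdd_meas_maps_def)
  obtain B R where B: "\<And>c x. norm c \<le> C \<Longrightarrow> \<bar>second_order \<zeta> c x\<bar> \<le> B * indicator (cball 0 R) x"
    using second_order_uniform[OF \<zeta>, of C] by metis
  define X where "X s = indicator {0<..<T} s *\<^sub>R affine_coords (\<mu> i s)" for s
  have X: "X \<in> borel_measurable borel"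
    using \<mu>[OF i] unfolding X_def[abs_def] bdd_meas_maps_altdef by (simp add: borel_measurable_restrict_space_iff)
  have fs: "(fst :: real \<times> (real^'n) \<Rightarrow> _) \<in> borel_measurable borel" "(snd :: real \<times> (real^'n) \<Rightarrow> _) \<in> borel_measurable borel"
    by (intro borel_measurable_continuous_onI continuous_intros)+
  have q: "(\<lambda>(c, x). second_order \<zeta> c x) \<in> borel_measurable borel"
    by (intro borel_measurable_continuous_onI second_order_continuous \<zeta>)
  have "(\<lambda>p::real \<times> (real^'n). (X (fst p), snd p)) \<in> borel_measurable borel"
    by (intro borel_measurable_Pair measurable_compose[OF fs(1)] X fs(2))
  from measurable_compose[OF this q]
  have "(\<lambda>p::real \<times> (real^'n). indicator {0<..<T} (fst p) * second_order \<zeta> (X (fst p)) (snd p)) \<in> borel_measurable borel"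
    by (intro borel_measurable_times measurable_compose[OF fs(1)]) auto
  also have "(\<lambda>p::real \<times> (real^'n). indicator {0<..<T} (fst p) * second_order \<zeta> (X (fst p)) (snd p)) =
      (\<lambda>(s, x). indicator {0<..<T} s * second_diff (\<mu> i s) \<zeta> x)"
    by (auto simp: fun_eq_iff indicator_def X_def eq)
  finally have m: "(\<lambda>(s, x). indicator {0<..<T} s * second_diff (\<mu> i s) \<zeta> x) \<in> borel_measurable borel" .
  show "cyl_integrable T (\<lambda>s. second_diff (\<mu> i s) \<zeta>)"
  proof (rule cyl_integrable_dominated[OF m])
    show "integrable lborel (\<lambda>x. B * indicator (cball (0::real^'n) R) x)"
      by (intro integrable_mult_right integrable_indicator_cball)
    show "\<bar>second_diff (\<mu> i s) \<zeta> x\<bar> \<le> \<bar>B * indicator (cball 0 R) x\<bar>" if "s \<in> {0<..<T}" for s x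
      unfolding eq[OF that] using B[OF C[OF i that], of x] by linarith
  qed
qed

text \<open>The solutions for finite-valued approximations of the directions are approximate solutions for the
directions themselves, since \<^const>\<open>second_order\<close> depends uniformly continuously on the coordinates.\<close>

lemma measurable_directions:
  fixes N :: "(real ^ 'n \<Rightarrow> real ^ 'n) set" and n :: nat
  assumes N: "N \<subseteq> affine_maps" "G = exp_set N" and n: "1 \<le> n"
    and \<mu>: "\<And>i. i \<in> {1..n} \<Longrightarrow> \<mu> i \<in> bdd_meas_maps {0<..<T} N"
  shows "\<exists>w\<in>W. weak_solution T (\<lambda>s \<zeta> x. L s \<zeta> x + (\<Sum>i=1..n. second_diff (\<mu> i s) \<zeta> x)) u0 (\<lambda>s x. f (s, h s x)) w"
proof -
  let ?F = "\<lambda>s x. f (s, h s x)"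
  let ?M = "\<lambda>s \<zeta> x. \<Sum>i=1..n. second_diff (\<mu> i s) \<zeta> x"
  note K = K_nonneg
  have "bounded (\<Union>i\<in>{1..n}. (\<lambda>s. affine_coords (\<mu> i s)) ` {0<..<T})"
    using \<mu> by (intro bounded_UN ballI finite_atLeastAtMost) (auto simp: bdd_meas_maps_altdef)
  then obtain C where C: "\<And>i s. i \<in> {1..n} \<Longrightarrow> s \<in> {0<..<T} \<Longrightarrow> norm (affine_coords (\<mu> i s)) \<le> C"
    unfolding bounded_iff by blast
  define approx where "approx k w B \<longleftrightarrow> w \<in> W \<and> weak_solution T (\<lambda>s \<zeta> x. L s \<zeta> x + B s \<zeta> x) u0 ?F w \<and>
    (\<forall>\<zeta>\<in>C0_inf. cyl_integrable T (\<lambda>s. B s \<zeta>)) \<and>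
    (\<forall>s\<in>{0<..<T}. \<exists>c. (\<forall>i\<in>{1..n}. norm (c i) \<le> C \<and> dist (c i) (affine_coords (\<mu> i s)) < inverse (real (Suc k))) \<and>
      (\<forall>\<zeta>\<in>C0_inf. \<forall>x. B s \<zeta> x = (\<Sum>i=1..n. second_order \<zeta> (c i) x)))" for k w B
  have "\<exists>w B. approx k w B" for k
  proof -
    have "0 < inverse (real (Suc k))" by simp
    from finite_valued_approximation[where \<mu>=\<mu>, OF N n \<mu> C this] show ?thesis
      unfolding approx_def by blast
  qed
  then obtain w B where "\<And>k. approx k (w k) (B k)" by metis
  note wB = this[unfolded approx_def]
  have wW: "w k \<in> W" for k using wB by blast
  have sol: "weak_solution T (\<lambda>s \<zeta> x. L s \<zeta> x + B k s \<zeta> x) u0 ?F (w k)" for k using wB by blast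
  have B_cyl: "cyl_integrable T (\<lambda>s. B k s \<zeta>)" if "\<zeta> \<in> C0_inf" for k \<zeta> using wB that by blast
  have near: "\<exists>c. (\<forall>i\<in>{1..n}. norm (c i) \<le> C \<and> dist (c i) (affine_coords (\<mu> i s)) < inverse (real (Suc k))) \<and>
      (\<forall>\<zeta>\<in>C0_inf. \<forall>x. B k s \<zeta> x = (\<Sum>i=1..n. second_order \<zeta> (c i) x))" if "s \<in> {0<..<T}" for k s
    using wB that by blast
  have M_cyl: "cyl_integrable T (\<lambda>s. ?M s \<zeta>)" if "\<zeta> \<in> C0_inf" for \<zeta>
    by (rule second_diff_cyl_integrable[where \<mu>=\<mu>, OF N(1) \<mu> C that])
  show ?thesis
  proof (rule weak_solution_of_approximate_solutions[OF T W_bdd W_limits _ forcing_set_integrable[OF h] wW])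
    show "cyl_integrable T (\<lambda>s x. L s \<zeta> x + ?M s \<zeta> x)" if "\<zeta> \<in> C0_inf" for \<zeta>
      by (intro cyl_integrable_add L_cyl_integrable M_cyl that)
    fix \<zeta> :: "real^'n \<Rightarrow> real" and e :: real assume \<zeta>: "\<zeta> \<in> C0_inf" and e: "0 < e"
    obtain R where R: "\<And>e. e > 0 \<Longrightarrow> \<exists>d>0. \<forall>c c'. norm c \<le> C \<longrightarrow> norm c' \<le> C \<longrightarrow> dist c c' < d \<longrightarrow>
      (\<forall>x. \<bar>second_order \<zeta> c x - second_order \<zeta> c' x\<bar> \<le> e * indicator (cball 0 R) x)"
      using second_order_uniform[OF \<zeta>, of C] by metis
    define V where "V = measure lborel (cball (0::real^'n) R)"
    have V: "0 \<le> V" by (simp add: V_def)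
    define e' where "e' = e / (T * K * real n * V + 1)"
    have TK: "0 \<le> T * K * real n * V" using T K V by auto
    have e': "0 < e'" "T * (K * (real n * e' * V)) \<le> e"
      using e TK by (auto simp: e'_def divide_simps add_pos_nonneg mult_le_cancel_right1 mult_ac)
    obtain d where d: "d > 0" "\<And>c c' x. norm c \<le> C \<Longrightarrow> norm c' \<le> C \<Longrightarrow> dist c c' < d \<Longrightarrow>
        \<bar>second_order \<zeta> c x - second_order \<zeta> c' x\<bar> \<le> e' * indicator (cball 0 R) x"
      using R[OF e'(1)] by blast
    have "\<forall>\<^sub>F k in sequentially. inverse (real (Suc k)) < d"
      using order_tendstoD(2)[OF LIMSEQ_inverse_real_of_nat d(1)] .
    then show "\<forall>\<^sub>F k in sequentially. \<forall>t\<in>{0..T}. \<bar>residual (\<lambda>s \<zeta> x. L s \<zeta> x + ?M s \<zeta> x) u0 ?F (w k) \<zeta> t\<bar> \<le> e"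
    proof eventually_elim
      case (elim k)
      show ?case
      proof
        fix t assume t: "t \<in> {0..T}"
        let ?D = "\<lambda>s \<zeta> x. ?M s \<zeta> x - B k s \<zeta> x"
        have D_cyl: "cyl_integrable T (\<lambda>s. ?D s \<zeta>)"
          by (intro cyl_integrable_diff M_cyl B_cyl \<zeta>)
        note wb = W_bdd[OF wW[of k]]
        have "residual (\<lambda>s \<zeta> x. (L s \<zeta> x + B k s \<zeta> x) + ?D s \<zeta> x) u0 ?F (w k) \<zeta> t =
            residual (\<lambda>s \<zeta> x. L s \<zeta> x + B k s \<zeta> x) u0 ?F (w k) \<zeta> t - (LBINT s:{0<..<t}. pairing (\<lambda>x. w k (s, x)) (?D s \<zeta>))"
          by (rule residual_add_operator[where A="\<lambda>s \<zeta> x. L s \<zeta> x + B k s \<zeta> x" and B="?D" and \<zeta>=\<zeta>,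
                OF wb cyl_integrable_add[OF L_cyl_integrable[OF \<zeta>] B_cyl[OF \<zeta>]] D_cyl t])
        moreover have "(\<lambda>s \<zeta> x. (L s \<zeta> x + B k s \<zeta> x) + ?D s \<zeta> x) = (\<lambda>s \<zeta> x. L s \<zeta> x + ?M s \<zeta> x)"
          by (simp add: fun_eq_iff)
        moreover have "residual (\<lambda>s \<zeta> x. L s \<zeta> x + B k s \<zeta> x) u0 ?F (w k) \<zeta> t = 0"
          using sol[of k] \<zeta> t unfolding weak_solution_iff_residual by blast
        ultimately have eq: "residual (\<lambda>s \<zeta> x. L s \<zeta> x + ?M s \<zeta> x) u0 ?F (w k) \<zeta> t =
            - (LBINT s:{0<..<t}. pairing (\<lambda>x. w k (s, x)) (?D s \<zeta>))" by simp
        have D_le: "\<bar>?D s \<zeta> x\<bar> \<le> real n * e' * indicator (cball (0::real^'n) R) x" if s: "s \<in> {0<..<T}" for s x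
        proof -
          obtain c where c: "\<And>i. i \<in> {1..n} \<Longrightarrow> norm (c i) \<le> C" "\<And>i. i \<in> {1..n} \<Longrightarrow> dist (c i) (affine_coords (\<mu> i s)) < inverse (real (Suc k))"
            "B k s \<zeta> x = (\<Sum>i=1..n. second_order \<zeta> (c i) x)"
            using near[OF s, of k] \<zeta> by blast
          have sd: "second_diff (\<mu> i s) \<zeta> = second_order \<zeta> (affine_coords (\<mu> i s))" if "i \<in> {1..n}" for i
            using \<mu>[OF that] s N(1) by (intro second_diff_eq_second_order \<zeta>) (auto simp: bdd_meas_maps_def)
          have "?D s \<zeta> x = (\<Sum>i=1..n. second_order \<zeta> (affine_coords (\<mu> i s)) x - second_order \<zeta> (c i) x)"
            using sd by (simp add: c(3) sum_subtractf)
          also have "\<bar>\<dots>\<bar> \<le> (\<Sum>i=1..n. e' * indicator (cball 0 R) x)"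
          proof (rule order_trans[OF sum_abs sum_mono])
            fix i assume i: "i \<in> {1..n}"
            have "dist (affine_coords (\<mu> i s)) (c i) < d" using c(2)[OF i] elim by (simp add: dist_commute)
            then show "\<bar>second_order \<zeta> (affine_coords (\<mu> i s)) x - second_order \<zeta> (c i) x\<bar> \<le> e' * indicator (cball 0 R) x"
              by (rule d(2)[OF C[OF i s] c(1)[OF i]])
          qed
          finally show ?thesis by (simp add: mult.assoc)
        qed
        have iC: "integrable lborel (\<lambda>x. real n * e' * indicator (cball (0::real^'n) R) x)"
          by (intro integrable_mult_right integrable_indicator_cball)
        have sub: "set_integrable lborel {0<..<t} q" if "set_integrable lborel {0<..<T} q" for q :: "real \<Rightarrow> real"
          by (rule set_integrable_subset[OF that]) (use t in auto)
        have "\<bar>LBINT s:{0<..<t}. pairing (\<lambda>x. w k (s, x)) (?D s \<zeta>)\<bar> \<le> (LBINT s:{0<..<t}. K * (real n * e' * V))"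
        proof (rule set_integral_abs_le[OF sub[OF set_integrable_pairing[OF wb D_cyl]]])
          show "set_integrable lborel {0<..<t} (\<lambda>s. K * (real n * e' * V))"
            by (rule set_integral_const_greaterThanLessThan(1)) (use t in simp)
          show "AE s in lborel. s \<in> {0<..<t} \<longrightarrow> \<bar>pairing (\<lambda>x. w k (s, x)) (?D s \<zeta>)\<bar> \<le> K * (real n * e' * V)"
            using AE_pairing_le[OF wb D_cyl] cyl_integrable_AE[OF D_cyl]
          proof eventually_elim
            case (elim s)
            show ?case
            proof
              assume "s \<in> {0<..<t}"
              then have s: "s \<in> {0<..<T}" using t by auto
              have iD: "integrable lborel (\<lambda>x. \<bar>?D s \<zeta> x\<bar>)" using elim s by (intro integrable_abs) blast
              have "(\<integral>x. \<bar>?D s \<zeta> x\<bar> \<partial>lborel) \<le> (\<integral>x. real n * e' * indicator (cball (0::real^'n) R) x \<partial>lborel)"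
                by (rule integral_mono[OF iD iC D_le[OF s]])
              also have "\<dots> = real n * e' * V" by (simp add: V_def)
              finally have "K * (\<integral>x. \<bar>?D s \<zeta> x\<bar> \<partial>lborel) \<le> K * (real n * e' * V)" by (rule mult_left_mono[OF _ K])
              then show "\<bar>pairing (\<lambda>x. w k (s, x)) (?D s \<zeta>)\<bar> \<le> K * (real n * e' * V)"
                using elim s by linarith
            qed
          qed
        qed
        also have "\<dots> = (t - 0) * (K * (real n * e' * V))"
          by (rule set_integral_const_greaterThanLessThan(2)) (use t in simp)
        also have "\<dots> \<le> T * (K * (real n * e' * V))"
          using t K V e'(1) by (intro mult_right_mono mult_nonneg_nonneg) auto
        also have "\<dots> \<le> e" by (rule e'(2))
        finally show "\<bar>residual (\<lambda>s \<zeta> x. L s \<zeta> x + ?M s \<zeta> x) u0 ?F (w k) \<zeta> t\<bar> \<le> e" unfolding eq by simp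
      qed
    qed
  qed
qed

end

theorem theorem4p9:
  fixes T K :: real
    and N G :: "(real ^ 'n \<Rightarrow> real ^ 'n) set"
    and W :: "(real \<times> (real ^ 'n) \<Rightarrow> real) set"
    and L :: "real \<Rightarrow> (real ^ 'n \<Rightarrow> real) \<Rightarrow> real ^ 'n \<Rightarrow> real"
    and u0 :: "real ^ 'n \<Rightarrow> real"
    and f :: "real \<times> (real ^ 'n) \<Rightarrow> real"
    and n :: nat
    and \<mu> :: "nat \<Rightarrow> real \<Rightarrow> real ^ 'n \<Rightarrow> real ^ 'n"
    and h :: "real \<Rightarrow> real ^ 'n \<Rightarrow> real ^ 'n"
  assumes "0 < T" and "0 \<le> K"
    and "N \<subseteq> affine_maps"
    and "G = exp_set N"
    and "comm_group \<lparr>carrier = G, mult = (\<circ>), one = id\<rparr>"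
    and "\<forall>g\<in>G. volume_preserving g"
    and "W \<subseteq> extensional (strip T) \<inter> borel_measurable (restrict_space borel (strip T))"
    and "uniformly_bounded_class T K W"
    and "closed_under_expectation T W"
    and "closed_under_transformations T G W"
    and "closed_under_weak_limits T W"
    and "u0 \<in> bdd_borel_on UNIV"
    and "f \<in> bdd_borel_on ({0<..<T} \<times> UNIV)"
    and "operator_family T L"
    and "commutes_with T G L"
    and "integrable_on_test_functions T L"
    and "\<exists>U. solution_map T K G W L u0 f U"
    and "1 \<le> n"
    and "\<forall>i\<in>{1..n}. \<mu> i \<in> bdd_meas_maps {0<..<T} N"
    and "h \<in> bdd_meas_maps {0<..<T} G"
  shows "\<exists>u\<in>W. weak_solution T
           (\<lambda>s \<zeta> x. L s \<zeta> x + (\<Sum>i = 1..n. second_diff (\<mu> i s) \<zeta> x))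
           u0 (\<lambda>s x. f (s, h s x)) u"
proof -
  obtain U where U: "solution_map T K G W L u0 f U" using assms(17) by blast
  have exp_affine: "aff_exp \<nu> t \<in> affine_maps" if \<nu>: "\<nu> \<in> N" for \<nu> t
  proof -
    obtain a b where "\<nu> = (\<lambda>x. a *v x + b)" using \<nu> assms(3) by (auto simp: affine_maps_def)
    then show ?thesis by (simp add: aff_exp_eq_flow flow_affine)
  qed
  interpret evolution T K G W L u0 f U h
  proof (rule evolution.intro)
    show "G \<subseteq> affine_maps" unfolding assms(4) exp_set_def using exp_affine by blast
    show "group \<lparr>carrier = G, mult = (\<circ>), one = id\<rparr>" using assms(5) by (rule comm_group.axioms(2))
    show "bdd_on_strip T K w" if "w \<in> W" for w
      using that assms(7,8) by (auto simp: bdd_on_strip_def uniformly_bounded_class_def)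
    show "volume_preserving g" if "g \<in> G" for g using that assms(6) by blast
  qed (fact assms U)+
  show ?thesis
    by (rule measurable_directions[OF assms(3,4,18)]) (use assms(19) in blast)
qed

end
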